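(* Let $\mu$ be an invariant locally square-integrable random measure on $\mathbb{R}^n$. Then $$\limsup_{R\to+\infty}\frac{\mathrm{NV}_\mu(R)}{\mathrm{Vol}_{n-1}(\partial B_R)}>0 .$$
   Context: Let $n\in\mathbb{N}$, $n\ge 1$, and let $\mathscr{M}_+(\mathbb{R}^n)$ be the set of positive locally finite Borel measures on $\mathbb{R}^n$, with the smallest $\sigma$-algebra making all maps $p\mapsto p(f)=\int f\,dp$ measurable, where $f$ ranges over bounded measurable complex-valued functions with bounded support. A random measure on $\mathbb{R}^n$ is a probability measure $\mu$ on $\mathscr{M}_+(\mathbb{R}^n)$. It is invariant if it is preserved by push-forward under all translations of $\mathbb{R}^n$, and locally square-integrable if $\int p(B)^2\,d\mu(p)<\infty$ for all bounded Borel sets $B\subset\mathbb{R}^n$. The intensity $\iota_\mu>0$ of such a $\mu$ is the constant with $\int p(B)\,d\mu(p)=\iota_\mu\,\mathrm{Vol}_{\mathbb{R}^n}(B)$ for all bounded Borel sets $B$, where $\mathrm{Vol}_{\mathbb{R}^n}$ is Lebesgue measure. $B_R$ is the Euclidean ball of radius $R$ centered at the origin, and $\mathrm{Vol}_{n-1}(\partial B_R)$ is the $(n-1)$-dimensional volume of its boundary sphere (for $n=1$, the number of boundary points). The number variance is $$\mathrm{NV}_\mu(R)=\int_{\mathscr{M}_+(\mathbb{R}^n)}|p(B_R)-\iota_\mu\mathrm{Vol}_{\mathbb{R}^n}(B_R)|^2\,d\mu(p),$$ i.e. the $\mu$-variance of $p\mapsto p(B_R)$. The limit superior may be $+\inf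ty$.
   Formalization: The formal theorem additionally assumes that it is not the case that p equals ι_μ times Lebesgue measure for μ-almost every p; in exactly that case the number variance vanishes identically and the claim fails. *)

theory Defs
  imports "HOL-Probability.Probability"
begin

text \<open>Locally finite is meant in the sense of random measure theory: finite on bounded Borel sets.
  In a Euclidean space this is the same as every point having a neighbourhood of finite measure.\<close>

definition locally_finite_measures :: "'a::euclidean_space measure set" where
  "locally_finite_measures =
     {p. sets p = sets borel \<and> (\<forall>B\<in>sets borel. bounded B \<longrightarrow> emeasure p B < \<infinity>)}"

definition test_functions :: "('a::euclidean_space \<Rightarrow> complex) set" where
  "test_functions = {f \<in> borel_measurable borel. bounded (range f) \<and> bounded {x. f x \<noteq> 0}}"

definition measure_space_of_measures :: "'a::euclidean_space measure measure" where
  "measure_space_of_measures = sigma locally_finite_measures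
     {(\<lambda>p. integral\<^sup>L p f) -` A \<inter> locally_finite_measures | f A.
        f \<in> test_functions \<and> A \<in> sets borel}"

definition random_measure :: "'a::euclidean_space measure measure \<Rightarrow> bool" where
  "random_measure M \<longleftrightarrow> prob_space M \<and> sets M = sets measure_space_of_measures"

definition translate_measure :: "'a::euclidean_space \<Rightarrow> 'a measure \<Rightarrow> 'a measure" where
  "translate_measure t p = distr p borel (\<lambda>x. x + t)"

definition translation_invariant :: "'a::euclidean_space measure measure \<Rightarrow> bool" where
  "translation_invariant M \<longleftrightarrow> (\<forall>t. distr M measure_space_of_measures (translate_measure t) = M)"

definition locally_square_integrable :: "'a::euclidean_space measure measure \<Rightarrow> bool" where
  "locally_square_integrable M \<longleftrightarrow>
     (\<forall>B\<in>sets borel. bounded B \<longrightarrow> (\<integral>\<^sup>+p. (emeasure p B)\<^sup>2 \<partial>M) < \<infinity>)"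

definition intensity :: "'a::euclidean_space measure measure \<Rightarrow> real" where
  "intensity M = (THE c. \<forall>B\<in>sets borel. bounded B \<longrightarrow>
     (\<integral>p. measure p B \<partial>M) = c * measure lborel B)"

definition number_variance :: "'a::euclidean_space measure measure \<Rightarrow> real \<Rightarrow> ennreal" where
  "number_variance M R =
     (\<integral>\<^sup>+p. ennreal (\<bar>measure p (ball 0 R) - intensity M * measure lborel (ball (0 :: 'a) R)\<bar>\<^sup>2) \<partial>M)"

text \<open>The \<open>k\<close>-dimensional volume of a set is its \<open>k\<close>-dimensional Hausdorff measure, normalised so that
  it is surface area for smooth hypersurfaces (\<open>k = n - 1\<close>) and counting measure for \<open>k = 0\<close>.
  The empty set needs a separate clause because \<open>0 ^ 0 = 1\<close>, and boundedness is
  required explicitly because \<^const>\<open>diameter\<close> is meaningless on unbounded sets.\<close>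

definition hausdorff_premeasure :: "nat \<Rightarrow> real \<Rightarrow> 'a::euclidean_space set \<Rightarrow> ennreal" where
  "hausdorff_premeasure k \<delta> A =
     (INF E \<in> {E :: nat \<Rightarrow> 'a set. A \<subseteq> (\<Union>i. E i) \<and> (\<forall>i. bounded (E i) \<and> diameter (E i) \<le> \<delta>)}.
        \<Sum>i. if E i = {} then 0 else ennreal (unit_ball_vol (real k) * (diameter (E i) / 2) ^ k))"

definition hausdorff_measure :: "nat \<Rightarrow> 'a::euclidean_space set \<Rightarrow> ennreal" where
  "hausdorff_measure k A = (SUP \<delta>\<in>{0<..}. hausdorff_premeasure k \<delta> A)"

text \<open>The deterministic random measure concentrated on a multiple of Lebesgue measure is invariant,
  locally square-integrable and of positive intensity, but its number variance vanishes
  identically.  It has to be excluded from any lower bound on the number variance.\<close>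

definition almost_surely_lebesgue :: "'a::euclidean_space measure measure \<Rightarrow> bool" where
  "almost_surely_lebesgue M \<longleftrightarrow> (AE p in M. p = scale_measure (ennreal (intensity M)) lborel)"

end

theory Submission
  imports Defs
begin

text \<open>The proof compares balls with Gaussians inside the second moment of the random measure.

Let \<open>\<alpha> = E[p \<otimes> p]\<close> be the second moment measure on \<open>\<real>\<^sup>n \<times> \<real>\<^sup>n\<close>, written \<open>pair_moment\<close>, and write \<open>\<iota>\<close> for
the intensity.  Stationarity makes \<open>\<alpha>\<close> invariant under diagonal shifts, so \<open>\<integral>H d\<alpha>\<close> depends on
a nonnegative \<open>H\<close> only through its diagonal integrals \<open>\<integral>H (x + t, y + t) dt\<close>
(\<open>nn_integral_diagonal_invariant\<close>).  The same is true of Lebesgue measure on the product, and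
\<open>\<alpha> (B\<^sub>R \<times> B\<^sub>R) = (\<iota> vol B\<^sub>R)\<^sup>2 + NV(R)\<close>.  Hence any identity between diagonal integrals turns into an
identity between variances.

Averaging the indicators of \<open>B\<^sub>R \<times> B\<^sub>R\<close> over \<open>R\<close> with weight \<open>2\<kappa>R exp (-\<kappa>R\<^sup>2)\<close> gives
\<open>exp (-\<kappa> max (|x|,|y|)\<^sup>2)\<close>.  With \<open>r = |x - y| / 2\<close>, its diagonal integral is
\<open>2 (\<pi>/\<kappa>)\<^bsup>(n-1)/2\<^esup> \<integral>\<^sub>r\<^sup>\<infinity> exp (-\<kappa>s\<^sup>2) ds\<close>, and this Gaussian tail is a mixture of
Gaussians \<open>exp (-\<tau>r\<^sup>2)\<close>, \<open>\<tau> > \<kappa>\<close>, with the positive weight \<open>(\<tau> - \<kappa>)\<^bsup>-1/2\<^esup> / \<tau>\<close> up to a constant.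
Up to a constant, each of these Gaussians is in turn the diagonal integral of a product
\<open>exp (-\<tau>|x|\<^sup>2/2) exp (-\<tau>|y|\<^sup>2/2)\<close>.  Therefore a weighted average of \<open>NV(R)\<close> equals an average, with
positive weights, of the variances \<open>V(\<tau>)\<close> of \<open>\<integral> exp (-\<tau>|x|\<^sup>2/2) dp\<close>
(\<open>nn_integral_ball_pair_eq_mixture\<close>).

Suppose now that \<open>NV(R) = o(R\<^bsup>n-1\<^esup>)\<close>.  With the normalisation \<open>\<pi>\<^bsup>1/2\<^esup> (\<kappa>/\<pi>)\<^bsup>(n-1)/2\<^esup>\<close> the average of
\<open>NV\<close> tends to \<open>0\<close> as \<open>\<kappa> \<rightarrow> 0\<close>, while the weight of each \<open>V(\<tau>)\<close> stays bounded below.  As the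
\<open>V(\<tau>)\<close> are nonnegative, they vanish for arbitrarily large \<open>\<tau>\<close>
(\<open>gauss_pair_moment_eq\<close>).  These Gaussians concentrate at a point, so Fatou's lemma gives
\<open>E[p(U)\<^sup>2] \<le> (E[p(U)])\<^sup>2\<close> for bounded open \<open>U\<close>.  Thus \<open>p(U) = \<iota> vol U\<close> almost surely, and a
countable generating family of sets \<open>U\<close> shows that \<open>p\<close> is almost surely \<open>\<iota>\<close> times Lebesgue measure.
So unless \<open>p\<close> is almost surely that measure, \<open>NV(R) > \<epsilon> R\<^bsup>n-1\<^esup>\<close> for some \<open>\<epsilon> > 0\<close> and arbitrarily
large \<open>R\<close>.

The Hausdorff measure of the sphere enters only through an upper bound of order \<open>R\<^bsup>n-1\<^esup>\<close>, which
comes from projecting a grid on the faces of a cube to the sphere (\<open>hausdorff_measure_sphere_le\<close>).\<close>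

section \<open>Random measures and their measurability\<close>

lemma space_measure_space_of_measures:
  "space measure_space_of_measures = locally_finite_measures"
  by (simp add: measure_space_of_measures_def space_measure_of_conv)

lemma borel_measurable_integral_test_function:
  fixes f :: "'a::euclidean_space \<Rightarrow> complex"
  assumes "f \<in> test_functions"
  shows "(\<lambda>p. integral\<^sup>L p f) \<in> borel_measurable measure_space_of_measures"
proof (rule measurableI)
  fix A :: "complex set" assume "A \<in> sets borel"
  then show "(\<lambda>p. integral\<^sup>L p f) -` A \<inter> space measure_space_of_measures \<in> sets measure_space_of_measures"
    unfolding space_measure_space_of_measures unfolding measure_space_of_measures_def
    using assms by (subst sets_measure_of) (auto intro!: sigma_sets.Basic)
qed simp

lemma measurable_translate_measure:
  "translate_measure (t::'a::euclidean_space) \<in> measurable measure_space_of_measures measure_space_of_measures"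
proof -
  have lf: "translate_measure t p \<in> locally_finite_measures" if "p \<in> locally_finite_measures" for p :: "'a measure"
  proof -
    have p: "sets p = sets borel" and fin: "\<And>B. B \<in> sets borel \<Longrightarrow> bounded B \<Longrightarrow> emeasure p B < \<infinity>"
      using that by (auto simp: locally_finite_measures_def)
    have [measurable]: "(\<lambda>x. x + t) \<in> measurable p borel"
      using p by (simp cong: measurable_cong_sets)
    have "emeasure (distr p borel (\<lambda>x. x + t)) B < \<infinity>" if B: "B \<in> sets borel" "bounded B" for B
    proof -
      have "(\<lambda>x. x + t) -` B = (\<lambda>x. - t + x) ` B"
        by (auto intro: image_eqI[where x="_ + t"])
      moreover have "bounded ((\<lambda>x. - t + x) ` B)"
        using B(2) by (rule bounded_translation)
      moreover have "(\<lambda>x. x + t) -` B \<in> sets borel"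
        using measurable_sets[of "\<lambda>x. x + t" borel borel B] B by simp
      ultimately have "emeasure p ((\<lambda>x. x + t) -` B) < \<infinity>"
        using fin by metis
      moreover have "space p = UNIV" using p sets_eq_imp_space_eq by fastforce
      ultimately show ?thesis
        using B by (subst emeasure_distr) auto
    qed
    then show ?thesis
      by (auto simp: locally_finite_measures_def translate_measure_def)
  qed
  show ?thesis
    unfolding measure_space_of_measures_def[where 'a='a]
  proof (rule measurable_measure_of)
    show "{(\<lambda>p. integral\<^sup>L p f) -` A \<inter> locally_finite_measures |f A. f \<in> test_functions \<and> A \<in> sets borel}
      \<subseteq> Pow locally_finite_measures" by auto
  next
    show "translate_measure t \<in> space (sigma locally_finite_measures
             {(\<lambda>p. integral\<^sup>L p f) -` A \<inter> locally_finite_measures |f A. f \<in> test_functions \<and> A \<in> sets borel})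
        \<rightarrow> locally_finite_measures"
      using lf by (auto simp: space_measure_of_conv)
  next
    fix y :: "'a measure set"
    assume "y \<in> {(\<lambda>p. integral\<^sup>L p f) -` A \<inter> locally_finite_measures |f A. f \<in> test_functions \<and> A \<in> sets borel}"
    then obtain f :: "'a \<Rightarrow> complex" and A where
      y: "y = (\<lambda>p. integral\<^sup>L p f) -` A \<inter> locally_finite_measures" and f: "f \<in> test_functions" and A: "A \<in> sets borel"
      by auto
    have fm [measurable]: "f \<in> borel_measurable borel" using f by (auto simp: test_functions_def)
    define g where "g x = f (x + t)" for x
    have "g \<in> test_functions"
    proof -
      have "{x. g x \<noteq> 0} = (\<lambda>x. - t + x) ` {x. f x \<noteq> 0}"
        by (auto simp: g_def add.commute intro: image_eqI[where x="_ + t"])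
      then have "bounded {x. g x \<noteq> 0}"
        using f bounded_translation[of "{x. f x \<noteq> 0}" "- t"] by (simp add: test_functions_def)
      moreover have "bounded (range g)"
        using f by (intro bounded_subset[of "range f" "range g"]) (auto simp: test_functions_def g_def)
      ultimately show ?thesis by (simp add: test_functions_def g_def[abs_def])
    qed
    then have "(\<lambda>p. integral\<^sup>L p g) -` A \<inter> locally_finite_measures \<in> sets measure_space_of_measures"
      using measurable_sets[OF borel_measurable_integral_test_function[of g] A]
      by (simp add: space_measure_space_of_measures)
    moreover have "integral\<^sup>L (translate_measure t p) f = integral\<^sup>L p g" if "p \<in> locally_finite_measures" for p
    proof -
      have [measurable_cong]: "sets p = sets borel" using that by (auto simp: locally_finite_measures_def)
      show ?thesis unfolding translate_measure_def g_def
        by (subst integral_distr) auto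
    qed
    then have "translate_measure t -` y \<inter> locally_finite_measures
        = (\<lambda>p. integral\<^sup>L p g) -` A \<inter> locally_finite_measures"
      using lf by (auto simp: y)
    ultimately show "translate_measure t -` y \<inter> space (sigma locally_finite_measures
             {(\<lambda>p. integral\<^sup>L p f) -` A \<inter> locally_finite_measures |f A. f \<in> test_functions \<and> A \<in> sets borel})
        \<in> sets (sigma locally_finite_measures
             {(\<lambda>p. integral\<^sup>L p f) -` A \<inter> locally_finite_measures |f A. f \<in> test_functions \<and> A \<in> sets borel})"
      by (simp add: space_measure_of_conv measure_space_of_measures_def)
  qed
qed

locale stationary_random_measure =
  fixes M :: "'a::euclidean_space measure measure"
  assumes random: "random_measure M"
    and invariant: "translation_invariant M"
    and square_integrable: "locally_square_integrable M"
begin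

sublocale prob_space M
  using random by (simp add: random_measure_def)

lemma sets_M: "sets M = sets measure_space_of_measures"
  using random by (simp add: random_measure_def)

lemma space_M: "space M = locally_finite_measures"
  using sets_eq_imp_space_eq[OF sets_M] by (simp add: space_measure_space_of_measures)

lemma sets_realisation: "p \<in> space M \<Longrightarrow> sets p = sets borel"
  by (auto simp: space_M locally_finite_measures_def)

lemma space_realisation: "p \<in> space M \<Longrightarrow> space p = UNIV"
  using sets_eq_imp_space_eq[OF sets_realisation] by auto

lemma finite_realisation:
  "p \<in> space M \<Longrightarrow> B \<in> sets borel \<Longrightarrow> bounded B \<Longrightarrow> emeasure p B < \<infinity>"
  by (auto simp: space_M locally_finite_measures_def)

lemma emeasure_realisation:
  assumes "p \<in> space M" "B \<in> sets borel" "bounded B"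
  shows "emeasure p B = ennreal (measure p B)"
  using finite_realisation[OF assms] by (simp add: emeasure_eq_ennreal_measure)

lemma sigma_finite_realisation:
  assumes "p \<in> space M"
  shows "sigma_finite_measure p"
proof
  show "\<exists>A. countable A \<and> A \<subseteq> sets p \<and> \<Union> A = space p \<and> (\<forall>a\<in>A. emeasure p a \<noteq> \<infinity>)"
  proof (intro exI conjI ballI)
    show "(\<Union>N. {ball 0 (real N)}) \<subseteq> sets p" by (auto simp: sets_realisation[OF assms])
    show "\<Union> (\<Union>N. {ball (0::'a) (real N)}) = space p"
      by (auto simp: space_realisation[OF assms] reals_Archimedean2)
    fix a :: "'a set" assume "a \<in> (\<Union>N. {ball 0 (real N)})"
    then show "emeasure p a \<noteq> \<infinity>" using finite_realisation[OF assms, of a] by auto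
  qed auto
qed

lemma borel_measurable_emeasure_bounded:
  assumes "B \<in> sets borel" "bounded B"
  shows "(\<lambda>p. emeasure p B) \<in> borel_measurable M"
proof -
  define f :: "'a \<Rightarrow> complex" where "f = indicator B"
  have "bounded (range f)"
    by (rule boundedI[of _ 1]) (auto simp: f_def indicator_def)
  moreover have "{x. f x \<noteq> 0} = B" by (auto simp: f_def indicator_def)
  ultimately have "f \<in> test_functions"
    using assms by (auto simp: test_functions_def f_def)
  then have "(\<lambda>p. integral\<^sup>L p f) \<in> borel_measurable M"
    using borel_measurable_integral_test_function by (simp add: sets_M cong: measurable_cong_sets)
  then have "(\<lambda>p. ennreal (Re (integral\<^sup>L p f))) \<in> borel_measurable M" by measurable
  moreover have "ennreal (Re (integral\<^sup>L p f)) = emeasure p B" if p: "p \<in> space M" for p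
  proof -
    have "(LINT x|p. indicator B x :: complex) = of_real (measure p B)"
    proof -
      have "(LINT x|p. indicator B x :: complex) = (LINT x|p. complex_of_real (indicator B x))"
        by (intro Bochner_Integration.integral_cong) (auto simp: indicator_def)
      also have "\<dots> = complex_of_real (LINT x|p. indicator B x)"
        by (rule integral_complex_of_real)
      also have "(LINT x|p. indicator B x) = measure p B"
        by (simp add: space_realisation[OF p])
      finally show ?thesis .
    qed
    then show ?thesis using emeasure_realisation[OF p assms] by (simp add: f_def)
  qed
  ultimately show ?thesis by (simp cong: measurable_cong)
qed

text \<open>The restriction to a bounded square makes all the product measures finite, so that the sets with a
measurable evaluation form a Dynkin system; it contains the rectangles.\<close>

lemma borel_measurable_emeasure_product_bounded:
  assumes "A \<in> sets (borel :: ('a \<times> 'a) measure)"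
  shows "(\<lambda>p. emeasure (p \<Otimes>\<^sub>M p) (A \<inter> ball 0 (real N) \<times> ball 0 (real N))) \<in> borel_measurable M"
proof -
  let ?Q = "ball (0::'a) (real N)"
  have A: "A \<in> sigma_sets UNIV {a \<times> b | a b. a \<in> sets (borel::'a measure) \<and> b \<in> sets (borel::'a measure)}"
    using assms by (simp add: borel_prod[symmetric] sets_pair_measure)
  have "{a \<times> b | a b. a \<in> sets (borel::'a measure) \<and> b \<in> sets (borel::'a measure)} \<subseteq> Pow UNIV"
    by simp
  from Int_stable_pair_measure_generator[of "borel::'a measure" "borel::'a measure"] this A
  show ?thesis
  proof (induct rule: sigma_sets_induct_disjoint)
    case (basic A)
    then obtain a b where A: "A = a \<times> b" "a \<in> sets borel" "b \<in> sets borel" by auto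
    have "emeasure (p \<Otimes>\<^sub>M p) (A \<inter> ?Q \<times> ?Q) = emeasure p (a \<inter> ?Q) * emeasure p (b \<inter> ?Q)"
      if p: "p \<in> space M" for p
    proof -
      interpret sigma_finite_measure p by (rule sigma_finite_realisation[OF p])
      have "A \<inter> ?Q \<times> ?Q = (a \<inter> ?Q) \<times> (b \<inter> ?Q)" by (auto simp: A)
      then show ?thesis
        using A by (simp add: emeasure_pair_measure_Times sets_realisation[OF p])
    qed
    moreover have "(\<lambda>p. emeasure p (a \<inter> ?Q) * emeasure p (b \<inter> ?Q)) \<in> borel_measurable M"
      using A by (intro borel_measurable_times_ennreal borel_measurable_emeasure_bounded) auto
    ultimately show ?case by (simp cong: measurable_cong)
  next
    case empty show ?case by simp
  next
    case (compl A)
    have A: "A \<in> sets (borel :: ('a\<times>'a) measure)"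
      using compl(1) by (simp add: borel_prod[symmetric] sets_pair_measure)
    have "emeasure (p \<Otimes>\<^sub>M p) ((UNIV - A) \<inter> ?Q \<times> ?Q) =
      emeasure p ?Q * emeasure p ?Q - emeasure (p \<Otimes>\<^sub>M p) (A \<inter> ?Q \<times> ?Q)"
      if p: "p \<in> space M" for p
    proof -
      interpret sigma_finite_measure p by (rule sigma_finite_realisation[OF p])
      have s: "sets (p \<Otimes>\<^sub>M p) = sets borel"
        unfolding borel_prod[symmetric] by (intro sets_pair_measure_cong sets_realisation p)
      have Q: "?Q \<times> ?Q \<in> sets borel" unfolding borel_prod[symmetric] by auto
      have eq: "emeasure (p \<Otimes>\<^sub>M p) (?Q \<times> ?Q) = emeasure p ?Q * emeasure p ?Q"
        by (simp add: emeasure_pair_measure_Times sets_realisation[OF p])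
      have fin: "emeasure (p \<Otimes>\<^sub>M p) (?Q \<times> ?Q) < \<infinity>"
        unfolding eq using finite_realisation[OF p, of ?Q] by (simp add: ennreal_mult_less_top)
      have "(UNIV - A) \<inter> ?Q \<times> ?Q = ?Q \<times> ?Q - (A \<inter> ?Q \<times> ?Q)" by auto
      moreover have "emeasure (p \<Otimes>\<^sub>M p) (A \<inter> ?Q \<times> ?Q) \<noteq> \<infinity>"
        using fin emeasure_mono[of "A \<inter> ?Q \<times> ?Q" "?Q \<times> ?Q" "p \<Otimes>\<^sub>M p"] s Q by (auto simp: top_unique)
      ultimately show ?thesis
        using A Q by (simp add: emeasure_Diff s eq)
    qed
    moreover have "(\<lambda>p. emeasure p ?Q * emeasure p ?Q - emeasure (p \<Otimes>\<^sub>M p) (A \<inter> ?Q \<times> ?Q)) \<in> borel_measurable M"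
      using compl(2) borel_measurable_emeasure_bounded[of ?Q]
      by (intro borel_measurable_minus_ennreal borel_measurable_times_ennreal) auto
    ultimately show ?case by (simp cong: measurable_cong)
  next
    case (union A)
    have A: "A i \<in> sets (borel :: ('a\<times>'a) measure)" for i
      using union(2) by (auto simp: borel_prod[symmetric] sets_pair_measure)
    have "emeasure (p \<Otimes>\<^sub>M p) ((\<Union>i. A i) \<inter> ?Q \<times> ?Q) = (\<Sum>i. emeasure (p \<Otimes>\<^sub>M p) (A i \<inter> ?Q \<times> ?Q))"
      if p: "p \<in> space M" for p
    proof -
      have s: "sets (p \<Otimes>\<^sub>M p) = sets borel"
        unfolding borel_prod[symmetric] by (intro sets_pair_measure_cong sets_realisation p)
      have Q: "?Q \<times> ?Q \<in> sets borel" unfolding borel_prod[symmetric] by auto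
      have "(\<Union>i. A i) \<inter> ?Q \<times> ?Q = (\<Union>i. A i \<inter> ?Q \<times> ?Q)" by auto
      moreover have "disjoint_family (\<lambda>i. A i \<inter> ?Q \<times> ?Q)"
        using union(1) by (auto simp: disjoint_family_on_def)
      ultimately show ?thesis
        using A Q s by (subst suminf_emeasure) auto
    qed
    moreover have "(\<lambda>p. \<Sum>i. emeasure (p \<Otimes>\<^sub>M p) (A i \<inter> ?Q \<times> ?Q)) \<in> borel_measurable M"
      using union(3) by (intro borel_measurable_suminf_order) auto
    ultimately show ?case by (simp cong: measurable_cong)
  qed
qed

lemma sets_realisation_product:
  assumes "p \<in> space M" shows "sets (p \<Otimes>\<^sub>M p) = sets borel"
  unfolding borel_prod[symmetric] by (intro sets_pair_measure_cong sets_realisation assms)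

lemma borel_measurable_emeasure_product:
  assumes A: "A \<in> sets (borel :: ('a \<times> 'a) measure)"
  shows "(\<lambda>p. emeasure (p \<Otimes>\<^sub>M p) A) \<in> borel_measurable M"
proof -
  let ?Q = "\<lambda>N. ball (0::'a) (real N)"
  have "emeasure (p \<Otimes>\<^sub>M p) A = (SUP N. emeasure (p \<Otimes>\<^sub>M p) (A \<inter> ?Q N \<times> ?Q N))" if p: "p \<in> space M" for p
  proof -
    have Q: "?Q N \<times> ?Q N \<in> sets borel" for N unfolding borel_prod[symmetric] by auto
    have "(\<Union>N. A \<inter> ?Q N \<times> ?Q N) = A"
    proof safe
      fix x y assume xy: "(x, y) \<in> A"
      obtain N where "real N > max (norm x) (norm y)" using reals_Archimedean2 by blast
      then show "(x, y) \<in> (\<Union>N. A \<inter> ?Q N \<times> ?Q N)" using xy by auto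
    qed
    moreover have "incseq (\<lambda>N. A \<inter> ?Q N \<times> ?Q N)"
      by (fastforce simp: incseq_def)
    ultimately show ?thesis
      using A Q by (subst SUP_emeasure_incseq) (auto simp: sets_realisation_product[OF p])
  qed
  moreover have "(\<lambda>p. SUP N. emeasure (p \<Otimes>\<^sub>M p) (A \<inter> ?Q N \<times> ?Q N)) \<in> borel_measurable M"
    by (intro borel_measurable_SUP borel_measurable_emeasure_product_bounded A) auto
  ultimately show ?thesis by (simp cong: measurable_cong)
qed

lemma borel_measurable_emeasure:
  assumes A: "A \<in> sets borel"
  shows "(\<lambda>p. emeasure p A) \<in> borel_measurable M"
proof -
  let ?Q = "\<lambda>N. ball (0::'a) (real N)"
  have "emeasure p A = (SUP N. emeasure p (A \<inter> ?Q N))" if p: "p \<in> space M" for p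
  proof -
    have "(\<Union>N. A \<inter> ?Q N) = A" by (auto simp: reals_Archimedean2)
    moreover have "incseq (\<lambda>N. A \<inter> ?Q N)" by (fastforce simp: incseq_def)
    ultimately show ?thesis
      using A by (subst SUP_emeasure_incseq) (auto simp: sets_realisation[OF p])
  qed
  moreover have "(\<lambda>p. SUP N. emeasure p (A \<inter> ?Q N)) \<in> borel_measurable M"
    using A by (intro borel_measurable_SUP borel_measurable_emeasure_bounded) (auto simp: bounded_Int)
  ultimately show ?thesis by (simp cong: measurable_cong)
qed

text \<open>Invariance is used in this form only: integrating a functional of \<open>p\<close> against \<open>M\<close> does not see a
translation of \<open>p\<close>.\<close>

lemma nn_integral_translate:
  assumes "F \<in> borel_measurable M"
  shows "(\<integral>\<^sup>+p. F (translate_measure t p) \<partial>M) = (\<integral>\<^sup>+p. F p \<partial>M)"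
proof -
  have t: "translate_measure t \<in> measurable M measure_space_of_measures"
    using measurable_translate_measure sets_M by (simp cong: measurable_cong_sets)
  have "(\<integral>\<^sup>+p. F p \<partial>M) = (\<integral>\<^sup>+p. F p \<partial>distr M measure_space_of_measures (translate_measure t))"
    using invariant by (simp add: translation_invariant_def)
  also have "\<dots> = (\<integral>\<^sup>+p. F (translate_measure t p) \<partial>M)"
    using assms t by (subst nn_integral_distr) (auto simp: sets_M cong: measurable_cong_sets)
  finally show ?thesis by simp
qed

end

section \<open>Averages of random measures\<close>

text \<open>This is the monadic bind of \<open>M\<close> with a family of measures that may be infinite, which places it
outside the Giry monad of subprobability measures.\<close>

definition mixture :: "'b measure \<Rightarrow> ('b \<Rightarrow> 'c::topological_space measure) \<Rightarrow> 'c measure" where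
  "mixture M K = measure_of UNIV (sets borel) (\<lambda>A. \<integral>\<^sup>+p. emeasure (K p) A \<partial>M)"

lemma sets_mixture [measurable_cong]: "sets (mixture M K) = sets borel"
  using sets.sigma_sets_eq[of borel] by (simp add: mixture_def)

lemma space_mixture [simp]: "space (mixture M K) = UNIV"
  by (simp add: mixture_def space_measure_of_conv)

locale kernel =
  fixes M :: "'b measure" and K :: "'b \<Rightarrow> 'c::topological_space measure"
  assumes sets_kernel: "\<And>p. p \<in> space M \<Longrightarrow> sets (K p) = sets borel"
    and measurable_kernel: "\<And>A. A \<in> sets borel \<Longrightarrow> (\<lambda>p. emeasure (K p) A) \<in> borel_measurable M"
begin

lemma emeasure_mixture:
  assumes "A \<in> sets borel"
  shows "emeasure (mixture M K) A = (\<integral>\<^sup>+p. emeasure (K p) A \<partial>M)"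
proof (rule emeasure_measure_of[OF mixture_def])
  show "countably_additive (sets (mixture M K)) (\<lambda>A. \<integral>\<^sup>+p. emeasure (K p) A \<partial>M)"
  proof (rule countably_additiveI)
    fix A :: "nat \<Rightarrow> 'c set"
    assume A: "range A \<subseteq> sets (mixture M K)" "disjoint_family A"
    have "(\<Sum>i. \<integral>\<^sup>+p. emeasure (K p) (A i) \<partial>M) = (\<integral>\<^sup>+p. (\<Sum>i. emeasure (K p) (A i)) \<partial>M)"
      using A by (intro nn_integral_suminf[symmetric] measurable_kernel) (auto simp: sets_mixture)
    also have "\<dots> = (\<integral>\<^sup>+p. emeasure (K p) (\<Union>i. A i) \<partial>M)"
      using A by (intro nn_integral_cong suminf_emeasure) (auto simp: sets_mixture sets_kernel)
    finally show "(\<Sum>i. \<integral>\<^sup>+p. emeasure (K p) (A i) \<partial>M) = (\<integral>\<^sup>+p. emeasure (K p) (\<Union>i. A i) \<partial>M)" .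
  qed
qed (use assms in \<open>auto simp: positive_def sets_mixture\<close>)

lemma nn_integral_mixture:
  assumes "f \<in> borel_measurable borel"
  shows "(\<lambda>p. \<integral>\<^sup>+x. f x \<partial>K p) \<in> borel_measurable M \<and>
    (\<integral>\<^sup>+x. f x \<partial>mixture M K) = (\<integral>\<^sup>+p. \<integral>\<^sup>+x. f x \<partial>K p \<partial>M)"
  using assms
proof (induct f rule: borel_measurable_induct)
  case (cong f g)
  then have "f = g" by auto
  with cong show ?case by simp
next
  case (set A)
  have "(\<integral>\<^sup>+x. indicator A x \<partial>K p) = emeasure (K p) A" if "p \<in> space M" for p
    using set that by (simp add: sets_kernel)
  then show ?case
    using measurable_kernel[OF set] emeasure_mixture[OF set] set
    by (simp add: sets_mixture cong: measurable_cong nn_integral_cong)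
next
  case (mult u v)
  have u [measurable]: "u \<in> borel_measurable borel" by fact
  have "(\<integral>\<^sup>+x. v * u x \<partial>K p) = v * (\<integral>\<^sup>+x. u x \<partial>K p)" if "p \<in> space M" for p
    using that sets_kernel by (intro nn_integral_cmult) (simp cong: measurable_cong_sets)
  then show ?case
    using mult by (simp add: nn_integral_cmult borel_measurable_times_ennreal cong: measurable_cong nn_integral_cong)
next
  case (add u v)
  have [measurable]: "u \<in> borel_measurable borel" "v \<in> borel_measurable borel" by fact+
  have "(\<integral>\<^sup>+x. v x + u x \<partial>K p) = (\<integral>\<^sup>+x. v x \<partial>K p) + (\<integral>\<^sup>+x. u x \<partial>K p)" if "p \<in> space M" for p
    using that sets_kernel by (intro nn_integral_add) (simp_all cong: measurable_cong_sets)
  then show ?case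
    using add by (simp add: nn_integral_add borel_measurable_add cong: measurable_cong nn_integral_cong)
next
  case (seq U)
  have U [measurable]: "U i \<in> borel_measurable borel" for i by fact
  have 1: "(\<integral>\<^sup>+x. (SUP i. U i) x \<partial>K p) = (SUP i. \<integral>\<^sup>+x. U i x \<partial>K p)" if "p \<in> space M" for p
    unfolding SUP_apply using that sets_kernel seq
    by (intro nn_integral_monotone_convergence_SUP) (simp_all cong: measurable_cong_sets)
  have m: "(\<lambda>p. \<integral>\<^sup>+x. U i x \<partial>K p) \<in> borel_measurable M" for i using seq by auto
  have "(\<integral>\<^sup>+x. (SUP i. U i) x \<partial>mixture M K) = (SUP i. \<integral>\<^sup>+x. U i x \<partial>mixture M K)"
    unfolding SUP_apply using seq by (intro nn_integral_monotone_convergence_SUP) simp_all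
  also have "\<dots> = (SUP i. \<integral>\<^sup>+p. \<integral>\<^sup>+x. U i x \<partial>K p \<partial>M)" using seq by simp
  also have "\<dots> = (\<integral>\<^sup>+p. (SUP i. \<integral>\<^sup>+x. U i x \<partial>K p) \<partial>M)"
    using seq m
    by (intro nn_integral_monotone_convergence_SUP[symmetric])
       (auto simp: incseq_def le_fun_def intro!: nn_integral_mono)
  also have "\<dots> = (\<integral>\<^sup>+p. \<integral>\<^sup>+x. (SUP i. U i) x \<partial>K p \<partial>M)"
    using 1 by (intro nn_integral_cong) simp
  finally show ?case
    using m 1 by (simp cong: measurable_cong)
qed

end

section \<open>Measures invariant under shifts\<close>

lemma nn_integral_lborel_affine:
  fixes f :: "'a::euclidean_space \<Rightarrow> ennreal"
  assumes [measurable]: "f \<in> borel_measurable borel" and "c \<noteq> 0"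
  shows "(\<integral>\<^sup>+x. f x \<partial>lborel) = ennreal (\<bar>c\<bar> ^ DIM('a)) * (\<integral>\<^sup>+x. f (t + c *\<^sub>R x) \<partial>lborel)"
proof -
  have "(\<integral>\<^sup>+x. f x \<partial>lborel)
      = (\<integral>\<^sup>+x. f x \<partial>density (distr lborel borel (\<lambda>x. t + c *\<^sub>R x)) (\<lambda>_. ennreal (\<bar>c\<bar> ^ DIM('a))))"
    using lborel_affine[OF assms(2), of t] by simp
  then show ?thesis
    by (simp add: nn_integral_density nn_integral_distr nn_integral_cmult)
qed

lemma nn_integral_lborel_translate:
  fixes f :: "'a::euclidean_space \<Rightarrow> ennreal"
  assumes "f \<in> borel_measurable borel"
  shows "(\<integral>\<^sup>+x. f (t + x) \<partial>lborel) = (\<integral>\<^sup>+x. f x \<partial>lborel)"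
  using nn_integral_lborel_affine[OF assms, of 1 t] by simp

lemma nn_integral_lborel_reflect:
  fixes f :: "'a::euclidean_space \<Rightarrow> ennreal"
  assumes "f \<in> borel_measurable borel"
  shows "(\<integral>\<^sup>+x. f (t - x) \<partial>lborel) = (\<integral>\<^sup>+x. f x \<partial>lborel)"
  using nn_integral_lborel_affine[OF assms, of "-1" t] by simp

text \<open>The integral of \<open>H\<close> factors through its integrals along orbits: insert \<open>\<integral> 1\<^sub>W (\<pi> z - t) dt = vol W\<close>,
exchange the integrals and undo the shift by \<open>d t\<close>.  The map \<open>\<pi>\<close> reads off the position of a point on
its orbit, so \<open>W\<close> cuts out one window per orbit.  The case \<open>d t = t\<close> says that a shift-invariant
measure is a multiple of Lebesgue measure; the case \<open>d t = (t, t)\<close> serves for second moments.\<close>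

lemma nn_integral_shift_invariant:
  fixes \<alpha> :: "'b::euclidean_space measure" and d :: "'a::euclidean_space \<Rightarrow> 'b" and \<pi> :: "'b \<Rightarrow> 'a"
  assumes sets_\<alpha> [measurable_cong]: "sets \<alpha> = sets borel" and "sigma_finite_measure \<alpha>"
    and inv: "\<And>t. distr \<alpha> borel (\<lambda>z. z + d t) = \<alpha>"
    and [measurable]: "\<pi> \<in> borel_measurable borel" "d \<in> borel_measurable borel"
    and \<pi>: "\<And>z t. \<pi> (z + d t) = \<pi> z + t"
    and [measurable]: "H \<in> borel_measurable borel" "W \<in> sets borel"
  shows "emeasure lborel W * (\<integral>\<^sup>+z. H z \<partial>\<alpha>)
    = (\<integral>\<^sup>+z. indicator W (\<pi> z) * (\<integral>\<^sup>+t. H (z + d t) \<partial>lborel) \<partial>\<alpha>)"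
proof -
  interpret \<alpha>: sigma_finite_measure \<alpha> by fact
  interpret pair_sigma_finite \<alpha> "lborel :: 'a measure" ..
  have "emeasure lborel W * (\<integral>\<^sup>+z. H z \<partial>\<alpha>) = (\<integral>\<^sup>+z. (\<integral>\<^sup>+t. indicator W t * H z \<partial>lborel) \<partial>\<alpha>)"
    by (simp add: nn_integral_multc nn_integral_cmult)
  also have "\<dots> = (\<integral>\<^sup>+z. (\<integral>\<^sup>+t. indicator W (\<pi> z - t) * H z \<partial>lborel) \<partial>\<alpha>)"
    by (intro nn_integral_cong nn_integral_lborel_reflect[symmetric]) simp
  also have "\<dots> = (\<integral>\<^sup>+t. (\<integral>\<^sup>+z. indicator W (\<pi> z - t) * H z \<partial>\<alpha>) \<partial>lborel)"
    by (intro Fubini'[symmetric]) simp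
  also have "\<dots> = (\<integral>\<^sup>+t. (\<integral>\<^sup>+z. indicator W (\<pi> z) * H (z + d t) \<partial>\<alpha>) \<partial>lborel)"
  proof (rule nn_integral_cong)
    fix t
    have "(\<integral>\<^sup>+z. indicator W (\<pi> z - t) * H z \<partial>\<alpha>)
      = (\<integral>\<^sup>+z. indicator W (\<pi> z - t) * H z \<partial>distr \<alpha> borel (\<lambda>z. z + d t))" by (simp add: inv)
    also have "\<dots> = (\<integral>\<^sup>+z. indicator W (\<pi> z) * H (z + d t) \<partial>\<alpha>)"
      by (subst nn_integral_distr) (auto simp: \<pi>)
    finally show "(\<integral>\<^sup>+z. indicator W (\<pi> z - t) * H z \<partial>\<alpha>) = (\<integral>\<^sup>+z. indicator W (\<pi> z) * H (z + d t) \<partial>\<alpha>)" .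
  qed
  also have "\<dots> = (\<integral>\<^sup>+z. (\<integral>\<^sup>+t. indicator W (\<pi> z) * H (z + d t) \<partial>lborel) \<partial>\<alpha>)"
    by (intro Fubini') simp
  also have "\<dots> = (\<integral>\<^sup>+z. indicator W (\<pi> z) * (\<integral>\<^sup>+t. H (z + d t) \<partial>lborel) \<partial>\<alpha>)"
    by (intro nn_integral_cong nn_integral_cmult) simp
  finally show ?thesis .
qed

definition unit_cube :: "'a::euclidean_space set" where "unit_cube = cbox 0 One"

lemma unit_cube: "unit_cube \<in> sets borel" "bounded unit_cube" "emeasure lborel (unit_cube :: 'a::euclidean_space set) = 1"
  by (auto simp: unit_cube_def emeasure_lborel_cbox_eq)

definition diagonal_invariant :: "('a::euclidean_space \<times> 'a) measure \<Rightarrow> bool" where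
  "diagonal_invariant \<alpha> \<longleftrightarrow> sets \<alpha> = sets borel \<and> sigma_finite_measure \<alpha> \<and>
     (\<forall>t. distr \<alpha> borel (\<lambda>z. z + (t, t)) = \<alpha>)"

text \<open>The transfer principle behind the whole proof.  By the orbit decomposition, with the window a unit
cube in the first coordinate, an integral sees a function only through its diagonal integrals.\<close>

lemma nn_integral_diagonal_invariant:
  fixes \<alpha> :: "('a::euclidean_space \<times> 'a) measure"
  assumes \<alpha>: "diagonal_invariant \<alpha>"
    and [measurable]: "H \<in> borel_measurable borel" "H' \<in> borel_measurable borel"
    and eq: "\<And>x y. (\<integral>\<^sup>+t. H (x + t, y + t) \<partial>lborel) = (\<integral>\<^sup>+t. H' (x + t, y + t) \<partial>lborel)"
  shows "(\<integral>\<^sup>+z. H z \<partial>\<alpha>) = (\<integral>\<^sup>+z. H' z \<partial>\<alpha>)"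
proof -
  have 1: "(\<integral>\<^sup>+z. F z \<partial>\<alpha>) = (\<integral>\<^sup>+z. indicator unit_cube (fst z) * (\<integral>\<^sup>+t. F (z + (t, t)) \<partial>lborel) \<partial>\<alpha>)"
    if "F \<in> borel_measurable borel" for F
    using nn_integral_shift_invariant[of \<alpha> "\<lambda>t. (t, t)" fst F unit_cube] \<alpha> that
    by (simp add: diagonal_invariant_def unit_cube borel_measurable_Pair borel_measurable_continuous_onI continuous_on_fst)
  show ?thesis
    by (subst (1 2) 1) (auto intro!: nn_integral_cong simp: eq)
qed

section \<open>First and second moments of a stationary random measure\<close>

lemma ennreal_power2_deviation:
  fixes x :: ennreal
  assumes "x < \<top>" "0 \<le> m"
  shows "x\<^sup>2 + ennreal (m\<^sup>2) = 2 * ennreal m * x + ennreal (\<bar>enn2real x - m\<bar>\<^sup>2)"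
proof -
  obtain r where r: "x = ennreal r" "0 \<le> r" using assms(1) by (cases x) auto
  have "x\<^sup>2 + ennreal (m\<^sup>2) = ennreal (r\<^sup>2 + m\<^sup>2)"
    using r by (simp add: ennreal_power ennreal_plus[symmetric] del: ennreal_plus)
  also have "r\<^sup>2 + m\<^sup>2 = 2 * m * r + \<bar>r - m\<bar>\<^sup>2" by (simp add: power2_eq_square algebra_simps)
  also have "ennreal \<dots> = ennreal 2 * ennreal m * ennreal r + ennreal (\<bar>r - m\<bar>\<^sup>2)"
    using assms r by (simp add: ennreal_mult ennreal_plus)
  finally show ?thesis using r by simp
qed

text \<open>Both sides may be infinite: after expanding the square under the integral, only the finite
quantity \<open>m\<^sup>2\<close> is cancelled.\<close>

lemma (in prob_space) second_moment_eq_mean_plus_variance: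
  fixes X :: "'a \<Rightarrow> ennreal"
  assumes [measurable]: "X \<in> borel_measurable M" and fin: "AE p in M. X p < \<top>"
    and mean: "(\<integral>\<^sup>+p. X p \<partial>M) = ennreal m" and "0 \<le> m"
  shows "(\<integral>\<^sup>+p. (X p)\<^sup>2 \<partial>M) = ennreal (m\<^sup>2) + (\<integral>\<^sup>+p. ennreal (\<bar>enn2real (X p) - m\<bar>\<^sup>2) \<partial>M)"
proof -
  have "(\<integral>\<^sup>+p. (X p)\<^sup>2 \<partial>M) + ennreal (m\<^sup>2) = (\<integral>\<^sup>+p. (X p)\<^sup>2 + ennreal (m\<^sup>2) \<partial>M)"
    by (subst nn_integral_add) (auto simp: emeasure_space_1)
  also have "\<dots> = (\<integral>\<^sup>+p. 2 * ennreal m * X p + ennreal (\<bar>enn2real (X p) - m\<bar>\<^sup>2) \<partial>M)"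
    using fin by (intro nn_integral_cong_AE) (auto simp: ennreal_power2_deviation[OF _ \<open>0 \<le> m\<close>])
  also have "\<dots> = 2 * ennreal m * ennreal m + (\<integral>\<^sup>+p. ennreal (\<bar>enn2real (X p) - m\<bar>\<^sup>2) \<partial>M)"
    by (subst nn_integral_add) (auto simp: nn_integral_cmult mean)
  also have "2 * ennreal m * ennreal m = ennreal (m\<^sup>2) + ennreal (m\<^sup>2)"
    using \<open>0 \<le> m\<close> by (simp add: mult_2[symmetric] ennreal_mult[symmetric] power2_eq_square mult.assoc)
  finally have "ennreal (m\<^sup>2) + (\<integral>\<^sup>+p. (X p)\<^sup>2 \<partial>M)
     = ennreal (m\<^sup>2) + (ennreal (m\<^sup>2) + (\<integral>\<^sup>+p. ennreal (\<bar>enn2real (X p) - m\<bar>\<^sup>2) \<partial>M))"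
    by (simp add: ac_simps)
  then show ?thesis by (subst (asm) ennreal_add_left_cancel) auto
qed

lemma (in prob_space) mean_square_le_second_moment:
  fixes X :: "'a \<Rightarrow> ennreal"
  assumes [measurable]: "X \<in> borel_measurable M"
    and mean: "(\<integral>\<^sup>+p. X p \<partial>M) = ennreal m" and "0 \<le> m"
  shows "ennreal (m\<^sup>2) \<le> (\<integral>\<^sup>+p. (X p)\<^sup>2 \<partial>M)"
proof -
  have "AE p in M. X p < \<top>"
    using nn_integral_PInf_AE[of X M] mean by (auto simp: less_top)
  from second_moment_eq_mean_plus_variance[OF assms(1) this assms(2,3)]
  show ?thesis by simp
qed

text \<open>The converse extreme of the previous inequality: a second moment that does not exceed the square of
the mean forces the variance to vanish.\<close>

lemma (in prob_space) AE_eq_mean: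
  fixes X :: "'a \<Rightarrow> ennreal"
  assumes [measurable]: "X \<in> borel_measurable M"
    and mean: "(\<integral>\<^sup>+p. X p \<partial>M) = ennreal m" and "0 \<le> m"
    and second: "(\<integral>\<^sup>+p. (X p)\<^sup>2 \<partial>M) \<le> ennreal (m\<^sup>2)"
  shows "AE p in M. X p = ennreal m"
proof -
  have fin: "AE p in M. X p < \<top>"
    using nn_integral_PInf_AE[of X M] mean by (auto simp: less_top)
  from second_moment_eq_mean_plus_variance[OF assms(1) this assms(2,3)] second
  have "ennreal (m\<^sup>2) + (\<integral>\<^sup>+p. ennreal (\<bar>enn2real (X p) - m\<bar>\<^sup>2) \<partial>M) \<le> ennreal (m\<^sup>2) + 0" by simp
  then have "(\<integral>\<^sup>+p. ennreal (\<bar>enn2real (X p) - m\<bar>\<^sup>2) \<partial>M) = 0"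
    by (subst (asm) ennreal_add_left_cancel_le) auto
  then have "AE p in M. ennreal (\<bar>enn2real (X p) - m\<bar>\<^sup>2) = 0"
    by (subst (asm) nn_integral_0_iff_AE) auto
  with fin show ?thesis
  proof eventually_elim
    case (elim p)
    then have "enn2real (X p) = m" by (simp add: ennreal_eq_0_iff)
    with elim show ?case by (metis ennreal_enn2real)
  qed
qed

context stationary_random_measure
begin

text \<open>Also called the first moment measure or the intensity measure.\<close>

definition mean_measure :: "'a measure" where
  "mean_measure = mixture M (\<lambda>p. p)"

definition pair_moment :: "('a \<times> 'a) measure" where
  "pair_moment = mixture M (\<lambda>p. p \<Otimes>\<^sub>M p)"

sublocale mean: kernel M "\<lambda>p. p"
  by unfold_locales (auto simp: sets_realisation borel_measurable_emeasure)

sublocale pair: kernel M "\<lambda>p. p \<Otimes>\<^sub>M p"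
  by unfold_locales (auto simp: sets_realisation_product borel_measurable_emeasure_product)

lemma sets_mean_measure [measurable_cong]: "sets mean_measure = sets borel"
  by (simp add: mean_measure_def sets_mixture)

lemma sets_pair_moment [measurable_cong]: "sets pair_moment = sets borel"
  by (simp add: pair_moment_def sets_mixture)

lemma pair_moment_product:
  assumes f: "f \<in> borel_measurable borel" and g: "g \<in> borel_measurable borel"
  shows "(\<integral>\<^sup>+z. f (fst z) * g (snd z) \<partial>pair_moment)
    = (\<integral>\<^sup>+p. (\<integral>\<^sup>+x. f x \<partial>p) * (\<integral>\<^sup>+x. g x \<partial>p) \<partial>M)"
proof -
  have m: "(\<lambda>z. f (fst z) * g (snd z)) \<in> borel_measurable borel"
    using f g unfolding borel_prod[symmetric] by measurable
  have "(\<integral>\<^sup>+z. f (fst z) * g (snd z) \<partial>(p \<Otimes>\<^sub>M p)) = (\<integral>\<^sup>+x. f x \<partial>p) * (\<integral>\<^sup>+x. g x \<partial>p)"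
    if p: "p \<in> space M" for p
  proof -
    interpret sigma_finite_measure p by (rule sigma_finite_realisation[OF p])
    have [measurable_cong]: "sets p = sets borel" by (rule sets_realisation[OF p])
    note f[measurable] g[measurable]
    have "(\<integral>\<^sup>+z. f (fst z) * g (snd z) \<partial>(p \<Otimes>\<^sub>M p)) = (\<integral>\<^sup>+x. \<integral>\<^sup>+y. f x * g y \<partial>p \<partial>p)"
      by (subst nn_integral_fst[symmetric]) auto
    also have "\<dots> = (\<integral>\<^sup>+x. f x * (\<integral>\<^sup>+y. g y \<partial>p) \<partial>p)"
      by (intro nn_integral_cong nn_integral_cmult) simp
    also have "\<dots> = (\<integral>\<^sup>+x. f x \<partial>p) * (\<integral>\<^sup>+x. g x \<partial>p)"
      by (simp add: nn_integral_multc)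
    finally show ?thesis .
  qed
  then show ?thesis
    unfolding pair_moment_def using pair.nn_integral_mixture[OF m] by (simp cong: nn_integral_cong)
qed

lemma pair_moment_square:
  assumes B: "B \<in> sets borel"
  shows "emeasure pair_moment (B \<times> B) = (\<integral>\<^sup>+p. (emeasure p B)\<^sup>2 \<partial>M)"
proof -
  have "B \<times> B \<in> sets borel" using B unfolding borel_prod[symmetric] by auto
  then have "emeasure pair_moment (B \<times> B) = (\<integral>\<^sup>+z. indicator (B \<times> B) z \<partial>pair_moment)"
    by (simp add: sets_pair_moment)
  also have "\<dots> = (\<integral>\<^sup>+z. indicator B (fst z) * indicator B (snd z) \<partial>pair_moment)"
    by (intro nn_integral_cong) (auto simp: indicator_def)
  also have "\<dots> = (\<integral>\<^sup>+p. (\<integral>\<^sup>+x. indicator B x \<partial>p) * (\<integral>\<^sup>+x. indicator B x \<partial>p) \<partial>M)"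
    using B by (intro pair_moment_product) auto
  also have "\<dots> = (\<integral>\<^sup>+p. (emeasure p B)\<^sup>2 \<partial>M)"
    using B by (intro nn_integral_cong) (simp add: sets_realisation power2_eq_square)
  finally show ?thesis .
qed

lemma pair_moment_square_finite:
  assumes "B \<in> sets borel" "bounded B"
  shows "emeasure pair_moment (B \<times> B) < \<infinity>"
  using square_integrable assms by (simp add: pair_moment_square locally_square_integrable_def)

lemma mean_measure_finite:
  assumes "B \<in> sets borel" "bounded B"
  shows "emeasure mean_measure B < \<infinity>"
proof -
  have [measurable]: "(\<lambda>p. emeasure p B) \<in> borel_measurable M"
    using assms(1) by (rule borel_measurable_emeasure)
  have le: "x \<le> 1 + x\<^sup>2" for x :: ennreal
  proof (cases "x \<le> 1")
    case False
    then have "x * 1 \<le> x * x" by (intro mult_left_mono) auto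
    then show ?thesis by (simp add: power2_eq_square add_increasing)
  qed (simp add: add_increasing2)
  have "emeasure mean_measure B = (\<integral>\<^sup>+p. emeasure p B \<partial>M)"
    unfolding mean_measure_def using assms by (intro mean.emeasure_mixture)
  also have "\<dots> \<le> (\<integral>\<^sup>+p. 1 + (emeasure p B)\<^sup>2 \<partial>M)"
    by (intro nn_integral_mono le)
  also have "\<dots> = 1 + (\<integral>\<^sup>+p. (emeasure p B)\<^sup>2 \<partial>M)"
    by (subst nn_integral_add) (auto simp: emeasure_space_1)
  also have "\<dots> < \<infinity>"
    using square_integrable assms by (simp add: locally_square_integrable_def)
  finally show ?thesis .
qed

lemma sigma_finite_mean_measure: "sigma_finite_measure mean_measure"
proof
  show "\<exists>A. countable A \<and> A \<subseteq> sets mean_measure \<and> \<Union> A = space mean_measure \<and> (\<forall>a\<in>A. emeasure mean_measure a \<noteq> \<infinity>)"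
  proof (intro exI conjI ballI)
    show "(\<Union>N. {ball 0 (real N)}) \<subseteq> sets mean_measure" by (auto simp: sets_mean_measure)
    show "\<Union> (\<Union>N. {ball (0::'a) (real N)}) = space mean_measure"
      by (auto simp: mean_measure_def reals_Archimedean2)
    fix a :: "'a set" assume "a \<in> (\<Union>N. {ball 0 (real N)})"
    then show "emeasure mean_measure a \<noteq> \<infinity>" using mean_measure_finite[of a] by auto
  qed auto
qed

lemma sigma_finite_pair_moment: "sigma_finite_measure pair_moment"
proof
  let ?Q = "\<lambda>N. ball (0::'a) (real N)"
  show "\<exists>A. countable A \<and> A \<subseteq> sets pair_moment \<and> \<Union> A = space pair_moment \<and> (\<forall>a\<in>A. emeasure pair_moment a \<noteq> \<infinity>)"
  proof (intro exI conjI ballI)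
    have "?Q N \<times> ?Q N \<in> sets borel" for N unfolding borel_prod[symmetric] by auto
    then show "(\<Union>N. {?Q N \<times> ?Q N}) \<subseteq> sets pair_moment" by (auto simp: sets_pair_moment)
    have "\<exists>N. z \<in> ?Q N \<times> ?Q N" for z
    proof -
      obtain N where "real N > max (norm (fst z)) (norm (snd z))" using reals_Archimedean2 by blast
      then show ?thesis by (intro exI[of _ N]) (auto simp: mem_Times_iff)
    qed
    then show "\<Union> (\<Union>N. {?Q N \<times> ?Q N}) = space pair_moment"
      by (auto simp: pair_moment_def)
    fix a :: "('a \<times> 'a) set" assume "a \<in> (\<Union>N. {?Q N \<times> ?Q N})"
    then obtain N where "a = ?Q N \<times> ?Q N" by auto
    then show "emeasure pair_moment a \<noteq> \<infinity>" using pair_moment_square_finite[of "?Q N"] by auto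
  qed auto
qed

lemma mean_measure_invariant: "distr mean_measure borel (\<lambda>x. x + t) = mean_measure"
proof (rule measure_eqI)
  fix A :: "'a set" assume "A \<in> sets (distr mean_measure borel (\<lambda>x. x + t))"
  then have A [measurable]: "A \<in> sets borel" by simp
  have A': "(\<lambda>x. x + t) -` A \<in> sets borel"
    using measurable_sets[of "\<lambda>x. x + t" borel borel A] by simp
  have "emeasure (distr mean_measure borel (\<lambda>x. x + t)) A = emeasure mean_measure ((\<lambda>x. x + t) -` A)"
    by (subst emeasure_distr) (auto simp: mean_measure_def)
  also have "\<dots> = (\<integral>\<^sup>+p. emeasure p ((\<lambda>x. x + t) -` A) \<partial>M)"
    unfolding mean_measure_def using A' by (rule mean.emeasure_mixture)
  also have "\<dots> = (\<integral>\<^sup>+p. emeasure (translate_measure t p) A \<partial>M)"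
  proof (rule nn_integral_cong)
    fix p assume p: "p \<in> space M"
    have [measurable_cong]: "sets p = sets borel" by (rule sets_realisation[OF p])
    show "emeasure p ((\<lambda>x. x + t) -` A) = emeasure (translate_measure t p) A"
      unfolding translate_measure_def by (subst emeasure_distr) (auto simp: space_realisation[OF p])
  qed
  also have "\<dots> = (\<integral>\<^sup>+p. emeasure p A \<partial>M)"
    by (rule nn_integral_translate[OF borel_measurable_emeasure[OF A]])
  also have "\<dots> = emeasure mean_measure A"
    unfolding mean_measure_def using A by (rule mean.emeasure_mixture[symmetric])
  finally show "emeasure (distr mean_measure borel (\<lambda>x. x + t)) A = emeasure mean_measure A" .
qed (simp add: sets_mean_measure)

lemma pair_moment_invariant: "distr pair_moment borel (\<lambda>z. z + (t, t)) = pair_moment"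
proof (rule measure_eqI)
  fix A :: "('a \<times> 'a) set" assume "A \<in> sets (distr pair_moment borel (\<lambda>z. z + (t, t)))"
  then have A [measurable]: "A \<in> sets borel" by simp
  have A': "(\<lambda>z. z + (t, t)) -` A \<in> sets borel"
    using measurable_sets[of "\<lambda>z. z + (t, t)" borel borel A] by simp
  have "emeasure (distr pair_moment borel (\<lambda>z. z + (t, t))) A = emeasure pair_moment ((\<lambda>z. z + (t, t)) -` A)"
    by (subst emeasure_distr) (auto simp: pair_moment_def)
  also have "\<dots> = (\<integral>\<^sup>+p. emeasure (p \<Otimes>\<^sub>M p) ((\<lambda>z. z + (t, t)) -` A) \<partial>M)"
    unfolding pair_moment_def using A' by (rule pair.emeasure_mixture)
  also have "\<dots> = (\<integral>\<^sup>+p. emeasure (translate_measure t p \<Otimes>\<^sub>M translate_measure t p) A \<partial>M)"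
  proof (rule nn_integral_cong)
    fix p assume p: "p \<in> space M"
    have t: "translate_measure t p \<in> space M"
      using p measurable_space[OF measurable_translate_measure[of t], of p]
      by (simp add: space_M space_measure_space_of_measures)
    have sp [measurable_cong]: "sets p = sets borel" by (rule sets_realisation[OF p])
    interpret p: sigma_finite_measure p by (rule sigma_finite_realisation[OF p])
    have "translate_measure t p \<Otimes>\<^sub>M translate_measure t p
        = distr (p \<Otimes>\<^sub>M p) (borel \<Otimes>\<^sub>M borel) (\<lambda>(x, y). (x + t, y + t))"
      using sigma_finite_realisation[OF t] unfolding translate_measure_def
      by (intro pair_measure_distr) auto
    also have "\<dots> = distr (p \<Otimes>\<^sub>M p) borel (\<lambda>z. z + (t, t))"
      by (auto simp: borel_prod intro!: distr_cong)
    finally have eq: "translate_measure t p \<Otimes>\<^sub>M translate_measure t p = distr (p \<Otimes>\<^sub>M p) borel (\<lambda>z. z + (t, t))" .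
    have "(\<lambda>z. z + (t, t)) \<in> measurable (p \<Otimes>\<^sub>M p) borel"
      using sets_realisation_product[OF p] by (simp cong: measurable_cong_sets)
    then show "emeasure (p \<Otimes>\<^sub>M p) ((\<lambda>z. z + (t, t)) -` A) = emeasure (translate_measure t p \<Otimes>\<^sub>M translate_measure t p) A"
      unfolding eq by (subst emeasure_distr) (auto simp: space_realisation[OF p] space_pair_measure)
  qed
  also have "\<dots> = (\<integral>\<^sup>+p. emeasure (p \<Otimes>\<^sub>M p) A \<partial>M)"
    by (rule nn_integral_translate[OF borel_measurable_emeasure_product[OF A]])
  also have "\<dots> = emeasure pair_moment A"
    unfolding pair_moment_def using A by (rule pair.emeasure_mixture[symmetric])
  finally show "emeasure (distr pair_moment borel (\<lambda>z. z + (t, t))) A = emeasure pair_moment A" .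
qed (simp add: sets_pair_moment)

lemma diagonal_invariant_pair_moment: "diagonal_invariant pair_moment"
  by (simp add: diagonal_invariant_def sets_pair_moment sigma_finite_pair_moment pair_moment_invariant)

text \<open>This is the intensity (\<open>intensity_eq\<close>), in explicit form.\<close>

definition iota :: real where "iota = enn2real (emeasure mean_measure unit_cube)"

lemma iota_nonneg: "0 \<le> iota" by (simp add: iota_def)

text \<open>Campbell's formula.  The mean measure is shift-invariant, hence a multiple of Lebesgue measure, and
the unit cube determines the factor.\<close>

lemma nn_integral_mean_measure:
  assumes f: "f \<in> borel_measurable borel"
  shows "(\<integral>\<^sup>+p. \<integral>\<^sup>+x. f x \<partial>p \<partial>M) = ennreal iota * (\<integral>\<^sup>+x. f x \<partial>lborel)"
proof -
  note f[measurable]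
  have "(\<integral>\<^sup>+x. f x \<partial>mean_measure)
      = (\<integral>\<^sup>+x. indicator unit_cube x * (\<integral>\<^sup>+t. f (x + t) \<partial>lborel) \<partial>mean_measure)"
    using nn_integral_shift_invariant[of mean_measure "\<lambda>t. t" "\<lambda>x. x" f unit_cube] f
    by (simp add: sets_mean_measure sigma_finite_mean_measure mean_measure_invariant unit_cube)
  also have "\<dots> = (\<integral>\<^sup>+x. indicator unit_cube x * (\<integral>\<^sup>+t. f t \<partial>lborel) \<partial>mean_measure)"
    by (simp add: nn_integral_lborel_translate)
  also have "\<dots> = emeasure mean_measure unit_cube * (\<integral>\<^sup>+x. f x \<partial>lborel)"
    by (subst nn_integral_multc) (auto simp: unit_cube sets_mean_measure intro!: borel_measurable_indicator)
  also have "emeasure mean_measure unit_cube = ennreal iota"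
    using mean_measure_finite[OF unit_cube(1,2)] by (simp add: iota_def)
  finally show ?thesis
    unfolding mean_measure_def using mean.nn_integral_mixture[OF f] by simp
qed

lemma nn_integral_emeasure:
  assumes B: "B \<in> sets borel"
  shows "(\<integral>\<^sup>+p. emeasure p B \<partial>M) = ennreal iota * emeasure lborel B"
proof -
  have "(\<integral>\<^sup>+p. emeasure p B \<partial>M) = (\<integral>\<^sup>+p. \<integral>\<^sup>+x. indicator B x \<partial>p \<partial>M)"
    using B by (intro nn_integral_cong) (simp add: sets_realisation)
  then show ?thesis using B by (simp add: nn_integral_mean_measure)
qed

text \<open>The definite description in \<open>intensity\<close> is well defined: Campbell's formula gives existence and the
unit cube gives uniqueness.\<close>

lemma intensity_eq: "intensity M = iota"
proof -
  have *: "(\<integral>p. measure p B \<partial>M) = iota * measure lborel B" if B: "B \<in> sets borel" "bounded B" for B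
  proof -
    have [measurable]: "(\<lambda>p. emeasure p B) \<in> borel_measurable M"
      using B(1) by (rule borel_measurable_emeasure)
    have "(\<integral>p. measure p B \<partial>M) = enn2real (\<integral>\<^sup>+p. ennreal (measure p B) \<partial>M)"
      by (intro integral_eq_nn_integral) (auto simp: measure_def)
    also have "(\<integral>\<^sup>+p. ennreal (measure p B) \<partial>M) = (\<integral>\<^sup>+p. emeasure p B \<partial>M)"
      using B by (intro nn_integral_cong) (simp add: emeasure_realisation)
    also have "\<dots> = ennreal iota * emeasure lborel B"
      using B by (intro nn_integral_emeasure) auto
    finally show ?thesis
      by (simp add: measure_def enn2real_mult iota_nonneg)
  qed
  have cube: "measure lborel (unit_cube :: 'a set) = 1"
    by (simp add: measure_def unit_cube)
  show ?thesis
    unfolding intensity_def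
  proof (rule the_equality)
    fix c assume "\<forall>B\<in>sets borel. bounded B \<longrightarrow> (\<integral>p. measure p B \<partial>M) = c * measure lborel B"
    then have "(\<integral>p. measure p unit_cube \<partial>M) = c" by (simp add: unit_cube cube)
    then show "c = iota" using *[OF unit_cube(1,2)] by (simp add: cube)
  qed (simp add: *)
qed

text \<open>The number variance is what the second moment of a ball adds to the value
\<open>(\<iota> vol B\<^sub>R)\<^sup>2\<close> that a multiple of Lebesgue measure would give.\<close>

lemma pair_moment_ball:
  "emeasure pair_moment (ball 0 R \<times> ball 0 R)
    = ennreal ((iota * measure lborel (ball (0::'a) R))\<^sup>2) + number_variance M R"
proof -
  have [measurable]: "(\<lambda>p. emeasure p (ball 0 R)) \<in> borel_measurable M"
    by (rule borel_measurable_emeasure) simp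
  have "(\<integral>\<^sup>+p. emeasure p (ball 0 R) \<partial>M) = ennreal (iota * measure lborel (ball (0::'a) R))"
    using emeasure_lborel_ball_finite[of "0::'a" R]
    by (simp add: nn_integral_emeasure ennreal_mult iota_nonneg emeasure_eq_ennreal_measure less_top)
  then show ?thesis
    unfolding number_variance_def intensity_eq measure_def pair_moment_square[OF borel_open[OF open_ball]]
    using finite_realisation[of _ "ball 0 R"] iota_nonneg
    by (intro second_moment_eq_mean_plus_variance) (auto intro!: AE_I2 mult_nonneg_nonneg simp: measure_def)
qed

end

section \<open>Rotation invariance of Lebesgue measure\<close>

text \<open>The reflection in the hyperplane orthogonal to \<open>a - b\<close> exchanges \<open>a\<close> and \<open>b\<close>.\<close>

lemma orthogonal_transformation_mapping:
  fixes a b :: "'a::euclidean_space"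
  assumes "norm a = norm b"
  obtains f where "orthogonal_transformation f" "f a = b"
proof (cases "a = b")
  case True
  then show ?thesis using that[of "\<lambda>x. x"] by simp
next
  case False
  define v where "v = a - b"
  define f where "f x = x - (2 * (x \<bullet> v) / (v \<bullet> v)) *\<^sub>R v" for x
  have v: "v \<bullet> v \<noteq> 0" using False by (simp add: v_def)
  have ab: "a \<bullet> a = b \<bullet> b" using assms by (simp add: norm_eq)
  have "linear f"
  proof (rule linearI)
    show "f (x + y) = f x + f y" for x y
      unfolding f_def inner_add_left distrib_left add_divide_distrib scaleR_add_left by simp
    show "f (c *\<^sub>R x) = c *\<^sub>R f x" for c x
      by (simp add: f_def scaleR_diff_right mult.left_commute)
  qed
  moreover have "norm (f x) = norm x" for x
  proof -
    have "f x \<bullet> f x = x \<bullet> x"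
    proof -
      define c where "c = 2 * (x \<bullet> v) / (v \<bullet> v)"
      have c: "c * (v \<bullet> v) = 2 * (x \<bullet> v)" using v by (simp add: c_def)
      have "f x \<bullet> f x = x \<bullet> x - 2 * c * (x \<bullet> v) + c * (c * (v \<bullet> v))"
        unfolding f_def c_def[symmetric]
        by (simp add: inner_diff_left inner_diff_right inner_commute[of v x] right_diff_distrib)
      then show ?thesis unfolding c by simp
    qed
    then show ?thesis by (simp add: norm_eq)
  qed
  moreover have "f a = b"
  proof -
    have "2 * (a \<bullet> v) = v \<bullet> v" using ab by (simp add: v_def inner_simps inner_commute)
    then show ?thesis using v by (simp add: f_def v_def)
  qed
  ultimately show ?thesis using that by (auto simp: orthogonal_transformation)
qed

text \<open>The image of Lebesgue measure is again shift-invariant, hence a multiple of Lebesgue measure, and the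
factor is \<open>1\<close> because the unit ball is mapped to itself.\<close>

lemma distr_lborel_orthogonal_transformation:
  fixes f :: "'a::euclidean_space \<Rightarrow> 'a"
  assumes f: "orthogonal_transformation f"
  shows "distr lborel borel f = lborel"
proof -
  have lin: "linear f" using f by (rule orthogonal_transformation_linear)
  have [measurable]: "f \<in> borel_measurable borel"
    by (intro borel_measurable_continuous_onI linear_continuous_on linear_conv_bounded_linear[THEN iffD1] lin)
  have vim: "f -` ball 0 r = ball 0 r" for r
    using orthogonal_transformation_norm[OF f] by auto
  let ?\<alpha> = "distr lborel borel f"
  have ball: "emeasure ?\<alpha> (ball 0 r) = emeasure lborel (ball (0::'a) r)" for r
    by (subst emeasure_distr) (auto simp: vim)
  have sf: "sigma_finite_measure ?\<alpha>"
  proof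
    show "\<exists>A. countable A \<and> A \<subseteq> sets ?\<alpha> \<and> \<Union> A = space ?\<alpha> \<and> (\<forall>a\<in>A. emeasure ?\<alpha> a \<noteq> \<infinity>)"
    proof (intro exI conjI ballI)
      show "\<Union> (\<Union>N. {ball (0::'a) (real N)}) = space ?\<alpha>"
        by (auto simp: reals_Archimedean2)
      fix a :: "'a set" assume "a \<in> (\<Union>N. {ball 0 (real N)})"
      then obtain N where "a = ball 0 (real N)" by auto
      then show "emeasure ?\<alpha> a \<noteq> \<infinity>"
        using emeasure_lborel_ball_finite[of "0::'a" "real N"] by (simp add: ball)
    qed auto
  qed
  have inv: "distr ?\<alpha> borel (\<lambda>x. x + t) = ?\<alpha>" for t
  proof -
    obtain s where t: "t = f s" using orthogonal_transformation_surj[OF f] by (metis surjD)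
    have "distr ?\<alpha> borel (\<lambda>x. x + t) = distr lborel borel (\<lambda>x. f (s + x))"
      by (subst distr_distr) (auto simp: comp_def t linear_add[OF lin] add.commute)
    also have "\<dots> = distr (distr lborel borel ((+) s)) borel f"
      by (subst distr_distr) (auto simp: comp_def)
    finally show ?thesis by (simp add: lborel_distr_plus)
  qed
  show ?thesis
  proof (rule measure_eqI)
    fix A :: "'a set" assume "A \<in> sets ?\<alpha>"
    then have A [measurable]: "A \<in> sets borel" by simp
    let ?B = "ball (0::'a) 1"
    have "emeasure lborel ?B * (\<integral>\<^sup>+x. indicator A x \<partial>?\<alpha>)
        = (\<integral>\<^sup>+x. indicator ?B x * (\<integral>\<^sup>+t. indicator A (x + t) \<partial>lborel) \<partial>?\<alpha>)"
      using nn_integral_shift_invariant[of ?\<alpha> "\<lambda>t. t" "\<lambda>x. x" "indicator A" ?B] inv sf by simp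
    also have "\<dots> = (\<integral>\<^sup>+x. indicator ?B x * emeasure lborel A \<partial>?\<alpha>)"
      using nn_integral_lborel_translate[of "indicator A"] by simp
    also have "\<dots> = emeasure lborel ?B * emeasure lborel A"
    proof -
      have B: "?B \<in> sets ?\<alpha>" by simp
      show ?thesis
        by (simp only: nn_integral_multc[OF borel_measurable_indicator[OF B]] nn_integral_indicator[OF B] ball)
    qed
    finally have "emeasure lborel ?B * emeasure ?\<alpha> A = emeasure lborel ?B * emeasure lborel A" by simp
    moreover have "emeasure lborel ?B \<noteq> 0" "emeasure lborel ?B \<noteq> \<infinity>"
      using emeasure_lborel_ball_finite[of "0::'a" 1] content_ball_pos[of 1 "0::'a"]
      by (auto simp: measure_def)
    ultimately show "emeasure ?\<alpha> A = emeasure lborel A"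
      by (simp add: ennreal_mult_cancel_left)
  qed simp
qed

lemma nn_integral_lborel_orthogonal_transformation:
  fixes f :: "'a::euclidean_space \<Rightarrow> 'a"
  assumes f: "orthogonal_transformation f" and g [measurable]: "g \<in> borel_measurable borel"
  shows "(\<integral>\<^sup>+x. g (f x) \<partial>lborel) = (\<integral>\<^sup>+x. g x \<partial>lborel)"
proof -
  have [measurable]: "f \<in> borel_measurable borel"
    by (intro borel_measurable_continuous_onI linear_continuous_on linear_conv_bounded_linear[THEN iffD1]
        orthogonal_transformation_linear f)
  have "(\<integral>\<^sup>+x. g x \<partial>lborel) = (\<integral>\<^sup>+x. g x \<partial>distr lborel borel f)"
    by (simp add: distr_lborel_orthogonal_transformation[OF f])
  then show ?thesis by (simp add: nn_integral_distr)
qed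

lemma diagonal_invariant_lborel: "diagonal_invariant (lborel :: ('a::euclidean_space \<times> 'a) measure)"
proof -
  have "(\<lambda>z. z + (t, t)) = (+) (t, t)" for t :: 'a
    by (rule ext) (rule add.commute)
  then show ?thesis
    unfolding diagonal_invariant_def by (simp add: sigma_finite_lborel lborel_distr_plus)
qed

section \<open>Gaussian integrals and diagonal integrals\<close>

lemma nn_integral_gaussian_real:
  assumes "\<tau> > 0"
  shows "(\<integral>\<^sup>+x. ennreal (exp (- \<tau> * x\<^sup>2)) \<partial>lborel) = ennreal (sqrt (pi / \<tau>))"
proof -
  define \<sigma> where "\<sigma> = sqrt (1 / (2 * \<tau>))"
  have \<sigma>: "\<sigma> > 0" "\<sigma>\<^sup>2 = 1 / (2 * \<tau>)" using assms by (auto simp: \<sigma>_def)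
  have dens: "exp (- \<tau> * x\<^sup>2) = sqrt (pi / \<tau>) * normal_density 0 \<sigma> x" for x
  proof -
    have "2 * pi * \<sigma>\<^sup>2 = pi / \<tau>" "- (x - 0)\<^sup>2 / (2 * \<sigma>\<^sup>2) = - \<tau> * x\<^sup>2"
      using assms by (simp_all add: \<sigma>(2))
    moreover have "sqrt (pi / \<tau>) \<noteq> 0" using assms by simp
    ultimately show ?thesis unfolding normal_density_def by (simp only:) simp
  qed
  have "(\<integral>\<^sup>+x. ennreal (exp (- \<tau> * x\<^sup>2)) \<partial>lborel)
      = (\<integral>\<^sup>+x. ennreal (sqrt (pi / \<tau>)) * ennreal (normal_density 0 \<sigma> x) \<partial>lborel)"
    unfolding dens using assms by (intro nn_integral_cong ennreal_mult) auto
  also have "\<dots> = ennreal (sqrt (pi / \<tau>)) * (\<integral>\<^sup>+x. ennreal (normal_density 0 \<sigma> x) \<partial>lborel)"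
    by (intro nn_integral_cmult) auto
  also have "(\<integral>\<^sup>+x. ennreal (normal_density 0 \<sigma> x) \<partial>lborel) = ennreal 1"
    unfolding integral_normal_density[OF \<sigma>(1), of 0, symmetric]
    by (intro nn_integral_eq_integral integrable_normal_density \<sigma>(1)) auto
  finally show ?thesis by simp
qed

lemma norm_square_eq_sum: "(norm (x::'a::euclidean_space))\<^sup>2 = (\<Sum>b\<in>Basis. (x \<bullet> b)\<^sup>2)"
  unfolding power2_norm_eq_inner by (subst euclidean_inner) (simp only: power2_eq_square)

lemma nn_integral_gaussian:
  assumes "\<tau> > 0"
  shows "(\<integral>\<^sup>+x. ennreal (exp (- \<tau> * (norm (x::'a::euclidean_space))\<^sup>2)) \<partial>lborel)
    = ennreal (sqrt (pi / \<tau>) ^ DIM('a))"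
proof -
  have "ennreal (exp (- \<tau> * (norm x)\<^sup>2)) = (\<Prod>b\<in>Basis. ennreal (exp (- \<tau> * (x \<bullet> b)\<^sup>2)))" for x :: 'a
    by (simp add: norm_square_eq_sum sum_distrib_left exp_sum prod_ennreal)
  then have "(\<integral>\<^sup>+x. ennreal (exp (- \<tau> * (norm (x::'a))\<^sup>2)) \<partial>lborel)
    = (\<Prod>b\<in>(Basis::'a set). (\<integral>\<^sup>+x. ennreal (exp (- \<tau> * x\<^sup>2)) \<partial>lborel))"
    by (simp only:) (rule nn_integral_lborel_prod, auto)
  then show ?thesis
    unfolding nn_integral_gaussian_real[OF assms] using assms by (simp add: ennreal_power)
qed

text \<open>Integrating out all coordinates but one leaves a one-dimensional Gaussian integral.\<close>

lemma nn_integral_gaussian_slab: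
  fixes b :: "'a::euclidean_space"
  assumes "\<tau> > 0" "b \<in> Basis" and [measurable]: "g \<in> borel_measurable borel"
  shows "(\<integral>\<^sup>+x. ennreal (exp (- \<tau> * (norm (x::'a))\<^sup>2)) * g (x \<bullet> b) \<partial>lborel)
    = ennreal (sqrt (pi / \<tau>) ^ (DIM('a) - 1)) * (\<integral>\<^sup>+s. ennreal (exp (- \<tau> * s\<^sup>2)) * g s \<partial>lborel)"
proof -
  define h where "h c s = ennreal (exp (- \<tau> * s\<^sup>2)) * (if c = b then g s else 1)" for c :: 'a and s
  have "ennreal (exp (- \<tau> * (norm x)\<^sup>2)) * g (x \<bullet> b) = (\<Prod>c\<in>Basis. h c (x \<bullet> c))" for x :: 'a
  proof -
    have "ennreal (exp (- \<tau> * (norm x)\<^sup>2)) = (\<Prod>c\<in>Basis. ennreal (exp (- \<tau> * (x \<bullet> c)\<^sup>2)))"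
      by (simp add: norm_square_eq_sum sum_distrib_left exp_sum prod_ennreal)
    moreover have "g (x \<bullet> b) = (\<Prod>c\<in>Basis. if c = b then g (x \<bullet> c) else 1)"
      using assms(2) by (simp add: prod.delta)
    ultimately show ?thesis by (simp add: h_def prod.distrib)
  qed
  then have "(\<integral>\<^sup>+x. ennreal (exp (- \<tau> * (norm (x::'a))\<^sup>2)) * g (x \<bullet> b) \<partial>lborel)
     = (\<integral>\<^sup>+x. (\<Prod>c\<in>Basis. h c (x \<bullet> c)) \<partial>lborel)" by simp
  also have "\<dots> = (\<Prod>c\<in>Basis. \<integral>\<^sup>+s. h c s \<partial>lborel)"
    by (rule nn_integral_lborel_prod) (auto simp: h_def)
  also have "\<dots> = (\<integral>\<^sup>+s. h b s \<partial>lborel) * (\<Prod>c\<in>Basis - {b}. \<integral>\<^sup>+s. h c s \<partial>lborel)"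
    using assms(2) by (simp add: prod.remove)
  also have "(\<Prod>c\<in>Basis - {b}. \<integral>\<^sup>+s. h c s \<partial>lborel) = (\<Prod>c\<in>Basis - {b}. ennreal (sqrt (pi / \<tau>)))"
    using nn_integral_gaussian_real[OF assms(1)] by (intro prod.cong) (auto simp: h_def)
  also have "\<dots> = ennreal (sqrt (pi / \<tau>) ^ (DIM('a) - 1))"
    using assms by (simp add: ennreal_power card_Diff_singleton)
  finally show ?thesis by (simp add: h_def mult.commute)
qed

text \<open>Translating by the midpoint of \<open>x\<close> and \<open>y\<close> makes the two points symmetric about the origin.\<close>

lemma nn_integral_pair_recentre:
  fixes H :: "'a::euclidean_space \<Rightarrow> 'a \<Rightarrow> ennreal"
  assumes [measurable]: "case_prod H \<in> borel_measurable borel"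
  shows "(\<integral>\<^sup>+t. H (x + t) (y + t) \<partial>lborel)
    = (\<integral>\<^sup>+u. H (u + (1/2) *\<^sub>R (x - y)) (u - (1/2) *\<^sub>R (x - y)) \<partial>lborel)"
proof -
  have "(\<lambda>t. case_prod H (x + t, y + t)) \<in> borel_measurable borel" by measurable
  then have m: "(\<lambda>t. H (x + t) (y + t)) \<in> borel_measurable borel" by simp
  have "x + (- (1/2) *\<^sub>R (x + y) + u) = u + (1/2) *\<^sub>R (x - y)"
    "y + (- (1/2) *\<^sub>R (x + y) + u) = u - (1/2) *\<^sub>R (x - y)" for u
  proof -
    have e: "x = (1/2) *\<^sub>R x + (1/2) *\<^sub>R x" "y = (1/2) *\<^sub>R y + (1/2) *\<^sub>R y"
      by (simp_all add: scaleR_left_distrib[symmetric])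
    show "x + (- (1/2) *\<^sub>R (x + y) + u) = u + (1/2) *\<^sub>R (x - y)"
      by (subst (1) e(1)) (simp add: algebra_simps)
    show "y + (- (1/2) *\<^sub>R (x + y) + u) = u - (1/2) *\<^sub>R (x - y)"
      by (subst (1) e(2)) (simp add: algebra_simps)
  qed
  then show ?thesis
    by (subst nn_integral_lborel_translate[OF m, of "- (1/2) *\<^sub>R (x + y)", symmetric]) (simp only:)
qed

lemma nn_integral_even:
  assumes [measurable]: "h \<in> borel_measurable borel"
  shows "(\<integral>\<^sup>+s. h \<bar>s\<bar> \<partial>lborel) = 2 * (\<integral>\<^sup>+s. indicator {0..} s * h s \<partial>(lborel :: real measure))"
proof -
  have "(\<integral>\<^sup>+s. h \<bar>s\<bar> \<partial>lborel) = (\<integral>\<^sup>+s. indicator {0..} s * h s + indicator {0..} (0 - s) * h (0 - s) \<partial>(lborel :: real measure))"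
    using AE_lborel_singleton[of "0::real"]
    by (intro nn_integral_cong_AE) (auto simp: indicator_def)
  also have "\<dots> = (\<integral>\<^sup>+s. indicator {0..} s * h s \<partial>(lborel :: real measure))
      + (\<integral>\<^sup>+s. indicator {0..} (0 - s) * h (0 - s) \<partial>(lborel :: real measure))"
    by (intro nn_integral_add) auto
  also have "(\<integral>\<^sup>+s. indicator {0..} (0 - s) * h (0 - s) \<partial>(lborel :: real measure)) = (\<integral>\<^sup>+s. indicator {0..} s * h s \<partial>(lborel :: real measure))"
    by (rule nn_integral_lborel_reflect) auto
  finally show ?thesis by (simp add: mult_2)
qed

lemma max_norm_parallelogram:
  fixes u a :: "'a::real_inner"
  shows "(max (norm (u + a)) (norm (u - a)))\<^sup>2 = (norm u)\<^sup>2 + (norm a)\<^sup>2 + 2 * \<bar>u \<bullet> a\<bar>"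
proof -
  have p: "(norm (u + a))\<^sup>2 = (norm u)\<^sup>2 + (norm a)\<^sup>2 + 2 * (u \<bullet> a)"
    "(norm (u - a))\<^sup>2 = (norm u)\<^sup>2 + (norm a)\<^sup>2 - 2 * (u \<bullet> a)"
    by (simp_all add: power2_norm_eq_inner inner_simps inner_commute)
  have "(max (norm (u + a)) (norm (u - a)))\<^sup>2 = max ((norm (u + a))\<^sup>2) ((norm (u - a))\<^sup>2)"
    by (simp add: max_def)
  then show ?thesis unfolding p by (simp add: max_def abs_if)
qed

text \<open>After recentring, the exponent is \<open>-\<kappa> (|u|\<^sup>2 + |a|\<^sup>2 + 2 |u \<bullet> a|)\<close> with \<open>a = (x - y) / 2\<close>.  A rotation
moves \<open>a\<close> to a multiple of a basis vector \<open>b\<close>; the coordinates orthogonal to \<open>b\<close> split off, and in the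
remaining coordinate \<open>s\<close> the square \<open>(|s| + |a|)\<^sup>2\<close> is completed.\<close>

lemma nn_integral_ball_pair:
  fixes x y :: "'a::euclidean_space"
  assumes "\<kappa> > 0"
  shows "(\<integral>\<^sup>+t. ennreal (exp (- \<kappa> * (max (norm (x + t)) (norm (y + t)))\<^sup>2)) \<partial>lborel)
    = ennreal (sqrt (pi / \<kappa>) ^ (DIM('a) - 1))
      * (2 * (\<integral>\<^sup>+s. indicator {norm (x - y) / 2..} s * ennreal (exp (- \<kappa> * s\<^sup>2)) \<partial>lborel))"
proof -
  define a where "a = (1/2) *\<^sub>R (x - y)"
  define r where "r = norm (x - y) / 2"
  have r: "norm a = r" "r \<ge> 0" by (auto simp: a_def r_def)
  obtain b :: 'a where b: "b \<in> Basis" using nonempty_Basis by blast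
  have "norm (r *\<^sub>R b) = norm a" using r b by simp
  then obtain f where f: "orthogonal_transformation f" "f (r *\<^sub>R b) = a"
    by (rule orthogonal_transformation_mapping)
  define g where "g s = ennreal (exp (- \<kappa> * (r\<^sup>2 + 2 * r * \<bar>s\<bar>)))" for s
  define F :: "'a \<Rightarrow> ennreal" where "F u = ennreal (exp (- \<kappa> * ((norm u)\<^sup>2 + (norm a)\<^sup>2 + 2 * \<bar>u \<bullet> a\<bar>)))" for u
  have [measurable]: "g \<in> borel_measurable borel" unfolding g_def by measurable
  have F: "F \<in> borel_measurable borel" unfolding F_def by measurable
  have "(\<integral>\<^sup>+t. ennreal (exp (- \<kappa> * (max (norm (x + t)) (norm (y + t)))\<^sup>2)) \<partial>lborel)
     = (\<integral>\<^sup>+u. ennreal (exp (- \<kappa> * (max (norm (u + a)) (norm (u - a)))\<^sup>2)) \<partial>lborel)"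
    unfolding a_def
    by (rule nn_integral_pair_recentre[of "\<lambda>x y. ennreal (exp (- \<kappa> * (max (norm x) (norm y))\<^sup>2))"])
       (unfold borel_prod[symmetric], measurable)
  also have "\<dots> = (\<integral>\<^sup>+u. F u \<partial>lborel)"
    unfolding max_norm_parallelogram F_def ..
  also have "\<dots> = (\<integral>\<^sup>+u. F (f u) \<partial>lborel)"
    using nn_integral_lborel_orthogonal_transformation[OF f(1) F] by simp
  also have "\<dots> = (\<integral>\<^sup>+u. ennreal (exp (- \<kappa> * (norm u)\<^sup>2)) * g (u \<bullet> b) \<partial>lborel)"
  proof (rule nn_integral_cong)
    fix u :: 'a
    have "f u \<bullet> a = r * (u \<bullet> b)"
      using f(1) by (simp add: f(2)[symmetric] orthogonal_transformation_def)
    then have "F (f u) = ennreal (exp (- \<kappa> * (norm u)\<^sup>2 + - \<kappa> * (r\<^sup>2 + 2 * r * \<bar>u \<bullet> b\<bar>)))"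
      using r by (simp add: F_def orthogonal_transformation_norm[OF f(1)] abs_mult algebra_simps)
    then show "F (f u) = ennreal (exp (- \<kappa> * (norm u)\<^sup>2)) * g (u \<bullet> b)"
      by (simp only: exp_add g_def ennreal_mult'[OF exp_ge_zero])
  qed
  also have "\<dots> = ennreal (sqrt (pi / \<kappa>) ^ (DIM('a) - 1)) * (\<integral>\<^sup>+s. ennreal (exp (- \<kappa> * s\<^sup>2)) * g s \<partial>lborel)"
    by (rule nn_integral_gaussian_slab) (use assms b in auto)
  also have "(\<integral>\<^sup>+s. ennreal (exp (- \<kappa> * s\<^sup>2)) * g s \<partial>lborel) = (\<integral>\<^sup>+s. ennreal (exp (- \<kappa> * (r + \<bar>s\<bar>)\<^sup>2)) \<partial>lborel)"
  proof (rule nn_integral_cong)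
    fix s :: real
    have "- \<kappa> * (r + \<bar>s\<bar>)\<^sup>2 = - \<kappa> * s\<^sup>2 + - \<kappa> * (r\<^sup>2 + 2 * r * \<bar>s\<bar>)"
      by (simp add: power2_sum algebra_simps)
    then show "ennreal (exp (- \<kappa> * s\<^sup>2)) * g s = ennreal (exp (- \<kappa> * (r + \<bar>s\<bar>)\<^sup>2))"
      by (simp only: exp_add g_def ennreal_mult'[OF exp_ge_zero])
  qed
  also have "\<dots> = 2 * (\<integral>\<^sup>+s. indicator {0..} s * ennreal (exp (- \<kappa> * (r + s)\<^sup>2)) \<partial>lborel)"
    by (rule nn_integral_even) measurable
  also have "(\<integral>\<^sup>+s. indicator {0..} s * ennreal (exp (- \<kappa> * (r + s)\<^sup>2)) \<partial>lborel)
     = (\<integral>\<^sup>+s. indicator {r..} (r + s) * ennreal (exp (- \<kappa> * (r + s)\<^sup>2)) \<partial>lborel)"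
    by (intro nn_integral_cong) (auto simp: indicator_def)
  also have "\<dots> = (\<integral>\<^sup>+s. indicator {r..} s * ennreal (exp (- \<kappa> * s\<^sup>2)) \<partial>lborel)"
    by (rule nn_integral_lborel_translate) measurable
  finally show ?thesis unfolding r_def .
qed

lemma nn_integral_gaussian_pair:
  fixes x y :: "'a::euclidean_space"
  assumes "\<tau> > 0"
  shows "(\<integral>\<^sup>+t. ennreal (exp (- \<tau> / 2 * ((norm (x + t))\<^sup>2 + (norm (y + t))\<^sup>2))) \<partial>lborel)
    = ennreal (exp (- \<tau> * (norm (x - y) / 2)\<^sup>2) * sqrt (pi / \<tau>) ^ DIM('a))"
proof -
  define a where "a = (1/2) *\<^sub>R (x - y)"
  have r: "norm a = norm (x - y) / 2" by (auto simp: a_def)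
  have "(\<integral>\<^sup>+t. ennreal (exp (- \<tau> / 2 * ((norm (x + t))\<^sup>2 + (norm (y + t))\<^sup>2))) \<partial>lborel)
     = (\<integral>\<^sup>+u. ennreal (exp (- \<tau> / 2 * ((norm (u + a))\<^sup>2 + (norm (u - a))\<^sup>2))) \<partial>lborel)"
    unfolding a_def
    by (rule nn_integral_pair_recentre[of "\<lambda>x y. ennreal (exp (- \<tau> / 2 * ((norm x)\<^sup>2 + (norm y)\<^sup>2)))"])
       (unfold borel_prod[symmetric], measurable)
  also have "\<dots> = (\<integral>\<^sup>+u. ennreal (exp (- \<tau> * (norm a)\<^sup>2)) * ennreal (exp (- \<tau> * (norm (u::'a))\<^sup>2)) \<partial>lborel)"
  proof (rule nn_integral_cong)
    fix u :: 'a
    have "(norm (u + a))\<^sup>2 + (norm (u - a))\<^sup>2 = 2 * ((norm a)\<^sup>2 + (norm u)\<^sup>2)"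
      by (simp add: power2_norm_eq_inner inner_simps inner_commute)
    then have "- \<tau> / 2 * ((norm (u + a))\<^sup>2 + (norm (u - a))\<^sup>2) = - \<tau> * (norm a)\<^sup>2 + - \<tau> * (norm u)\<^sup>2"
      by (simp add: algebra_simps)
    then show "ennreal (exp (- \<tau> / 2 * ((norm (u + a))\<^sup>2 + (norm (u - a))\<^sup>2)))
      = ennreal (exp (- \<tau> * (norm a)\<^sup>2)) * ennreal (exp (- \<tau> * (norm u)\<^sup>2))"
      by (simp only: exp_add ennreal_mult'[OF exp_ge_zero])
  qed
  also have "\<dots> = ennreal (exp (- \<tau> * (norm a)\<^sup>2)) * ennreal (sqrt (pi / \<tau>) ^ DIM('a))"
    using nn_integral_gaussian[OF assms, where 'a='a] by (subst nn_integral_cmult) simp_all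
  finally show ?thesis
    by (simp only: r ennreal_mult'[OF exp_ge_zero])
qed

section \<open>The Gaussian tail as a mixture of Gaussians\<close>

lemma nn_integral_gaussian_tail:
  assumes "\<tau> > 0" "0 \<le> r"
  shows "(\<integral>\<^sup>+s. indicator {r..} s * ennreal (2 * s * exp (- \<tau> * s\<^sup>2)) \<partial>lborel)
    = ennreal (exp (- \<tau> * r\<^sup>2) / \<tau>)"
proof -
  have "(\<integral>\<^sup>+s. ennreal (2 * s * exp (- \<tau> * s\<^sup>2)) * indicator {r..} s \<partial>lborel)
     = ennreal (0 - (- (exp (- \<tau> * r\<^sup>2) / \<tau>)))"
  proof (rule nn_integral_FTC_atLeast)
    show "((\<lambda>s. - (exp (- \<tau> * s\<^sup>2) / \<tau>)) has_real_derivative 2 * s * exp (- \<tau> * s\<^sup>2)) (at s)" for s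
      using assms by (auto intro!: derivative_eq_intros)
    have "filterlim (\<lambda>s::real. s\<^sup>2) at_top at_top"
      by (rule filterlim_pow_at_top) (auto simp: filterlim_ident)
    then have "filterlim (\<lambda>s::real. - \<tau> * s\<^sup>2) at_bot at_top"
      using assms by (intro filterlim_tendsto_neg_mult_at_bot[OF tendsto_const]) auto
    then have "((\<lambda>s. exp (- \<tau> * s\<^sup>2)) \<longlongrightarrow> 0) at_top"
      by (rule filterlim_compose[OF exp_at_bot])
    then have "((\<lambda>s. - (exp (- \<tau> * s\<^sup>2) / \<tau>)) \<longlongrightarrow> - (0 / \<tau>)) at_top"
      using assms by (intro tendsto_intros) auto
    then show "((\<lambda>s. - (exp (- \<tau> * s\<^sup>2) / \<tau>)) \<longlongrightarrow> 0) at_top" by simp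
  qed (use assms in auto)
  then show ?thesis by (simp add: mult.commute)
qed

text \<open>The substitution \<open>\<tau> = \<kappa> + u / s\<^sup>2\<close> reduces this to \<open>\<Gamma>(1/2) = sqrt pi\<close>.  It represents \<open>1 / s\<close>, times a
Gaussian factor, as a mixture of Gaussians.\<close>

lemma nn_integral_inverse_sqrt_exp:
  assumes "s > (0::real)"
  shows "(\<integral>\<^sup>+\<tau>. indicator {\<kappa><..} \<tau> * ennreal ((\<tau> - \<kappa>) powr (-1/2) * exp (- \<tau> * s\<^sup>2)) \<partial>lborel)
    = ennreal (exp (- \<kappa> * s\<^sup>2) * (sqrt pi / s))"
proof -
  define F where "F \<tau> = indicator {\<kappa><..} \<tau> * ennreal ((\<tau> - \<kappa>) powr (-1/2) * exp (- \<tau> * s\<^sup>2))" for \<tau>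
  have [measurable]: "F \<in> borel_measurable borel" unfolding F_def by measurable
  have "(\<integral>\<^sup>+\<tau>. F \<tau> \<partial>lborel) = ennreal \<bar>1 / s\<^sup>2\<bar> * (\<integral>\<^sup>+u. F (\<kappa> + 1 / s\<^sup>2 * u) \<partial>lborel)"
    using assms by (intro nn_integral_real_affine) auto
  also have "(\<integral>\<^sup>+u. F (\<kappa> + 1 / s\<^sup>2 * u) \<partial>lborel)
    = (\<integral>\<^sup>+u. ennreal (exp (- \<kappa> * s\<^sup>2) * s) * ennreal (indicator {0..} u * u powr (1/2 - 1) / exp u) \<partial>lborel)"
  proof (rule nn_integral_cong)
    fix u :: real
    show "F (\<kappa> + 1 / s\<^sup>2 * u) = ennreal (exp (- \<kappa> * s\<^sup>2) * s) * ennreal (indicator {0..} u * u powr (1/2 - 1) / exp u)"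
    proof (cases "u > 0")
      case True
      have "(1 / s\<^sup>2 * u) powr (-1/2) = s * u powr (-1/2)"
      proof -
        have "(1 / s\<^sup>2 * u) powr (-1/2) = (1 / s\<^sup>2) powr (-1/2) * u powr (-1/2)"
          using assms True by (intro powr_mult)
        also have "(1 / s\<^sup>2) powr (-1/2) = s"
          using assms by (simp add: powr_minus powr_half_sqrt real_sqrt_divide powr_divide)
        finally show ?thesis .
      qed
      moreover have "exp (- (\<kappa> + 1 / s\<^sup>2 * u) * s\<^sup>2) = exp (- \<kappa> * s\<^sup>2) * (1 / exp u)"
      proof -
        have "- (\<kappa> + 1 / s\<^sup>2 * u) * s\<^sup>2 = - \<kappa> * s\<^sup>2 - u" using assms by (simp add: field_simps)
        then show ?thesis by (simp only: exp_diff) simp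
      qed
      ultimately show ?thesis
        using True assms by (simp add: F_def ennreal_mult[symmetric] mult_ac)
    next
      case False
      then have "\<not> \<kappa> < \<kappa> + 1 / s\<^sup>2 * u" using assms by (simp add: field_simps mult_nonpos_nonneg)
      then show ?thesis using False by (cases "u = 0") (auto simp: F_def indicator_def)
    qed
  qed
  also have "\<dots> = ennreal (exp (- \<kappa> * s\<^sup>2) * s) * ennreal (Gamma (1/2))"
    by (subst Gamma_conv_nn_integral_real) (auto intro: nn_integral_cmult)
  finally show ?thesis
    using assms unfolding F_def Gamma_one_half_real
    by (simp add: ennreal_mult[symmetric] field_simps power2_eq_square)
qed

text \<open>In the tail integral \<open>\<integral>\<^sub>r\<^sup>\<infinity> exp (-\<kappa>s\<^sup>2) ds\<close> write \<open>exp (-\<kappa>s\<^sup>2) = s (exp (-\<kappa>s\<^sup>2) / s)\<close>, replace the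
second factor by its mixture of Gaussians \<open>exp (-\<tau>s\<^sup>2)\<close>, and exchange the integrals: each
\<open>\<integral>\<^sub>r\<^sup>\<infinity> s exp (-\<tau>s\<^sup>2) ds\<close> is elementary and equals \<open>exp (-\<tau>r\<^sup>2) / (2\<tau>)\<close>.\<close>

lemma gaussian_tail_mixture:
  assumes "\<kappa> > 0" "0 \<le> r"
  shows "(\<integral>\<^sup>+\<tau>. indicator {\<kappa><..} \<tau> * ennreal ((\<tau> - \<kappa>) powr (-1/2) / \<tau>) * ennreal (exp (- \<tau> * r\<^sup>2)) \<partial>lborel)
    = ennreal (sqrt pi) * (2 * (\<integral>\<^sup>+s. indicator {r..} s * ennreal (exp (- \<kappa> * s\<^sup>2)) \<partial>lborel))"
proof -
  have "(\<integral>\<^sup>+\<tau>. indicator {\<kappa><..} \<tau> * ennreal ((\<tau> - \<kappa>) powr (-1/2) / \<tau>) * ennreal (exp (- \<tau> * r\<^sup>2)) \<partial>lborel)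
    = (\<integral>\<^sup>+\<tau>. (\<integral>\<^sup>+s. indicator {\<kappa><..} \<tau> * ennreal ((\<tau> - \<kappa>) powr (-1/2)) *
         (indicator {r..} s * ennreal (2 * s * exp (- \<tau> * s\<^sup>2))) \<partial>lborel) \<partial>lborel)"
  proof (rule nn_integral_cong)
    fix \<tau> :: real
    have "(\<integral>\<^sup>+s. indicator {\<kappa><..} \<tau> * ennreal ((\<tau> - \<kappa>) powr (-1/2)) *
         (indicator {r..} s * ennreal (2 * s * exp (- \<tau> * s\<^sup>2))) \<partial>lborel)
       = indicator {\<kappa><..} \<tau> * ennreal ((\<tau> - \<kappa>) powr (-1/2)) *
         (\<integral>\<^sup>+s. indicator {r..} s * ennreal (2 * s * exp (- \<tau> * s\<^sup>2)) \<partial>lborel)"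
      by (rule nn_integral_cmult) measurable
    also have "\<dots> = indicator {\<kappa><..} \<tau> * ennreal ((\<tau> - \<kappa>) powr (-1/2) / \<tau>) * ennreal (exp (- \<tau> * r\<^sup>2))"
    proof (cases "\<kappa> < \<tau>")
      case True
      then have "\<tau> > 0" using assms by simp
      then show ?thesis
        unfolding nn_integral_gaussian_tail[OF \<open>\<tau> > 0\<close> \<open>0 \<le> r\<close>] unfolding mult.assoc
        by (simp only: ennreal_mult[symmetric] powr_ge_zero exp_ge_zero divide_nonneg_pos) (simp add: mult.commute)
    qed simp
    finally show "indicator {\<kappa><..} \<tau> * ennreal ((\<tau> - \<kappa>) powr (-1/2) / \<tau>) * ennreal (exp (- \<tau> * r\<^sup>2))
      = (\<integral>\<^sup>+s. indicator {\<kappa><..} \<tau> * ennreal ((\<tau> - \<kappa>) powr (-1/2)) *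
         (indicator {r..} s * ennreal (2 * s * exp (- \<tau> * s\<^sup>2))) \<partial>lborel)" by simp
  qed
  also have "\<dots> = (\<integral>\<^sup>+s. (\<integral>\<^sup>+\<tau>. indicator {\<kappa><..} \<tau> * ennreal ((\<tau> - \<kappa>) powr (-1/2)) *
         (indicator {r..} s * ennreal (2 * s * exp (- \<tau> * s\<^sup>2))) \<partial>lborel) \<partial>lborel)"
    by (rule lborel_pair.Fubini') measurable
  also have "\<dots> = (\<integral>\<^sup>+s. ennreal (2 * sqrt pi) * (indicator {r..} s * ennreal (exp (- \<kappa> * s\<^sup>2))) \<partial>lborel)"
  proof (rule nn_integral_cong_AE, use AE_lborel_singleton[of "0::real"] in eventually_elim)
    fix s :: real assume "s \<noteq> 0"
    show "(\<integral>\<^sup>+\<tau>. indicator {\<kappa><..} \<tau> * ennreal ((\<tau> - \<kappa>) powr (-1/2)) *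
         (indicator {r..} s * ennreal (2 * s * exp (- \<tau> * s\<^sup>2))) \<partial>lborel)
       = ennreal (2 * sqrt pi) * (indicator {r..} s * ennreal (exp (- \<kappa> * s\<^sup>2)))"
    proof (cases "r \<le> s")
      case True
      then have s: "s > 0" using \<open>s \<noteq> 0\<close> assms by simp
      have "(\<integral>\<^sup>+\<tau>. indicator {\<kappa><..} \<tau> * ennreal ((\<tau> - \<kappa>) powr (-1/2)) *
         (indicator {r..} s * ennreal (2 * s * exp (- \<tau> * s\<^sup>2))) \<partial>lborel)
         = (\<integral>\<^sup>+\<tau>. ennreal (2 * s) * (indicator {\<kappa><..} \<tau> * ennreal ((\<tau> - \<kappa>) powr (-1/2) * exp (- \<tau> * s\<^sup>2))) \<partial>lborel)"
        using True s by (intro nn_integral_cong) (simp add: ennreal_mult mult_ac)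
      also have "\<dots> = ennreal (2 * s) * ennreal (exp (- \<kappa> * s\<^sup>2) * (sqrt pi / s))"
        by (subst nn_integral_cmult) (auto simp only: nn_integral_inverse_sqrt_exp[OF s], measurable)
      also have "\<dots> = ennreal (2 * sqrt pi * exp (- \<kappa> * s\<^sup>2))"
        using s by (simp add: ennreal_mult[symmetric] field_simps)
      finally show ?thesis using True by (simp add: ennreal_mult)
    qed simp
  qed
  also have "\<dots> = ennreal (2 * sqrt pi) * (\<integral>\<^sup>+s. indicator {r..} s * ennreal (exp (- \<kappa> * s\<^sup>2)) \<partial>lborel)"
    by (rule nn_integral_cmult) measurable
  finally show ?thesis by (simp add: ennreal_mult mult_ac)
qed

section \<open>Averages over balls as mixtures of Gaussian products\<close>

definition ball_pair :: "real \<Rightarrow> 'a::euclidean_space \<times> 'a \<Rightarrow> ennreal" where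
  "ball_pair \<kappa> z = ennreal (exp (- \<kappa> * (max (norm (fst z)) (norm (snd z)))\<^sup>2))"

definition gauss_pair :: "real \<Rightarrow> 'a::euclidean_space \<times> 'a \<Rightarrow> ennreal" where
  "gauss_pair \<tau> z = ennreal (exp (- \<tau> / 2 * ((norm (fst z))\<^sup>2 + (norm (snd z))\<^sup>2)))"

text \<open>The density of the Gaussian tail mixture, times the factor that turns the normalisation of
\<open>nn_integral_gaussian_pair\<close> into \<open>1\<close>.\<close>

definition mixing :: "nat \<Rightarrow> real \<Rightarrow> real \<Rightarrow> ennreal" where
  "mixing n \<kappa> \<tau> = indicator {\<kappa><..} \<tau> * ennreal ((\<tau> - \<kappa>) powr (-1/2) / \<tau> * sqrt (\<tau> / pi) ^ n)"

lemma measurable_ball_pair [measurable]: "ball_pair \<kappa> \<in> borel_measurable borel"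
  unfolding ball_pair_def[abs_def] borel_prod[symmetric] by measurable

lemma measurable_gauss_pair: "(\<lambda>(\<tau>, z). gauss_pair \<tau> z) \<in> borel_measurable (borel \<Otimes>\<^sub>M borel)"
  unfolding gauss_pair_def[abs_def] borel_prod[symmetric] by measurable

lemma measurable_gauss_pair' [measurable (raw)]:
  assumes [measurable]: "f \<in> borel_measurable N" "g \<in> borel_measurable N"
  shows "(\<lambda>x. gauss_pair (f x) (g x)) \<in> borel_measurable N"
  using measurable_compose[OF measurable_Pair[OF assms] measurable_gauss_pair] by simp

lemma measurable_mixing [measurable]: "mixing n \<kappa> \<in> borel_measurable borel"
  unfolding mixing_def[abs_def] by measurable

text \<open>Both sides are integrals over \<open>\<alpha>\<close> of functions whose diagonal integrals are the same multiple of a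
Gaussian tail.  The constant on the left is chosen to cancel the powers of \<open>\<pi> / \<kappa>\<close>, so that the
weights on the right converge as \<open>\<kappa> \<rightarrow> 0\<close>.\<close>

lemma nn_integral_ball_pair_eq_mixture:
  fixes \<alpha> :: "('a::euclidean_space \<times> 'a) measure"
  assumes \<alpha>: "diagonal_invariant \<alpha>" and "\<kappa> > 0"
  shows "ennreal (sqrt pi * sqrt (\<kappa> / pi) ^ (DIM('a) - 1)) * (\<integral>\<^sup>+z. ball_pair \<kappa> z \<partial>\<alpha>)
    = (\<integral>\<^sup>+\<tau>. mixing DIM('a) \<kappa> \<tau> * (\<integral>\<^sup>+z. gauss_pair \<tau> z \<partial>\<alpha>) \<partial>lborel)"
proof -
  have [measurable_cong]: "sets \<alpha> = sets borel" and "sigma_finite_measure \<alpha>"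
    using \<alpha> by (auto simp: diagonal_invariant_def)
  interpret \<alpha>: sigma_finite_measure \<alpha> by fact
  interpret P: pair_sigma_finite \<alpha> "lborel :: real measure" ..
  let ?c = "ennreal (sqrt pi * sqrt (\<kappa> / pi) ^ (DIM('a) - 1))"
  have "(\<integral>\<^sup>+z. ?c * ball_pair \<kappa> z \<partial>\<alpha>)
    = (\<integral>\<^sup>+z. (\<integral>\<^sup>+\<tau>. mixing DIM('a) \<kappa> \<tau> * gauss_pair \<tau> z \<partial>lborel) \<partial>\<alpha>)"
  proof (rule nn_integral_diagonal_invariant[OF \<alpha>])
    fix x y :: 'a
    let ?r = "norm (x - y) / 2"
    have "(\<integral>\<^sup>+t. ?c * ball_pair \<kappa> (x + t, y + t) \<partial>lborel)
      = ?c * (\<integral>\<^sup>+t. ball_pair \<kappa> (x + t, y + t) \<partial>lborel)"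
      by (intro nn_integral_cmult) measurable
    also have "\<dots> = ?c * ennreal (sqrt (pi / \<kappa>) ^ (DIM('a) - 1))
        * (2 * (\<integral>\<^sup>+s. indicator {?r..} s * ennreal (exp (- \<kappa> * s\<^sup>2)) \<partial>lborel))"
      unfolding ball_pair_def fst_conv snd_conv nn_integral_ball_pair[OF \<open>\<kappa> > 0\<close>] mult.assoc ..
    also have "?c * ennreal (sqrt (pi / \<kappa>) ^ (DIM('a) - 1)) = ennreal (sqrt pi)"
    proof -
      have "sqrt (\<kappa> / pi) ^ (DIM('a) - 1) * sqrt (pi / \<kappa>) ^ (DIM('a) - 1) = 1"
        using \<open>\<kappa> > 0\<close> by (simp add: power_mult_distrib[symmetric] real_sqrt_mult[symmetric])
      then show ?thesis
        using \<open>\<kappa> > 0\<close> by (simp add: ennreal_mult[symmetric] mult.assoc)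
    qed
    finally have L: "(\<integral>\<^sup>+t. ?c * ball_pair \<kappa> (x + t, y + t) \<partial>lborel)
      = ennreal (sqrt pi) * (2 * (\<integral>\<^sup>+s. indicator {?r..} s * ennreal (exp (- \<kappa> * s\<^sup>2)) \<partial>lborel))" .
    have "(\<integral>\<^sup>+t. (\<integral>\<^sup>+\<tau>. mixing DIM('a) \<kappa> \<tau> * gauss_pair \<tau> (x + t, y + t) \<partial>lborel) \<partial>lborel)
      = (\<integral>\<^sup>+\<tau>. (\<integral>\<^sup>+t. mixing DIM('a) \<kappa> \<tau> * gauss_pair \<tau> (x + t, y + t) \<partial>lborel) \<partial>lborel)"
      by (rule lborel_pair.Fubini') measurable
    also have "\<dots> = (\<integral>\<^sup>+\<tau>. indicator {\<kappa><..} \<tau> * ennreal ((\<tau> - \<kappa>) powr (-1/2) / \<tau>) * ennreal (exp (- \<tau> * ?r\<^sup>2)) \<partial>lborel)"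
    proof (rule nn_integral_cong)
      fix \<tau> :: real
      have "(\<integral>\<^sup>+t. mixing DIM('a) \<kappa> \<tau> * gauss_pair \<tau> (x + t, y + t) \<partial>lborel)
        = mixing DIM('a) \<kappa> \<tau> * (\<integral>\<^sup>+t. gauss_pair \<tau> (x + t, y + t) \<partial>lborel)"
        by (intro nn_integral_cmult) measurable
      also have "\<dots> = indicator {\<kappa><..} \<tau> * ennreal ((\<tau> - \<kappa>) powr (-1/2) / \<tau>) * ennreal (exp (- \<tau> * ?r\<^sup>2))"
      proof (cases "\<kappa> < \<tau>")
        case True
        then have \<tau>: "\<tau> > 0" using \<open>\<kappa> > 0\<close> by simp
        have "sqrt (\<tau> / pi) ^ DIM('a) * sqrt (pi / \<tau>) ^ DIM('a) = 1"
          using \<tau> by (simp add: power_mult_distrib[symmetric] real_sqrt_mult[symmetric])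
        then have "(a * sqrt (\<tau> / pi) ^ DIM('a)) * (b * sqrt (pi / \<tau>) ^ DIM('a)) = a * b" for a b
          by (metis (no_types, opaque_lifting) mult.assoc mult.commute mult_1)
        from this[of "(\<tau> - \<kappa>) powr (-1/2) / \<tau>" "exp (- \<tau> * ?r\<^sup>2)"]
        have "((\<tau> - \<kappa>) powr (-1/2) / \<tau> * sqrt (\<tau> / pi) ^ DIM('a)) * (exp (- \<tau> * ?r\<^sup>2) * sqrt (pi / \<tau>) ^ DIM('a))
          = (\<tau> - \<kappa>) powr (-1/2) / \<tau> * exp (- \<tau> * ?r\<^sup>2)"
 .
        then show ?thesis
          unfolding gauss_pair_def fst_conv snd_conv nn_integral_gaussian_pair[OF \<tau>] mixing_def
          using True \<tau> by (simp add: ennreal_mult[symmetric] del: mult_minus_left)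
      qed (simp add: mixing_def)
      finally show "(\<integral>\<^sup>+t. mixing DIM('a) \<kappa> \<tau> * gauss_pair \<tau> (x + t, y + t) \<partial>lborel)
        = indicator {\<kappa><..} \<tau> * ennreal ((\<tau> - \<kappa>) powr (-1/2) / \<tau>) * ennreal (exp (- \<tau> * ?r\<^sup>2))" .
    qed
    also have "\<dots> = ennreal (sqrt pi) * (2 * (\<integral>\<^sup>+s. indicator {?r..} s * ennreal (exp (- \<kappa> * s\<^sup>2)) \<partial>lborel))"
      using \<open>\<kappa> > 0\<close> by (intro gaussian_tail_mixture) auto
    finally show "(\<integral>\<^sup>+t. ?c * ball_pair \<kappa> (x + t, y + t) \<partial>lborel)
      = (\<integral>\<^sup>+t. (\<integral>\<^sup>+\<tau>. mixing DIM('a) \<kappa> \<tau> * gauss_pair \<tau> (x + t, y + t) \<partial>lborel) \<partial>lborel)"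
      unfolding L by simp
  qed measurable
  also have "\<dots> = (\<integral>\<^sup>+\<tau>. (\<integral>\<^sup>+z. mixing DIM('a) \<kappa> \<tau> * gauss_pair \<tau> z \<partial>\<alpha>) \<partial>lborel)"
    by (rule P.Fubini'[symmetric]) measurable
  also have "\<dots> = (\<integral>\<^sup>+\<tau>. mixing DIM('a) \<kappa> \<tau> * (\<integral>\<^sup>+z. gauss_pair \<tau> z \<partial>\<alpha>) \<partial>lborel)"
    by (intro nn_integral_cong nn_integral_cmult) measurable
  finally show ?thesis by (subst (asm) nn_integral_cmult) auto
qed

text \<open>The layer-cake formula for the decreasing function \<open>exp (-\<kappa>m\<^sup>2)\<close> of
\<open>m = max (|x|,|y|)\<close>, whose sublevel sets \<open>m < R\<close> are the products \<open>B\<^sub>R \<times> B\<^sub>R\<close>.\<close>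

lemma nn_integral_ball_pair_layers:
  fixes \<alpha> :: "('a::euclidean_space \<times> 'a) measure"
  assumes sets_\<alpha> [measurable_cong]: "sets \<alpha> = sets borel" and "sigma_finite_measure \<alpha>" and "\<kappa> > 0"
  shows "(\<integral>\<^sup>+z. ball_pair \<kappa> z \<partial>\<alpha>)
    = (\<integral>\<^sup>+R. indicator {0..} R * ennreal (2 * \<kappa> * R * exp (- \<kappa> * R\<^sup>2)) * emeasure \<alpha> (ball 0 R \<times> ball 0 R) \<partial>lborel)"
proof -
  interpret \<alpha>: sigma_finite_measure \<alpha> by fact
  interpret P: pair_sigma_finite \<alpha> "lborel :: real measure" ..
  define w where "w R = indicator {0..} R * ennreal (2 * \<kappa> * R * exp (- \<kappa> * R\<^sup>2))" for R
  define m where "m z = max (norm (fst z)) (norm (snd z))" for z :: "'a \<times> 'a"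
  have [measurable]: "w \<in> borel_measurable borel" unfolding w_def by measurable
  have [measurable]: "m \<in> borel_measurable borel" unfolding m_def borel_prod[symmetric] by measurable
  have [measurable]: "Measurable.pred (borel \<Otimes>\<^sub>M borel) (\<lambda>x. snd x \<in> {m (fst x)<..})"
    unfolding greaterThan_iff by measurable
  have "(\<integral>\<^sup>+z. ball_pair \<kappa> z \<partial>\<alpha>) = (\<integral>\<^sup>+z. (\<integral>\<^sup>+R. w R * indicator {m z<..} R \<partial>lborel) \<partial>\<alpha>)"
  proof (rule nn_integral_cong)
    fix z :: "'a \<times> 'a"
    have m: "m z \<ge> 0" by (simp add: m_def le_max_iff_disj)
    have "(\<integral>\<^sup>+R. w R * indicator {m z<..} R \<partial>lborel)
      = (\<integral>\<^sup>+R. ennreal \<kappa> * (indicator {m z..} R * ennreal (2 * R * exp (- \<kappa> * R\<^sup>2))) \<partial>lborel)"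
      using AE_lborel_singleton[of "m z"] m \<open>\<kappa> > 0\<close>
      by (intro nn_integral_cong_AE) (auto simp: w_def indicator_def ennreal_mult[symmetric] mult_ac)
    also have "\<dots> = ennreal \<kappa> * (\<integral>\<^sup>+R. indicator {m z..} R * ennreal (2 * R * exp (- \<kappa> * R\<^sup>2)) \<partial>lborel)"
      by (rule nn_integral_cmult) measurable
    also have "\<dots> = ball_pair \<kappa> z"
      unfolding nn_integral_gaussian_tail[OF \<open>\<kappa> > 0\<close> m] ball_pair_def m_def[symmetric]
      using \<open>\<kappa> > 0\<close> by (simp add: ennreal_mult[symmetric])
    finally show "ball_pair \<kappa> z = (\<integral>\<^sup>+R. w R * indicator {m z<..} R \<partial>lborel)" by simp
  qed
  also have "\<dots> = (\<integral>\<^sup>+R. (\<integral>\<^sup>+z. w R * indicator {m z<..} R \<partial>\<alpha>) \<partial>lborel)"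
    by (rule P.Fubini'[symmetric]) measurable
  also have "\<dots> = (\<integral>\<^sup>+R. w R * emeasure \<alpha> (ball 0 R \<times> ball 0 R) \<partial>lborel)"
  proof (rule nn_integral_cong)
    fix R :: real
    have B: "ball (0::'a) R \<times> ball (0::'a) R \<in> sets \<alpha>"
      unfolding sets_\<alpha> borel_prod[symmetric] by auto
    have "(\<integral>\<^sup>+z. w R * indicator {m z<..} R \<partial>\<alpha>) = (\<integral>\<^sup>+z. w R * indicator (ball 0 R \<times> ball 0 R) z \<partial>\<alpha>)"
      by (intro nn_integral_cong) (auto simp: m_def indicator_def mem_Times_iff)
    then show "(\<integral>\<^sup>+z. w R * indicator {m z<..} R \<partial>\<alpha>) = w R * emeasure \<alpha> (ball 0 R \<times> ball 0 R)"
      using B by (simp add: nn_integral_cmult_indicator)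
  qed
  finally show ?thesis unfolding w_def .
qed

lemma nn_integral_power_gaussian_finite:
  "(\<integral>\<^sup>+s. indicator {0..} s * ennreal (s ^ n * exp (- s\<^sup>2)) \<partial>(lborel::real measure)) < \<infinity>"
proof -
  have "integrable lborel (\<lambda>x::real. indicator {0..} x *\<^sub>R (exp (- x\<^sup>2) * x ^ n))"
  proof (cases "even n")
    case True
    then obtain k where n: "n = 2 * k" by (rule evenE)
    show ?thesis using gaussian_moment_even_pos[of k] unfolding n has_bochner_integral_iff by blast
  next
    case False
    then obtain k where n: "n = 2 * k + 1" by (rule oddE)
    show ?thesis using gaussian_moment_odd_pos[of k] unfolding n has_bochner_integral_iff by blast
  qed
  then have "(\<integral>\<^sup>+x. ennreal (norm (indicator {0..} x *\<^sub>R (exp (- x\<^sup>2) * x ^ n))) \<partial>(lborel::real measure)) < \<infinity>"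
    by (simp add: integrable_iff_bounded)
  also have "(\<integral>\<^sup>+x. ennreal (norm (indicator {0..} x *\<^sub>R (exp (- x\<^sup>2) * x ^ n))) \<partial>(lborel::real measure))
     = (\<integral>\<^sup>+s. indicator {0..} s * ennreal (s ^ n * exp (- s\<^sup>2)) \<partial>(lborel::real measure))"
    by (intro nn_integral_cong) (auto simp: indicator_def abs_mult mult.commute)
  finally show ?thesis .
qed

lemma nn_integral_power_gaussian_scale:
  assumes "\<kappa> > 0" "n \<ge> 1"
  shows "(\<integral>\<^sup>+R. indicator {0..} R * ennreal (2 * \<kappa> * R * exp (- \<kappa> * R\<^sup>2)) * ennreal (R ^ (n - 1)) \<partial>lborel)
    = ennreal (2 / sqrt \<kappa> ^ (n - 1)) * (\<integral>\<^sup>+s. indicator {0..} s * ennreal (s ^ n * exp (- s\<^sup>2)) \<partial>(lborel::real measure))"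
proof -
  define c where "c = 1 / sqrt \<kappa>"
  have c: "c > 0" "\<kappa> * c * c = 1" using assms by (simp_all add: c_def)
  obtain m where n: "n = Suc m" using assms by (cases n) auto
  define F where "F R = indicator {0..} R * ennreal (2 * \<kappa> * R * exp (- \<kappa> * R\<^sup>2)) * ennreal (R ^ (n - 1))" for R
  have [measurable]: "F \<in> borel_measurable borel" unfolding F_def by measurable
  have "(\<integral>\<^sup>+R. F R \<partial>lborel) = ennreal \<bar>c\<bar> * (\<integral>\<^sup>+s. F (0 + c * s) \<partial>lborel)"
    using c by (intro nn_integral_real_affine) auto
  also have "(\<integral>\<^sup>+s. F (0 + c * s) \<partial>lborel)
    = (\<integral>\<^sup>+s. ennreal (2 * \<kappa> * c ^ n) * (indicator {0..} s * ennreal (s ^ n * exp (- s\<^sup>2))) \<partial>lborel)"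
  proof (rule nn_integral_cong)
    fix s :: real
    show "F (0 + c * s) = ennreal (2 * \<kappa> * c ^ n) * (indicator {0..} s * ennreal (s ^ n * exp (- s\<^sup>2)))"
    proof (cases "s \<ge> 0")
      case True
      have "\<kappa> * (c * s)\<^sup>2 = (\<kappa> * c * c) * s\<^sup>2" by (simp add: power2_eq_square)
      then have "\<kappa> * (c * s)\<^sup>2 = s\<^sup>2" unfolding c(2) by simp
      show ?thesis
      proof -
        have "- \<kappa> * (c * s)\<^sup>2 = - s\<^sup>2" using \<open>\<kappa> * (c * s)\<^sup>2 = s\<^sup>2\<close> by simp
        then have "F (0 + c * s) = ennreal (2 * \<kappa> * (c * s) * exp (- s\<^sup>2)) * ennreal ((c * s) ^ m)"
          using True c by (simp add: F_def n)
        also have "\<dots> = ennreal (2 * \<kappa> * (c * s) * exp (- s\<^sup>2) * (c * s) ^ m)"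
          using True c assms by (intro ennreal_mult[symmetric]) auto
        also have "2 * \<kappa> * (c * s) * exp (- s\<^sup>2) * (c * s) ^ m = 2 * \<kappa> * c ^ n * (s ^ n * exp (- s\<^sup>2))"
          by (simp add: n power_mult_distrib)
        also have "ennreal \<dots> = ennreal (2 * \<kappa> * c ^ n) * ennreal (s ^ n * exp (- s\<^sup>2))"
          using True c assms by (intro ennreal_mult) auto
        finally show ?thesis using True by simp
      qed
    next
      case False
      then show ?thesis using c by (simp add: F_def zero_le_mult_iff)
    qed
  qed
  also have "\<dots> = ennreal (2 * \<kappa> * c ^ n) * (\<integral>\<^sup>+s. indicator {0..} s * ennreal (s ^ n * exp (- s\<^sup>2)) \<partial>lborel)"
    by (rule nn_integral_cmult) measurable
  also have "ennreal \<bar>c\<bar> * (ennreal (2 * \<kappa> * c ^ n) * (\<integral>\<^sup>+s. indicator {0..} s * ennreal (s ^ n * exp (- s\<^sup>2)) \<partial>lborel))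
    = ennreal (2 / sqrt \<kappa> ^ (n - 1)) * (\<integral>\<^sup>+s. indicator {0..} s * ennreal (s ^ n * exp (- s\<^sup>2)) \<partial>lborel)"
  proof -
    have "c * (2 * \<kappa> * c ^ n) = 2 * (\<kappa> * c * c) * c ^ m" by (simp add: n)
    also have "\<dots> = 2 / sqrt \<kappa> ^ (n - 1)" unfolding c(2) by (simp add: n c_def power_divide)
    finally have "c * (2 * \<kappa> * c ^ n) = 2 / sqrt \<kappa> ^ (n - 1)" .
    show ?thesis
    proof -
      have "ennreal \<bar>c\<bar> * ennreal (2 * \<kappa> * c ^ n) = ennreal (2 / sqrt \<kappa> ^ (n - 1))"
        unfolding \<open>c * (2 * \<kappa> * c ^ n) = 2 / sqrt \<kappa> ^ (n - 1)\<close>[symmetric]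
        using c assms by (subst ennreal_mult) auto
      then show ?thesis by (simp only: mult.assoc[symmetric])
    qed
  qed
  finally show ?thesis unfolding F_def .
qed

section \<open>The surface measure of a sphere\<close>

lemma hausdorff_premeasure_le_finite_cover:
  fixes S :: "'i \<Rightarrow> 'a::euclidean_space set"
  assumes I: "finite I" and cover: "A \<subseteq> (\<Union>i\<in>I. S i)"
    and S: "\<And>i. i \<in> I \<Longrightarrow> bounded (S i) \<and> diameter (S i) \<le> d"
    and d: "0 \<le> d" "d \<le> \<delta>"
  shows "hausdorff_premeasure k \<delta> A \<le> of_nat (card I) * ennreal (unit_ball_vol (real k) * (d / 2) ^ k)"
proof -
  obtain h where h: "bij_betw h {0..<card I} I"
    using ex_bij_betw_nat_finite[OF I] by blast
  define E where "E j = (if j < card I then S (h j) else {})" for j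
  have hI: "h j \<in> I" if "j < card I" for j
    using h that by (auto simp: bij_betw_def)
  have "(\<Union>i\<in>I. S i) \<subseteq> (\<Union>j. E j)"
  proof
    fix x assume "x \<in> (\<Union>i\<in>I. S i)"
    then obtain i where i: "i \<in> I" "x \<in> S i" by auto
    then have "i \<in> h ` {0..<card I}" using h by (simp add: bij_betw_def)
    then obtain j where "j < card I" "h j = i" by auto
    with i show "x \<in> (\<Union>j. E j)" by (auto simp: E_def)
  qed
  then have E: "E \<in> {E :: nat \<Rightarrow> 'a set. A \<subseteq> (\<Union>i. E i) \<and> (\<forall>i. bounded (E i) \<and> diameter (E i) \<le> \<delta>)}"
    using cover S hI d by (force simp: E_def)
  have "(\<Sum>i. if E i = {} then 0 else ennreal (unit_ball_vol (real k) * (diameter (E i) / 2) ^ k))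
    = (\<Sum>i<card I. if E i = {} then 0 else ennreal (unit_ball_vol (real k) * (diameter (E i) / 2) ^ k))"
    by (rule suminf_finite) (auto simp: E_def)
  also have "\<dots> \<le> (\<Sum>i<card I. ennreal (unit_ball_vol (real k) * (d / 2) ^ k))"
  proof (rule sum_mono)
    fix i assume i: "i \<in> {..<card I}"
    then have "diameter (E i) \<le> d" "bounded (E i)" using S hI by (auto simp: E_def)
    then have "(diameter (E i) / 2) ^ k \<le> (d / 2) ^ k"
      using diameter_ge_0 by (intro power_mono) auto
    then show "(if E i = {} then 0 else ennreal (unit_ball_vol (real k) * (diameter (E i) / 2) ^ k))
      \<le> ennreal (unit_ball_vol (real k) * (d / 2) ^ k)"
      by (auto intro!: ennreal_leI mult_left_mono)
  qed
  also have "\<dots> = of_nat (card I) * ennreal (unit_ball_vol (real k) * (d / 2) ^ k)"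
    by simp
  finally show ?thesis
    unfolding hausdorff_premeasure_def by (rule INF_lower2[OF E])
qed

lemma norm_normalise_diff_le:
  fixes x y :: "'a::real_normed_vector"
  assumes "1 \<le> norm x" "1 \<le> norm y"
  shows "norm (x /\<^sub>R norm x - y /\<^sub>R norm y) \<le> 2 * norm (x - y)"
proof -
  have ne: "norm x > 0" "norm y > 0" using assms by auto
  have "x /\<^sub>R norm x - y /\<^sub>R norm y = inverse (norm x) *\<^sub>R (x - y) + (inverse (norm x) - inverse (norm y)) *\<^sub>R y"
    by (simp add: algebra_simps)
  then have "norm (x /\<^sub>R norm x - y /\<^sub>R norm y)
    \<le> norm (inverse (norm x) *\<^sub>R (x - y)) + norm ((inverse (norm x) - inverse (norm y)) *\<^sub>R y)"
    using norm_triangle_ineq by metis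
  also have "\<dots> = inverse (norm x) * norm (x - y) + \<bar>inverse (norm x) - inverse (norm y)\<bar> * norm y"
    by simp
  also have "\<bar>inverse (norm x) - inverse (norm y)\<bar> * norm y = inverse (norm x) * \<bar>norm y - norm x\<bar>"
  proof -
    have "(inverse (norm x) - inverse (norm y)) = inverse (norm x) * inverse (norm y) * (norm y - norm x)"
      using ne by (simp add: field_simps)
    then have "\<bar>inverse (norm x) - inverse (norm y)\<bar> = inverse (norm x) * inverse (norm y) * \<bar>norm y - norm x\<bar>"
      using ne by (simp add: abs_mult)
    then show ?thesis using ne by simp
  qed
  also have "\<bar>norm y - norm x\<bar> \<le> norm (x - y)"
    using norm_triangle_ineq3[of x y] by (simp add: abs_minus_commute)
  also have "inverse (norm x) * norm (x - y) + inverse (norm x) * norm (x - y) \<le> 1 * norm (x - y) + 1 * norm (x - y)"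
    using assms by (intro add_mono mult_right_mono inverse_le_1_iff[THEN iffD2]) auto
  finally show ?thesis using ne by (simp add: mult_left_mono)
qed

text \<open>The grid divides \<open>[-1, 1]\<close> into \<open>m\<close> intervals of length \<open>2 / m\<close>; the endpoint \<open>y = 1\<close> belongs to the last.\<close>

lemma interval_grid:
  fixes y :: real
  assumes "-1 \<le> y" "y \<le> 1" "0 < m"
  shows "\<exists>j<m. -1 + 2 * real j / real m \<le> y \<and> y \<le> -1 + 2 * (real j + 1) / real m"
proof (cases "y = 1")
  case True
  then show ?thesis using assms by (intro exI[of _ "m - 1"]) (auto simp: of_nat_diff field_simps)
next
  case False
  define z where "z = (y + 1) * real m / 2"
  have z: "0 \<le> z" using assms by (simp add: z_def)
  have "(y + 1) * real m < 2 * real m" using assms False by (intro mult_strict_right_mono) auto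
  then have z': "z < real m" by (simp add: z_def)
  define j where "j = nat \<lfloor>z\<rfloor>"
  have j: "real j \<le> z" "z < real j + 1" using z by (auto simp: j_def)
  have y: "y = -1 + 2 * z / real m" using assms by (simp add: z_def)
  have "real j < real m" using j z' by linarith
  then have "j < m" by simp
  moreover have "2 * real j / real m \<le> 2 * z / real m" "2 * z / real m \<le> 2 * (real j + 1) / real m"
    using j by (auto intro!: divide_right_mono)
  ultimately show ?thesis unfolding y by (intro exI[of _ j]) auto
qed

text \<open>The cells of a grid on the boundary of the cube \<open>[-1, 1]\<^sup>n\<close>: the direction \<open>b\<close> and the sign \<open>\<sigma>\<close> select
a face, and \<open>f\<close> numbers the grid intervals in the remaining coordinates.  Leaving \<open>b\<close> out of the
domain of \<open>f\<close> makes the number of cells a multiple of \<open>m\<^bsup>n-1\<^esup>\<close> rather than of \<open>m\<^sup>n\<close>.\<close>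

definition face_cell :: "nat \<Rightarrow> 'a::euclidean_space \<times> real \<times> ('a \<Rightarrow> nat) \<Rightarrow> 'a set" where
  "face_cell m = (\<lambda>(b, \<sigma>, f). {\<xi>. \<xi> \<bullet> b = \<sigma> \<and> (\<forall>i\<in>Basis - {b}.
      -1 + 2 * real (f i) / real m \<le> \<xi> \<bullet> i \<and> \<xi> \<bullet> i \<le> -1 + 2 * (real (f i) + 1) / real m)})"

definition face_index :: "nat \<Rightarrow> ('a::euclidean_space \<times> real \<times> ('a \<Rightarrow> nat)) set" where
  "face_index m = (SIGMA b:Basis. {-1, 1} \<times> ((Basis - {b}) \<rightarrow>\<^sub>E {..<m}))"

lemma finite_face_index: "finite (face_index m :: ('a::euclidean_space \<times> real \<times> ('a \<Rightarrow> nat)) set)"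
  unfolding face_index_def by (intro finite_SigmaI finite_cartesian_product finite_PiE) auto

lemma card_face_index:
  "card (face_index m :: ('a::euclidean_space \<times> real \<times> ('a \<Rightarrow> nat)) set) = 2 * DIM('a) * m ^ (DIM('a) - 1)"
proof -
  have "card (face_index m :: ('a \<times> real \<times> ('a \<Rightarrow> nat)) set)
    = (\<Sum>b\<in>(Basis::'a set). card ({-1, 1::real} \<times> ((Basis - {b}) \<rightarrow>\<^sub>E {..<m})))"
    unfolding face_index_def by (intro card_SigmaI) (auto intro!: finite_PiE)
  also have "\<dots> = (\<Sum>b\<in>(Basis::'a set). 2 * m ^ (DIM('a) - 1))"
    by (intro sum.cong) (auto simp: card_cartesian_product card_PiE)
  finally show ?thesis by simp
qed

lemma face_cell_norm_ge_1:
  assumes "c \<in> face_index m" "\<xi> \<in> face_cell m c"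
  shows "1 \<le> norm \<xi>"
proof -
  obtain b \<sigma> f where c: "c = (b, \<sigma>, f)" by (cases c) auto
  have "b \<in> Basis" "\<sigma> \<in> {-1, 1}" "\<xi> \<bullet> b = \<sigma>" using assms by (auto simp: c face_index_def face_cell_def)
  then show ?thesis using Basis_le_norm[of b \<xi>] by auto
qed

lemma face_cell_diff_le:
  fixes \<xi> \<eta> :: "'a::euclidean_space"
  assumes "c \<in> face_index m" "\<xi> \<in> face_cell m c" "\<eta> \<in> face_cell m c"
  shows "norm (\<xi> - \<eta>) \<le> 2 * DIM('a) / m"
proof -
  obtain b \<sigma> f where c: "c = (b, \<sigma>, f)" by (cases c) auto
  have "\<bar>(\<xi> - \<eta>) \<bullet> i\<bar> \<le> 2 / m" if i: "i \<in> Basis" for i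
  proof (cases "i = b")
    case True
    then show ?thesis using assms by (auto simp: c face_cell_def inner_diff_left)
  next
    case False
    with i assms have "-1 + 2 * real (f i) / real m \<le> \<xi> \<bullet> i" "\<xi> \<bullet> i \<le> -1 + 2 * (real (f i) + 1) / real m"
      "-1 + 2 * real (f i) / real m \<le> \<eta> \<bullet> i" "\<eta> \<bullet> i \<le> -1 + 2 * (real (f i) + 1) / real m"
      by (auto simp: c face_cell_def)
    moreover have "2 * (real (f i) + 1) / real m = 2 * real (f i) / real m + 2 / real m"
      by (simp add: add_divide_distrib distrib_left)
    ultimately show ?thesis by (simp add: inner_diff_left abs_le_iff)
  qed
  then have "(\<Sum>i\<in>Basis. \<bar>(\<xi> - \<eta>) \<bullet> i\<bar>) \<le> of_nat DIM('a) * (2 / m)"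
    by (intro sum_bounded_above) auto
  then show ?thesis using norm_le_l1[of "\<xi> - \<eta>"] by (simp add: mult.commute)
qed

text \<open>Dividing a point of the sphere by its largest coordinate in absolute value puts it on a face of the
cube, and the radial projection undoes the division.\<close>

lemma sphere_subset_projected_cells:
  fixes R :: real
  assumes "R > 0" "0 < m"
  shows "sphere (0::'a::euclidean_space) R \<subseteq> (\<Union>c\<in>face_index m. (\<lambda>\<xi>. R *\<^sub>R (\<xi> /\<^sub>R norm \<xi>)) ` face_cell m c)"
proof
  fix x :: 'a assume "x \<in> sphere 0 R"
  then have x: "norm x = R" by simp
  obtain b :: 'a where b: "b \<in> Basis" and max: "\<And>i. i \<in> Basis \<Longrightarrow> \<bar>x \<bullet> i\<bar> \<le> \<bar>x \<bullet> b\<bar>"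
  proof -
    have "finite ((\<lambda>i. \<bar>x \<bullet> i\<bar>) ` (Basis::'a set))" "(\<lambda>i. \<bar>x \<bullet> i\<bar>) ` (Basis::'a set) \<noteq> {}" by auto
    then have "Max ((\<lambda>i. \<bar>x \<bullet> i\<bar>) ` (Basis::'a set)) \<in> (\<lambda>i. \<bar>x \<bullet> i\<bar>) ` (Basis::'a set)"
      by (rule Max_in)
    then obtain b where "b \<in> Basis" "\<bar>x \<bullet> b\<bar> = Max ((\<lambda>i. \<bar>x \<bullet> i\<bar>) ` (Basis::'a set))"
      by force
    then show ?thesis using that by simp
  qed
  have pos: "\<bar>x \<bullet> b\<bar> > 0"
  proof (rule ccontr)
    assume "\<not> \<bar>x \<bullet> b\<bar> > 0"
    then have "x \<bullet> i = 0" if "i \<in> Basis" for i using max[OF that] by auto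
    then have "x = 0" by (intro euclidean_all_zero_iff[THEN iffD1]) blast
    with x assms show False by simp
  qed
  define \<xi> where "\<xi> = x /\<^sub>R \<bar>x \<bullet> b\<bar>"
  have \<xi>i: "\<xi> \<bullet> i = (x \<bullet> i) / \<bar>x \<bullet> b\<bar>" for i by (simp add: \<xi>_def divide_inverse_commute)
  have "\<exists>j<m. -1 + 2 * real j / real m \<le> \<xi> \<bullet> i \<and> \<xi> \<bullet> i \<le> -1 + 2 * (real j + 1) / real m" if "i \<in> Basis" for i
  proof (rule interval_grid[OF _ _ \<open>0 < m\<close>])
    have "\<bar>\<xi> \<bullet> i\<bar> \<le> 1"
      unfolding \<xi>i abs_divide abs_abs using max[OF that] pos by (simp add: divide_le_eq_1_pos)
    then show "-1 \<le> \<xi> \<bullet> i" "\<xi> \<bullet> i \<le> 1" by linarith+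
  qed
  then have "\<forall>i\<in>Basis. \<exists>j. j < m \<and> -1 + 2 * real j / real m \<le> \<xi> \<bullet> i \<and> \<xi> \<bullet> i \<le> -1 + 2 * (real j + 1) / real m"
    by blast
  from bchoice[OF this] obtain f where f: "\<And>i. i \<in> Basis \<Longrightarrow> f i < m \<and> -1 + 2 * real (f i) / real m \<le> \<xi> \<bullet> i \<and> \<xi> \<bullet> i \<le> -1 + 2 * (real (f i) + 1) / real m"
    by blast
  define c where "c = (b, sgn (x \<bullet> b), restrict f (Basis - {b}))"
  have "sgn (x \<bullet> b) \<in> {-1, 1}" using pos by (auto simp: sgn_if)
  then have c: "c \<in> face_index m" using b f by (auto simp: c_def face_index_def)
  have "\<xi> \<bullet> b = sgn (x \<bullet> b)" unfolding \<xi>i by (rule real_sgn_eq[symmetric])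
  then have "\<xi> \<in> face_cell m c" using f by (simp add: c_def face_cell_def)
  moreover have "R *\<^sub>R (\<xi> /\<^sub>R norm \<xi>) = x"
  proof -
    have "norm \<xi> = R / \<bar>x \<bullet> b\<bar>" by (simp add: \<xi>_def x divide_inverse_commute)
    then show ?thesis using pos assms by (simp add: \<xi>_def)
  qed
  ultimately have "x \<in> (\<lambda>\<xi>. R *\<^sub>R (\<xi> /\<^sub>R norm \<xi>)) ` face_cell m c" by (intro image_eqI[of x _ \<xi>]) simp_all
  then show "x \<in> (\<Union>c\<in>face_index m. (\<lambda>\<xi>. R *\<^sub>R (\<xi> /\<^sub>R norm \<xi>)) ` face_cell m c)" using c by blast
qed

text \<open>On the boundary of the cube radial projection is Lipschitz, since the norm is at least \<open>1\<close> there.  So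
the \<open>2 n m\<^bsup>n-1\<^esup>\<close> cells have images of diameter \<open>O(R / m)\<close>, and the powers of \<open>m\<close> cancel in the sum.\<close>

lemma hausdorff_measure_sphere_le:
  fixes R :: real
  assumes "R > 0"
  shows "hausdorff_measure (DIM('a) - 1) (sphere (0::'a::euclidean_space) R)
    \<le> ennreal (2 * DIM('a) * unit_ball_vol (real (DIM('a) - 1)) * (2 * DIM('a)) ^ (DIM('a) - 1) * R ^ (DIM('a) - 1))"
  unfolding hausdorff_measure_def
proof (rule SUP_least)
  fix \<delta> :: real assume "\<delta> \<in> {0<..}"
  then have \<delta>: "\<delta> > 0" by simp
  let ?n = "DIM('a)"
  obtain m :: nat where m: "real m > 4 * ?n * R / \<delta>" using reals_Archimedean2 by blast
  have "4 * ?n * R / \<delta> > 0" using assms \<delta> by simp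
  then have m0: "real m > 0" using m by linarith
  \<comment> \<open>cells have diameter at most \<open>2 * DIM('a) / m\<close>, projection doubles and scaling multiplies it by \<open>R\<close>\<close>
  define d where "d = 4 * ?n * R / m"
  have d: "0 \<le> d" "d \<le> \<delta>"
    using m m0 \<delta> assms by (auto simp: d_def field_simps)
  let ?S = "\<lambda>c. (\<lambda>\<xi>. R *\<^sub>R (\<xi> /\<^sub>R norm \<xi>)) ` (face_cell m c :: 'a set)"
  have S: "bounded (?S c) \<and> diameter (?S c) \<le> d" if c: "c \<in> face_index m" for c
  proof
    have "norm (R *\<^sub>R (\<xi> /\<^sub>R norm \<xi>)) \<le> R" for \<xi> :: 'a
      using assms by (cases "\<xi> = 0") auto
    then show "bounded (?S c)" by (intro boundedI[of _ R]) blast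
    show "diameter (?S c) \<le> d"
    proof (rule diameter_le)
      fix x y assume "x \<in> ?S c" "y \<in> ?S c"
      then obtain \<xi> \<eta> where xy: "x = R *\<^sub>R (\<xi> /\<^sub>R norm \<xi>)" "y = R *\<^sub>R (\<eta> /\<^sub>R norm \<eta>)"
        and cell: "\<xi> \<in> face_cell m c" "\<eta> \<in> face_cell m c" by auto
      have "norm (x - y) = R * norm (\<xi> /\<^sub>R norm \<xi> - \<eta> /\<^sub>R norm \<eta>)"
        unfolding xy scaleR_right_diff_distrib[symmetric] using assms by simp
      also have "\<dots> \<le> R * (2 * norm (\<xi> - \<eta>))"
        using assms face_cell_norm_ge_1[OF c] cell by (intro mult_left_mono norm_normalise_diff_le) auto
      also have "\<dots> \<le> R * (2 * (2 * ?n / m))"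
        using assms face_cell_diff_le[OF c cell] by (intro mult_left_mono) auto
      also have "\<dots> = d" by (simp add: d_def)
      finally show "norm (x - y) \<le> d" .
    qed (use d in auto)
  qed
  have "hausdorff_premeasure (?n - 1) \<delta> (sphere (0::'a) R)
    \<le> of_nat (card (face_index m :: ('a \<times> real \<times> ('a \<Rightarrow> nat)) set)) * ennreal (unit_ball_vol (real (?n - 1)) * (d / 2) ^ (?n - 1))"
    using m0 by (intro hausdorff_premeasure_le_finite_cover[where S="?S"] finite_face_index
        sphere_subset_projected_cells assms S d) auto
  also have "\<dots> = ennreal (real (2 * ?n * m ^ (?n - 1)) * (unit_ball_vol (real (?n - 1)) * (d / 2) ^ (?n - 1)))"
    unfolding card_face_index using d by (subst ennreal_mult) (auto simp: ennreal_of_nat_eq_real_of_nat)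
  also have "real (2 * ?n * m ^ (?n - 1)) * (unit_ball_vol (real (?n - 1)) * (d / 2) ^ (?n - 1))
    = 2 * ?n * unit_ball_vol (real (?n - 1)) * (real m * (d / 2)) ^ (?n - 1)"
    unfolding power_mult_distrib[of "real m"] by simp
  also have "real m * (d / 2) = 2 * ?n * R" using m0 by (simp add: d_def)
  also have "2 * ?n * unit_ball_vol (real (?n - 1)) * (2 * ?n * R) ^ (?n - 1)
    = 2 * ?n * unit_ball_vol (real (?n - 1)) * (2 * ?n) ^ (?n - 1) * R ^ (?n - 1)"
    by (simp add: power_mult_distrib)
  finally show "hausdorff_premeasure (?n - 1) \<delta> (sphere (0::'a) R)
    \<le> ennreal (2 * ?n * unit_ball_vol (real (?n - 1)) * (2 * ?n) ^ (?n - 1) * R ^ (?n - 1))" .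
qed

section \<open>Vanishing of Gaussian variances\<close>

lemma gauss_pair_eq_prod:
  "gauss_pair \<tau> z = ennreal (exp (- (\<tau> / 2) * (norm (fst z))\<^sup>2)) * ennreal (exp (- (\<tau> / 2) * (norm (snd z))\<^sup>2))"
proof -
  have "- \<tau> / 2 * ((norm (fst z))\<^sup>2 + (norm (snd z))\<^sup>2)
      = - (\<tau> / 2) * (norm (fst z))\<^sup>2 + - (\<tau> / 2) * (norm (snd z))\<^sup>2"
    by (simp add: distrib_left)
  then show ?thesis unfolding gauss_pair_def by (simp only: exp_add ennreal_mult'[OF exp_ge_zero])
qed

lemma nn_integral_lborel_product:
  fixes f g :: "'a::euclidean_space \<Rightarrow> ennreal"
  assumes [measurable]: "f \<in> borel_measurable borel" "g \<in> borel_measurable borel"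
  shows "(\<integral>\<^sup>+z. f (fst z) * g (snd z) \<partial>lborel) = (\<integral>\<^sup>+x. f x \<partial>lborel) * (\<integral>\<^sup>+x. g x \<partial>lborel)"
proof -
  have "(\<integral>\<^sup>+z. f (fst z) * g (snd z) \<partial>lborel) = (\<integral>\<^sup>+z. f (fst z) * g (snd z) \<partial>(lborel \<Otimes>\<^sub>M lborel))"
    by (simp add: lborel_prod)
  also have "\<dots> = (\<integral>\<^sup>+x. \<integral>\<^sup>+y. f x * g y \<partial>lborel \<partial>lborel)"
    by (subst lborel.nn_integral_fst[symmetric]) auto
  also have "\<dots> = (\<integral>\<^sup>+x. f x * (\<integral>\<^sup>+y. g y \<partial>lborel) \<partial>lborel)"
    by (intro nn_integral_cong nn_integral_cmult) simp
  also have "\<dots> = (\<integral>\<^sup>+x. f x \<partial>lborel) * (\<integral>\<^sup>+x. g x \<partial>lborel)"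
    by (simp add: nn_integral_multc)
  finally show ?thesis .
qed

lemma nn_integral_gauss_pair_lborel:
  assumes "\<tau> > 0"
  shows "(\<integral>\<^sup>+z. gauss_pair \<tau> z \<partial>(lborel :: ('a::euclidean_space \<times> 'a) measure))
    = ennreal ((sqrt (pi / (\<tau> / 2)) ^ DIM('a))\<^sup>2)"
proof -
  have "\<tau> / 2 > 0" using assms by simp
  note g = nn_integral_gaussian[OF this, where 'a='a]
  have "(\<integral>\<^sup>+z. gauss_pair \<tau> z \<partial>(lborel :: ('a \<times> 'a) measure))
    = (\<integral>\<^sup>+x. ennreal (exp (- (\<tau> / 2) * (norm (x::'a))\<^sup>2)) \<partial>lborel) * (\<integral>\<^sup>+x. ennreal (exp (- (\<tau> / 2) * (norm (x::'a))\<^sup>2)) \<partial>lborel)"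
    unfolding gauss_pair_eq_prod by (rule nn_integral_lborel_product) measurable
  also have "\<dots> = ennreal (sqrt (pi / (\<tau> / 2)) ^ DIM('a) * sqrt (pi / (\<tau> / 2)) ^ DIM('a))"
    unfolding g using assms by (intro ennreal_mult[symmetric]) auto
  finally show ?thesis by (simp only: power2_eq_square)
qed

lemma emeasure_lborel_ball_square:
  "emeasure lborel (ball (0::'a::euclidean_space) R \<times> ball (0::'a) R) = ennreal ((measure lborel (ball (0::'a) R))\<^sup>2)"
proof -
  have "emeasure lborel (ball (0::'a) R \<times> ball (0::'a) R) = emeasure lborel (ball (0::'a) R) * emeasure lborel (ball (0::'a) R)"
    unfolding lborel_prod[symmetric] by (rule lborel.emeasure_pair_measure_Times) auto
  moreover have "emeasure lborel (ball (0::'a) R) = ennreal (measure lborel (ball (0::'a) R))"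
    using emeasure_lborel_ball_finite[of "0::'a" R] by (intro emeasure_eq_ennreal_measure) (simp add: less_top)
  ultimately show ?thesis by (simp add: power2_eq_square ennreal_mult)
qed

lemma nn_integral_ball_pair_lborel_finite:
  assumes "\<kappa> > 0"
  shows "(\<integral>\<^sup>+z. ball_pair \<kappa> z \<partial>(lborel :: ('a::euclidean_space \<times> 'a) measure)) < \<infinity>"
proof -
  have "(\<integral>\<^sup>+z. ball_pair \<kappa> z \<partial>(lborel :: ('a \<times> 'a) measure)) \<le> (\<integral>\<^sup>+z. gauss_pair \<kappa> z \<partial>(lborel :: ('a \<times> 'a) measure))"
  proof (intro nn_integral_mono)
    fix z :: "'a \<times> 'a"
    let ?a = "norm (fst z)" and ?b = "norm (snd z)"
    have "?a\<^sup>2 \<le> (max ?a ?b)\<^sup>2" "?b\<^sup>2 \<le> (max ?a ?b)\<^sup>2" by (auto intro!: power_mono)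
    then have "?a\<^sup>2 + ?b\<^sup>2 \<le> 2 * (max ?a ?b)\<^sup>2" by simp
    then have "\<kappa> / 2 * (?a\<^sup>2 + ?b\<^sup>2) \<le> \<kappa> / 2 * (2 * (max ?a ?b)\<^sup>2)"
      using assms by (intro mult_left_mono) auto
    then show "ball_pair \<kappa> z \<le> gauss_pair \<kappa> z"
      unfolding ball_pair_def gauss_pair_def by (intro ennreal_leI) simp
  qed
  also have "\<dots> < \<infinity>" using assms by (simp add: nn_integral_gauss_pair_lborel)
  finally show ?thesis .
qed

context stationary_random_measure
begin

lemma nn_integral_gauss_pair_moment:
  "(\<integral>\<^sup>+z. gauss_pair \<tau> z \<partial>pair_moment) = (\<integral>\<^sup>+p. (\<integral>\<^sup>+x. ennreal (exp (- (\<tau> / 2) * (norm x)\<^sup>2)) \<partial>p)\<^sup>2 \<partial>M)"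
  unfolding gauss_pair_eq_prod power2_eq_square[of "nn_integral _ _"]
  by (intro pair_moment_product) measurable

text \<open>The Gaussian variances are nonnegative.\<close>

lemma gauss_pair_lower_bound:
  assumes "\<tau> > 0"
  shows "ennreal (iota\<^sup>2) * (\<integral>\<^sup>+z. gauss_pair \<tau> z \<partial>(lborel :: ('a \<times> 'a) measure)) \<le> (\<integral>\<^sup>+z. gauss_pair \<tau> z \<partial>pair_moment)"
proof -
  define c where "c = sqrt (pi / (\<tau> / 2)) ^ DIM('a)"
  have c: "c \<ge> 0" using assms by (simp add: c_def)
  have g: "(\<lambda>x::'a. ennreal (exp (- (\<tau> / 2) * (norm x)\<^sup>2))) \<in> borel_measurable borel" by measurable
  have "\<tau> / 2 > 0" using assms by simp
  from nn_integral_gaussian[OF this, where 'a='a]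
  have m: "(\<integral>\<^sup>+p. (\<integral>\<^sup>+x. ennreal (exp (- (\<tau> / 2) * (norm x)\<^sup>2)) \<partial>p) \<partial>M) = ennreal (iota * c)"
    using c by (simp only: nn_integral_mean_measure[OF g] c_def[symmetric]) (simp add: ennreal_mult iota_nonneg)
  have "ennreal ((iota * c)\<^sup>2) \<le> (\<integral>\<^sup>+z. gauss_pair \<tau> z \<partial>pair_moment)"
    unfolding nn_integral_gauss_pair_moment
    using mean.nn_integral_mixture[OF g] iota_nonneg c
    by (intro mean_square_le_second_moment m) auto
  then show ?thesis
    unfolding nn_integral_gauss_pair_lborel[OF assms] c_def[symmetric]
    by (simp add: power_mult_distrib ennreal_mult)
qed

text \<open>Below \<open>R0\<close> nothing is known about the number variance; monotonicity in \<open>R\<close> bounds the second moment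
by its value at \<open>R0\<close>, and that contribution becomes negligible after averaging.\<close>

lemma pair_moment_ball_growth:
  assumes "\<epsilon> > 0" and small: "\<forall>R\<ge>R0. number_variance M R \<le> ennreal (\<epsilon> * R ^ (DIM('a) - 1))"
  shows "\<exists>A\<ge>0. \<forall>R\<ge>0. emeasure pair_moment (ball 0 R \<times> ball 0 R)
    \<le> ennreal (iota\<^sup>2) * emeasure lborel (ball (0::'a) R \<times> ball (0::'a) R)
      + ennreal \<epsilon> * ennreal (R ^ (DIM('a) - 1)) + ennreal A * indicator {..R0} R"
proof (intro exI conjI allI impI)
  define A where "A = enn2real (emeasure pair_moment (ball 0 R0 \<times> ball 0 R0))"
  show "A \<ge> 0" by (simp add: A_def)
  have A: "emeasure pair_moment (ball 0 R0 \<times> ball 0 R0) = ennreal A"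
    using pair_moment_square_finite[of "ball 0 R0"] by (simp add: A_def)
  fix R :: real assume R: "R \<ge> 0"
  show "emeasure pair_moment (ball 0 R \<times> ball 0 R)
    \<le> ennreal (iota\<^sup>2) * emeasure lborel (ball (0::'a) R \<times> ball (0::'a) R)
      + ennreal \<epsilon> * ennreal (R ^ (DIM('a) - 1)) + ennreal A * indicator {..R0} R"
  proof (cases "R \<le> R0")
    case True
    have "ball (0::'a) R0 \<times> ball (0::'a) R0 \<in> sets borel" unfolding borel_prod[symmetric] by auto
    then have "emeasure pair_moment (ball 0 R \<times> ball 0 R) \<le> emeasure pair_moment (ball 0 R0 \<times> ball 0 R0)"
      using True by (intro emeasure_mono) (auto simp: sets_pair_moment)
    then show ?thesis using True unfolding A by (simp add: add_increasing)
  next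
    case False
    have "emeasure pair_moment (ball 0 R \<times> ball 0 R)
      = ennreal (iota\<^sup>2) * emeasure lborel (ball (0::'a) R \<times> ball (0::'a) R) + number_variance M R"
      by (simp add: pair_moment_ball emeasure_lborel_ball_square power_mult_distrib ennreal_mult)
    moreover have "number_variance M R \<le> ennreal \<epsilon> * ennreal (R ^ (DIM('a) - 1))"
      using small False \<open>\<epsilon> > 0\<close> R by (simp add: ennreal_mult[symmetric])
    ultimately show ?thesis by (simp add: add_increasing2 add_left_mono)
  qed
qed

text \<open>The normalised average of \<open>R\<^bsup>n-1\<^esup>\<close>, which by scaling does not depend on \<open>\<kappa>\<close>.\<close>

definition gaussian_constant :: real where
  "gaussian_constant = 2 * sqrt pi / sqrt pi ^ (DIM('a) - 1)
     * enn2real (\<integral>\<^sup>+s. indicator {0..} s * ennreal (s ^ DIM('a) * exp (- s\<^sup>2)) \<partial>(lborel::real measure))"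

text \<open>The average of the growth bound over \<open>R\<close>.  The part of order \<open>R\<^bsup>n-1\<^esup>\<close> contributes a multiple of \<open>\<epsilon>\<close>
uniformly in \<open>\<kappa>\<close>, and the part from bounded \<open>R\<close> is \<open>O(\<kappa>)\<close> because the weight \<open>2\<kappa>R exp (-\<kappa>R\<^sup>2)\<close> is.\<close>

lemma ball_pair_upper_bound:
  assumes "\<epsilon> > 0" and small: "\<exists>R0. \<forall>R\<ge>R0. number_variance M R \<le> ennreal (\<epsilon> * R ^ (DIM('a) - 1))"
  shows "\<exists>B\<ge>0. \<forall>\<kappa>\<in>{0<..1}.
    ennreal (sqrt pi * sqrt (\<kappa> / pi) ^ (DIM('a) - 1)) * (\<integral>\<^sup>+z. ball_pair \<kappa> z \<partial>pair_moment)
    \<le> ennreal (iota\<^sup>2) * (ennreal (sqrt pi * sqrt (\<kappa> / pi) ^ (DIM('a) - 1)) * (\<integral>\<^sup>+z. ball_pair \<kappa> z \<partial>(lborel :: ('a \<times> 'a) measure)))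
      + ennreal (gaussian_constant * \<epsilon> + B * \<kappa>)"
proof -
  from small obtain R1 where "\<forall>R\<ge>R1. number_variance M R \<le> ennreal (\<epsilon> * R ^ (DIM('a) - 1))" by blast
  then have "\<forall>R\<ge>max 0 R1. number_variance M R \<le> ennreal (\<epsilon> * R ^ (DIM('a) - 1))" by auto
  moreover define R0 where "R0 = max 0 R1"
  ultimately have sm: "\<forall>R\<ge>R0. number_variance M R \<le> ennreal (\<epsilon> * R ^ (DIM('a) - 1))" and R0: "R0 \<ge> 0" by auto
  from pair_moment_ball_growth[OF assms(1) sm] obtain A where A: "A \<ge> 0" and
    bound: "\<And>R. R \<ge> 0 \<Longrightarrow> emeasure pair_moment (ball 0 R \<times> ball 0 R)
    \<le> ennreal (iota\<^sup>2) * emeasure lborel (ball (0::'a) R \<times> ball (0::'a) R)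
      + ennreal \<epsilon> * ennreal (R ^ (DIM('a) - 1)) + ennreal A * indicator {..R0} R" by blast
  define D where "D = enn2real (\<integral>\<^sup>+s. indicator {0..} s * ennreal (s ^ DIM('a) * exp (- s\<^sup>2)) \<partial>(lborel::real measure))"
  have D: "D \<ge> 0" "(\<integral>\<^sup>+s. indicator {0..} s * ennreal (s ^ DIM('a) * exp (- s\<^sup>2)) \<partial>(lborel::real measure)) = ennreal D"
    using nn_integral_power_gaussian_finite[of "DIM('a)"] by (auto simp: D_def)
  have "ennreal (sqrt pi * sqrt (\<kappa> / pi) ^ (DIM('a) - 1)) * (\<integral>\<^sup>+z. ball_pair \<kappa> z \<partial>pair_moment)
    \<le> ennreal (iota\<^sup>2) * (ennreal (sqrt pi * sqrt (\<kappa> / pi) ^ (DIM('a) - 1)) * (\<integral>\<^sup>+z. ball_pair \<kappa> z \<partial>(lborel :: ('a \<times> 'a) measure)))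
      + ennreal (gaussian_constant * \<epsilon> + (2 * sqrt pi * R0\<^sup>2 * A) * \<kappa>)"
    if \<kappa>: "\<kappa> > 0" "\<kappa> \<le> 1" for \<kappa>
  proof -
    define w where "w R = indicator {0..} R * ennreal (2 * \<kappa> * R * exp (- \<kappa> * R\<^sup>2))" for R
    have [measurable]: "w \<in> borel_measurable borel" unfolding w_def by measurable
    define l where "l R = emeasure lborel (ball (0::'a) R \<times> ball (0::'a) R)" for R
    have [measurable]: "l \<in> borel_measurable borel"
    proof -
      have "l R = ennreal ((indicator {0..} R * (unit_ball_vol (real DIM('a)) * R ^ DIM('a)))\<^sup>2)" for R
        by (cases "R \<ge> 0") (simp_all add: l_def emeasure_lborel_ball_square content_ball)
      then have "l = (\<lambda>R. ennreal ((indicator {0..} R * (unit_ball_vol (real DIM('a)) * R ^ DIM('a)))\<^sup>2))"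
        by (rule ext)
      then show ?thesis by simp
    qed
    define C where "C = sqrt pi * sqrt (\<kappa> / pi) ^ (DIM('a) - 1)"
    have C: "0 \<le> C" "C \<le> sqrt pi"
    proof -
      have "\<kappa> / pi \<le> 1" using \<kappa> pi_gt3 by simp
      then have "sqrt (\<kappa> / pi) ^ (DIM('a) - 1) \<le> 1" using \<kappa> by (intro power_le_one) auto
      then show "C \<le> sqrt pi" unfolding C_def by (simp add: mult_left_le)
    qed (use \<kappa> in \<open>simp add: C_def\<close>)
    have "(\<integral>\<^sup>+z. ball_pair \<kappa> z \<partial>pair_moment) = (\<integral>\<^sup>+R. w R * emeasure pair_moment (ball 0 R \<times> ball 0 R) \<partial>lborel)"
      unfolding w_def
      by (rule nn_integral_ball_pair_layers[OF sets_pair_moment sigma_finite_pair_moment \<kappa>(1)])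
    also have "\<dots> \<le> (\<integral>\<^sup>+R. ennreal (iota\<^sup>2) * (w R * l R) + ennreal \<epsilon> * (w R * ennreal (R ^ (DIM('a) - 1)))
        + ennreal (2 * \<kappa> * R0 * A) * indicator {0..R0} R \<partial>lborel)"
    proof (rule nn_integral_mono)
      fix R :: real
      show "w R * emeasure pair_moment (ball 0 R \<times> ball 0 R)
        \<le> ennreal (iota\<^sup>2) * (w R * l R) + ennreal \<epsilon> * (w R * ennreal (R ^ (DIM('a) - 1)))
          + ennreal (2 * \<kappa> * R0 * A) * indicator {0..R0} R"
      proof (cases "R \<ge> 0")
        case True
        have "w R * emeasure pair_moment (ball 0 R \<times> ball 0 R)
          \<le> w R * (ennreal (iota\<^sup>2) * l R + ennreal \<epsilon> * ennreal (R ^ (DIM('a) - 1)) + ennreal A * indicator {..R0} R)"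
          using bound[OF True] unfolding l_def by (intro mult_left_mono) auto
        also have "\<dots> = ennreal (iota\<^sup>2) * (w R * l R) + ennreal \<epsilon> * (w R * ennreal (R ^ (DIM('a) - 1)))
          + w R * (ennreal A * indicator {..R0} R)"
          by (simp only: distrib_left mult.left_commute)
        also have "w R * (ennreal A * indicator {..R0} R) \<le> ennreal (2 * \<kappa> * R0 * A) * indicator {0..R0} R"
        proof (cases "R \<le> R0")
          case le: True
          have "2 * \<kappa> * R * exp (- \<kappa> * R\<^sup>2) \<le> 2 * \<kappa> * R0 * 1"
            using \<kappa> True le by (intro mult_mono) auto
          then have "w R \<le> ennreal (2 * \<kappa> * R0)" using True by (simp add: w_def ennreal_leI)
          then have "w R * ennreal A \<le> ennreal (2 * \<kappa> * R0) * ennreal A" by (rule mult_right_mono) simp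
          then show ?thesis using True le A \<kappa> R0 by (simp add: ennreal_mult)
        qed simp
        finally show ?thesis by (simp add: add_left_mono)
      qed (simp add: w_def)
    qed
    also have "\<dots> = ennreal (iota\<^sup>2) * (\<integral>\<^sup>+R. w R * l R \<partial>lborel)
        + ennreal \<epsilon> * (\<integral>\<^sup>+R. w R * ennreal (R ^ (DIM('a) - 1)) \<partial>lborel) + ennreal (2 * \<kappa> * R0 * A) * ennreal R0"
      using R0 by (simp add: nn_integral_add nn_integral_cmult nn_integral_cmult_indicator)
    also have "(\<integral>\<^sup>+R. w R * l R \<partial>lborel) = (\<integral>\<^sup>+z. ball_pair \<kappa> z \<partial>(lborel :: ('a \<times> 'a) measure))"
      unfolding w_def l_def
      by (rule nn_integral_ball_pair_layers[OF sets_lborel sigma_finite_lborel \<kappa>(1), symmetric])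
    also have "(\<integral>\<^sup>+R. w R * ennreal (R ^ (DIM('a) - 1)) \<partial>lborel) = ennreal (2 / sqrt \<kappa> ^ (DIM('a) - 1)) * ennreal D"
      unfolding w_def D(2)[symmetric] using \<kappa> by (intro nn_integral_power_gaussian_scale) (auto simp: Suc_leI)
    finally have main: "ennreal C * (\<integral>\<^sup>+z. ball_pair \<kappa> z \<partial>pair_moment)
      \<le> ennreal C * (ennreal (iota\<^sup>2) * (\<integral>\<^sup>+z. ball_pair \<kappa> z \<partial>(lborel :: ('a \<times> 'a) measure))
        + ennreal \<epsilon> * (ennreal (2 / sqrt \<kappa> ^ (DIM('a) - 1)) * ennreal D) + ennreal (2 * \<kappa> * R0 * A) * ennreal R0)"
      by (intro mult_left_mono) auto
    have e1: "ennreal C * (ennreal \<epsilon> * (ennreal (2 / sqrt \<kappa> ^ (DIM('a) - 1)) * ennreal D)) = ennreal (gaussian_constant * \<epsilon>)"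
    proof -
      have "C * (2 / sqrt \<kappa> ^ (DIM('a) - 1)) = 2 * sqrt pi / sqrt pi ^ (DIM('a) - 1)"
        using \<kappa> by (simp add: C_def real_sqrt_divide power_divide)
      moreover have "C * (\<epsilon> * (2 / sqrt \<kappa> ^ (DIM('a) - 1) * D)) = C * (2 / sqrt \<kappa> ^ (DIM('a) - 1)) * D * \<epsilon>"
        by simp
      ultimately have "C * (\<epsilon> * (2 / sqrt \<kappa> ^ (DIM('a) - 1) * D)) = gaussian_constant * \<epsilon>"
        unfolding gaussian_constant_def D_def[symmetric] by (simp only:)
      then show ?thesis
        using C D(1) \<kappa> assms(1) by (simp only: ennreal_mult[symmetric] mult_nonneg_nonneg less_imp_le
           divide_nonneg_nonneg real_sqrt_ge_zero zero_le_power zero_le_numeral)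
    qed
    have e2: "ennreal C * (ennreal (2 * \<kappa> * R0 * A) * ennreal R0) \<le> ennreal ((2 * sqrt pi * R0\<^sup>2 * A) * \<kappa>)"
    proof -
      have "C * (2 * \<kappa> * R0 * A * R0) \<le> sqrt pi * (2 * \<kappa> * R0 * A * R0)"
        using C \<kappa> R0 A by (intro mult_right_mono) auto
      also have "\<dots> = (2 * sqrt pi * R0\<^sup>2 * A) * \<kappa>" by (simp add: power2_eq_square)
      finally have "ennreal (C * (2 * \<kappa> * R0 * A * R0)) \<le> ennreal ((2 * sqrt pi * R0\<^sup>2 * A) * \<kappa>)" by (rule ennreal_leI)
      then show ?thesis using C \<kappa> R0 A by (simp add: ennreal_mult[symmetric])
    qed
    have gc: "0 \<le> gaussian_constant * \<epsilon>" using assms(1) by (simp add: gaussian_constant_def)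
    have "ennreal C * (\<integral>\<^sup>+z. ball_pair \<kappa> z \<partial>pair_moment)
      \<le> ennreal (iota\<^sup>2) * (ennreal C * (\<integral>\<^sup>+z. ball_pair \<kappa> z \<partial>(lborel :: ('a \<times> 'a) measure)))
        + ennreal C * (ennreal \<epsilon> * (ennreal (2 / sqrt \<kappa> ^ (DIM('a) - 1)) * ennreal D))
        + ennreal C * (ennreal (2 * \<kappa> * R0 * A) * ennreal R0)"
      using main by (simp only: distrib_left mult.left_commute[of "ennreal C" "ennreal (iota\<^sup>2)"])
    also have "\<dots> \<le> ennreal (iota\<^sup>2) * (ennreal C * (\<integral>\<^sup>+z. ball_pair \<kappa> z \<partial>(lborel :: ('a \<times> 'a) measure)))
        + ennreal (gaussian_constant * \<epsilon>) + ennreal ((2 * sqrt pi * R0\<^sup>2 * A) * \<kappa>)"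
      unfolding e1 by (intro add_left_mono e2)
    finally show ?thesis
      unfolding C_def[symmetric] using gc A \<kappa> by (simp add: ennreal_plus[symmetric] add.assoc del: ennreal_plus)
  qed
  then show ?thesis
    using A by (intro exI[of _ "2 * sqrt pi * R0\<^sup>2 * A"]) auto
qed

text \<open>Otherwise the Gaussian variances \<open>\<Delta>(\<tau>)\<close> would be positive on \<open>(k, k + 1)\<close>, and so would be their
integral \<open>I\<close> against the limiting weight at \<open>\<kappa> = 0\<close>.  The weights for \<open>\<kappa> > 0\<close> dominate the limiting
one, so \<open>I\<close> is bounded by the average of the number variance, which is arbitrarily small.\<close>

lemma gauss_pair_moment_eq:
  assumes small: "\<And>\<epsilon>. \<epsilon> > 0 \<Longrightarrow> \<exists>R0. \<forall>R\<ge>R0. number_variance M R \<le> ennreal (\<epsilon> * R ^ (DIM('a) - 1))"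
    and "k \<ge> 1"
  shows "\<exists>\<tau>>k. (\<integral>\<^sup>+z. gauss_pair \<tau> z \<partial>pair_moment)
      = ennreal (iota\<^sup>2) * (\<integral>\<^sup>+z. gauss_pair \<tau> z \<partial>(lborel :: ('a \<times> 'a) measure))"
proof (rule ccontr)
  define J where "J \<tau> = (\<integral>\<^sup>+z. gauss_pair \<tau> z \<partial>pair_moment)" for \<tau>
  define L where "L \<tau> = ennreal (iota\<^sup>2) * (\<integral>\<^sup>+z. gauss_pair \<tau> z \<partial>(lborel :: ('a \<times> 'a) measure))" for \<tau>
  assume "\<not> ?thesis"
  then have ne: "J \<tau> \<noteq> L \<tau>" if "\<tau> > k" for \<tau> using that by (auto simp: J_def L_def)
  interpret \<alpha>: sigma_finite_measure pair_moment by (rule sigma_finite_pair_moment)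
  have [measurable]: "J \<in> borel_measurable borel" unfolding J_def by measurable
  have [measurable]: "L \<in> borel_measurable borel" unfolding L_def by measurable
  have LJ: "L \<tau> \<le> J \<tau>" if "\<tau> > 0" for \<tau>
    unfolding L_def J_def by (rule gauss_pair_lower_bound[OF that])
  have Lfin: "L \<tau> < \<infinity>" if "\<tau> > 0" for \<tau>
    unfolding L_def nn_integral_gauss_pair_lborel[OF that] by (simp add: ennreal_mult_less_top)
  define \<Delta> where "\<Delta> \<tau> = J \<tau> - L \<tau>" for \<tau>
  have [measurable]: "\<Delta> \<in> borel_measurable borel" unfolding \<Delta>_def by measurable
  define w where "w \<tau> = ennreal (\<tau> powr (-1/2) / \<tau> * sqrt (\<tau> / pi) ^ DIM('a))" for \<tau>
  have [measurable]: "w \<in> borel_measurable borel" unfolding w_def by measurable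
  define I where "I = (\<integral>\<^sup>+\<tau>. indicator {k<..<k+1} \<tau> * (w \<tau> * \<Delta> \<tau>) \<partial>lborel)"
  \<comment> \<open>the interval has positive length, so a positive integrand cannot have integral \<open>0\<close>\<close>
  have "I \<noteq> 0"
  proof
    assume "I = 0"
    then have "AE \<tau> in lborel. indicator {k<..<k+1} \<tau> * (w \<tau> * \<Delta> \<tau>) = 0"
      unfolding I_def by (subst (asm) nn_integral_0_iff_AE) auto
    then have "AE \<tau> in lborel. \<tau> \<notin> {k<..<k+1}"
    proof eventually_elim
      case (elim \<tau>)
      show ?case
      proof
        assume \<tau>: "\<tau> \<in> {k<..<k+1}"
        then have "\<tau> > 0" "\<tau> > k" using \<open>k \<ge> 1\<close> by auto
        then have "w \<tau> \<noteq> 0" by (simp add: w_def ennreal_eq_0_iff not_le)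
        moreover have "\<Delta> \<tau> \<noteq> 0"
          using LJ[OF \<open>\<tau> > 0\<close>] ne[OF \<open>\<tau> > k\<close>] Lfin[OF \<open>\<tau> > 0\<close>]
          by (simp add: \<Delta>_def diff_eq_0_iff_ennreal)
        ultimately show False using elim \<tau> by simp
      qed
    qed
    then have "emeasure lborel {k<..<k+1} = 0"
      by (subst (asm) AE_iff_measurable[of "{k<..<k+1}"]) auto
    then show False by simp
  qed
  have le: "I \<le> ennreal (gaussian_constant * \<epsilon>)" if \<epsilon>: "\<epsilon> > 0" for \<epsilon>
  proof -
    have gc: "0 \<le> gaussian_constant * \<epsilon>" using \<epsilon> by (simp add: gaussian_constant_def)
    from ball_pair_upper_bound[OF \<epsilon> small[OF \<epsilon>]] obtain B where B: "B \<ge> 0" and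
      bound: "\<And>\<kappa>. \<kappa> > 0 \<Longrightarrow> \<kappa> \<le> 1 \<Longrightarrow>
    ennreal (sqrt pi * sqrt (\<kappa> / pi) ^ (DIM('a) - 1)) * (\<integral>\<^sup>+z. ball_pair \<kappa> z \<partial>pair_moment)
    \<le> ennreal (iota\<^sup>2) * (ennreal (sqrt pi * sqrt (\<kappa> / pi) ^ (DIM('a) - 1)) * (\<integral>\<^sup>+z. ball_pair \<kappa> z \<partial>(lborel :: ('a \<times> 'a) measure)))
      + ennreal (gaussian_constant * \<epsilon> + B * \<kappa>)" by auto
    have I\<kappa>: "I \<le> ennreal (gaussian_constant * \<epsilon> + B * \<kappa>)" if \<kappa>: "\<kappa> > 0" "\<kappa> \<le> 1" for \<kappa>
    proof -
      let ?m = "mixing DIM('a) \<kappa>"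
      have mJ: "(\<integral>\<^sup>+\<tau>. ?m \<tau> * J \<tau> \<partial>lborel) = (\<integral>\<^sup>+\<tau>. ?m \<tau> * L \<tau> \<partial>lborel) + (\<integral>\<^sup>+\<tau>. ?m \<tau> * \<Delta> \<tau> \<partial>lborel)"
      proof -
        have "?m \<tau> * J \<tau> = ?m \<tau> * L \<tau> + ?m \<tau> * \<Delta> \<tau>" for \<tau>
        proof (cases "\<kappa> < \<tau>")
          case True
          then have "L \<tau> + \<Delta> \<tau> = J \<tau>" using LJ[of \<tau>] \<kappa> unfolding \<Delta>_def by (intro add_diff_inverse_ennreal) auto
          then show ?thesis by (simp add: distrib_left[symmetric])
        qed (simp add: mixing_def)
        then show ?thesis by (simp add: nn_integral_add)
      qed
      have mL: "(\<integral>\<^sup>+\<tau>. ?m \<tau> * L \<tau> \<partial>lborel)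
        = ennreal (iota\<^sup>2) * (ennreal (sqrt pi * sqrt (\<kappa> / pi) ^ (DIM('a) - 1)) * (\<integral>\<^sup>+z. ball_pair \<kappa> z \<partial>(lborel :: ('a \<times> 'a) measure)))"
        unfolding nn_integral_ball_pair_eq_mixture[OF diagonal_invariant_lborel \<kappa>(1)] L_def
        by (subst nn_integral_cmult[symmetric]) (auto simp: mult.left_commute)
      have fin: "(\<integral>\<^sup>+\<tau>. ?m \<tau> * L \<tau> \<partial>lborel) \<noteq> \<infinity>"
        unfolding mL using nn_integral_ball_pair_lborel_finite[OF \<kappa>(1), where 'a='a]
        by (simp add: ennreal_mult_eq_top_iff less_top)
      have "(\<integral>\<^sup>+\<tau>. ?m \<tau> * J \<tau> \<partial>lborel) \<le> (\<integral>\<^sup>+\<tau>. ?m \<tau> * L \<tau> \<partial>lborel) + ennreal (gaussian_constant * \<epsilon> + B * \<kappa>)"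
        using bound[OF \<kappa>] unfolding mL J_def nn_integral_ball_pair_eq_mixture[OF diagonal_invariant_pair_moment \<kappa>(1)] .
      then have "(\<integral>\<^sup>+\<tau>. ?m \<tau> * \<Delta> \<tau> \<partial>lborel) \<le> ennreal (gaussian_constant * \<epsilon> + B * \<kappa>)"
        unfolding mJ using fin by (simp add: ennreal_add_left_cancel_le)
      moreover have "I \<le> (\<integral>\<^sup>+\<tau>. ?m \<tau> * \<Delta> \<tau> \<partial>lborel)"
        unfolding I_def
      proof (rule nn_integral_mono)
        fix \<tau> :: real
        show "indicator {k<..<k+1} \<tau> * (w \<tau> * \<Delta> \<tau>) \<le> ?m \<tau> * \<Delta> \<tau>"
        proof (cases "\<tau> \<in> {k<..<k+1}")
          case True
          then have \<tau>: "\<kappa> < \<tau>" using \<kappa> \<open>k \<ge> 1\<close> by auto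
          then have "\<tau> powr (-1/2) \<le> (\<tau> - \<kappa>) powr (-1/2)"
            using \<kappa> by (intro powr_mono2') auto
          then have "w \<tau> \<le> ?m \<tau>"
            using \<tau> \<kappa> unfolding w_def mixing_def
            by (simp del: ennreal_mult) (intro ennreal_leI mult_right_mono divide_right_mono, auto)
          then show ?thesis using True by (simp add: mult_right_mono)
        qed simp
      qed
      ultimately show ?thesis by simp
    qed
    show ?thesis
    proof (rule ennreal_le_epsilon)
      fix e :: real assume "e > 0"
      \<comment> \<open>small enough for \<open>B * \<kappa> \<le> e\<close>; adding \<open>1\<close> avoids a division by zero\<close>
      define \<kappa> where "\<kappa> = min 1 (e / (B + 1))"
      have \<kappa>: "\<kappa> > 0" "\<kappa> \<le> 1" using \<open>e > 0\<close> B by (auto simp: \<kappa>_def)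
      have "B * \<kappa> \<le> (B + 1) * (e / (B + 1))"
        using B \<open>e > 0\<close> by (intro mult_mono) (auto simp: \<kappa>_def)
      then have "B * \<kappa> \<le> e" using B by simp
      then have "ennreal (gaussian_constant * \<epsilon> + B * \<kappa>) \<le> ennreal (gaussian_constant * \<epsilon>) + ennreal e"
        using gc \<open>e > 0\<close> by (simp add: ennreal_plus[symmetric] ennreal_leI del: ennreal_plus)
      with I\<kappa>[OF \<kappa>] show "I \<le> ennreal (gaussian_constant * \<epsilon>) + ennreal e" by (rule order_trans)
    qed
  qed
  have gc: "0 \<le> gaussian_constant" by (simp add: gaussian_constant_def)
  have "I \<le> 0"
  proof (rule ennreal_le_epsilon)
    fix e :: real assume "e > 0"
    have "gaussian_constant * (e / (gaussian_constant + 1)) \<le> (gaussian_constant + 1) * (e / (gaussian_constant + 1))"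
      using gc \<open>e > 0\<close> by (intro mult_right_mono) auto
    also have "\<dots> = e" using gc by simp
    finally have "ennreal (gaussian_constant * (e / (gaussian_constant + 1))) \<le> ennreal e" by (rule ennreal_leI)
    moreover have "e / (gaussian_constant + 1) > 0" using gc \<open>e > 0\<close> by simp
    ultimately show "I \<le> 0 + ennreal e" using le[of "e / (gaussian_constant + 1)"] by simp
  qed
  with \<open>I \<noteq> 0\<close> show False by simp
qed

end

section \<open>From Gaussian variances to Lebesgue measure\<close>

lemma two_mult_le_sum_squares_ennreal: "2 * (a * b) \<le> a\<^sup>2 + (b::ennreal)\<^sup>2"
proof (cases "a = \<top> \<or> b = \<top>")
  case True
  then show ?thesis by (auto simp: power2_eq_square)
next
  case False
  then obtain x y where x: "a = ennreal x" "0 \<le> x" and y: "b = ennreal y" "0 \<le> y"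
    by (cases a; cases b) auto
  have "0 \<le> (x - y)\<^sup>2" by simp
  then have "2 * (x * y) \<le> x\<^sup>2 + y\<^sup>2" by (simp add: power2_diff)
  then have "ennreal (2 * (x * y)) \<le> ennreal (x\<^sup>2 + y\<^sup>2)" by (rule ennreal_leI)
  then show ?thesis using x y by (simp add: ennreal_mult ennreal_power)
qed

text \<open>The Gaussian probability density with covariance \<open>1 / \<tau>\<close> times the identity.\<close>

definition heat_kernel :: "real \<Rightarrow> 'a::euclidean_space \<Rightarrow> ennreal" where
  "heat_kernel \<tau> x = ennreal (exp (- (\<tau> / 2) * (norm x)\<^sup>2) / sqrt (pi / (\<tau> / 2)) ^ DIM('a))"

lemma measurable_heat_kernel [measurable]: "heat_kernel \<tau> \<in> borel_measurable borel"
  unfolding heat_kernel_def[abs_def] by measurable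

lemma nn_integral_heat_kernel:
  assumes "\<tau> > 0"
  shows "(\<integral>\<^sup>+x. heat_kernel \<tau> (x::'a::euclidean_space) \<partial>lborel) = 1"
proof -
  define c where "c = sqrt (pi / (\<tau> / 2)) ^ DIM('a)"
  have c: "c > 0" using assms by (simp add: c_def)
  have "\<tau> / 2 > 0" using assms by simp
  note g = nn_integral_gaussian[OF this, where 'a='a, folded c_def]
  have "(\<integral>\<^sup>+x. heat_kernel \<tau> (x::'a) \<partial>lborel)
    = (\<integral>\<^sup>+x. ennreal (1 / c) * ennreal (exp (- (\<tau> / 2) * (norm (x::'a))\<^sup>2)) \<partial>lborel)"
    unfolding heat_kernel_def c_def[symmetric] using c
    by (intro nn_integral_cong) (simp add: ennreal_mult[symmetric])
  also have "\<dots> = ennreal (1 / c) * ennreal c"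
    unfolding g[symmetric] by (rule nn_integral_cmult) measurable
  finally show ?thesis using c by (simp add: ennreal_mult[symmetric])
qed

lemma heat_kernel_scale:
  assumes "\<tau> > 0"
  shows "ennreal ((1 / sqrt \<tau>) ^ DIM('a)) * heat_kernel \<tau> (- (1 / sqrt \<tau>) *\<^sub>R (u::'a::euclidean_space)) = heat_kernel 1 u"
proof -
  have e: "- (\<tau> / 2) * (norm (- (1 / sqrt \<tau>) *\<^sub>R u))\<^sup>2 = - (1 / 2) * (norm u)\<^sup>2"
    using assms by (simp add: power_mult_distrib power_divide)
  have "sqrt (pi / (\<tau> / 2)) = sqrt (pi / (1 / 2)) * (1 / sqrt \<tau>)"
    by (simp add: real_sqrt_divide real_sqrt_mult)
  then have c: "sqrt (pi / (\<tau> / 2)) ^ DIM('a) = sqrt (pi / (1 / 2)) ^ DIM('a) * (1 / sqrt \<tau>) ^ DIM('a)"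
    by (simp only: power_mult_distrib)
  have "(1 / sqrt \<tau>) ^ DIM('a) > 0" using assms by simp
  then show ?thesis
    unfolding heat_kernel_def e c using assms by (simp add: ennreal_mult[symmetric])
qed

definition smoothed :: "'a::euclidean_space set \<Rightarrow> real \<Rightarrow> 'a \<Rightarrow> ennreal" where
  "smoothed U \<tau> x = (\<integral>\<^sup>+t. indicator U t * heat_kernel \<tau> (x - t) \<partial>lborel)"

text \<open>Rescaling moves the dependence on \<open>\<tau>\<close> from the kernel to the set, which prepares dominated convergence.\<close>

lemma smoothed_eq:
  assumes "\<tau> > 0" and [measurable]: "U \<in> sets borel"
  shows "smoothed U \<tau> x = (\<integral>\<^sup>+u. indicator U (x + (1 / sqrt \<tau>) *\<^sub>R u) * heat_kernel 1 (u::'a::euclidean_space) \<partial>lborel)"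
proof -
  define s where "s = 1 / sqrt \<tau>"
  have s: "s > 0" using assms by (simp add: s_def)
  have "smoothed U \<tau> x = ennreal (\<bar>s\<bar> ^ DIM('a)) *
      (\<integral>\<^sup>+u. indicator U (x + s *\<^sub>R u) * heat_kernel \<tau> (x - (x + s *\<^sub>R u)) \<partial>lborel)"
    unfolding smoothed_def using s by (intro nn_integral_lborel_affine) auto
  also have "\<dots> = (\<integral>\<^sup>+u. ennreal (\<bar>s\<bar> ^ DIM('a)) * (indicator U (x + s *\<^sub>R u) * heat_kernel \<tau> (x - (x + s *\<^sub>R u))) \<partial>lborel)"
    by (rule nn_integral_cmult[symmetric]) measurable
  also have "\<dots> = (\<integral>\<^sup>+u. indicator U (x + s *\<^sub>R u) * heat_kernel 1 (u::'a) \<partial>lborel)"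
  proof (rule nn_integral_cong)
    fix u :: 'a
    have e: "x - (x + s *\<^sub>R u) = - s *\<^sub>R u" by simp
    have h: "ennreal (\<bar>s\<bar> ^ DIM('a)) * heat_kernel \<tau> (- s *\<^sub>R u) = heat_kernel 1 u"
      using heat_kernel_scale[OF assms(1), of u, folded s_def] s by simp
    show "ennreal (\<bar>s\<bar> ^ DIM('a)) * (indicator U (x + s *\<^sub>R u) * heat_kernel \<tau> (x - (x + s *\<^sub>R u)))
      = indicator U (x + s *\<^sub>R u) * heat_kernel 1 u"
      unfolding e mult.left_commute[of _ "indicator U (x + s *\<^sub>R u)"] h ..
  qed
  finally show ?thesis unfolding s_def .
qed

lemma smoothed_tendsto_1:
  fixes x :: "'a::euclidean_space"
  assumes U: "open U" "x \<in> U" and \<tau>: "filterlim \<tau> at_top sequentially" "\<And>k. \<tau> k > 0"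
  shows "(\<lambda>k. smoothed U (\<tau> k) x) \<longlonglongrightarrow> 1"
proof -
  have [measurable]: "U \<in> sets borel" using U by auto
  have "(\<lambda>k. \<integral>\<^sup>+u. indicator U (x + (1 / sqrt (\<tau> k)) *\<^sub>R u) * heat_kernel 1 (u::'a) \<partial>lborel)
    \<longlonglongrightarrow> (\<integral>\<^sup>+u. heat_kernel 1 (u::'a) \<partial>lborel)"
  proof (rule nn_integral_dominated_convergence[where w="heat_kernel 1"])
    have "((\<lambda>k. 1 / sqrt (\<tau> k)) \<longlongrightarrow> 0) sequentially"
    proof -
      have "filterlim (\<lambda>k. sqrt (\<tau> k)) at_top sequentially"
        by (rule filterlim_compose[OF sqrt_at_top \<tau>(1)])
      then show ?thesis
        using tendsto_inverse_0_at_top by (simp add: divide_inverse)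
    qed
    then have "(\<lambda>k. x + (1 / sqrt (\<tau> k)) *\<^sub>R u) \<longlonglongrightarrow> x + 0 *\<^sub>R u" for u
      by (intro tendsto_intros)
    then have ev: "\<forall>\<^sub>F k in sequentially. x + (1 / sqrt (\<tau> k)) *\<^sub>R u \<in> U" for u
      using U by (intro topological_tendstoD) auto
    have "(\<lambda>k. indicator U (x + (1 / sqrt (\<tau> k)) *\<^sub>R u) * heat_kernel 1 u) \<longlonglongrightarrow> heat_kernel 1 u" for u
      by (rule tendsto_eventually, use ev[of u] in eventually_elim) simp
    then show "AE u in lborel. (\<lambda>k. indicator U (x + (1 / sqrt (\<tau> k)) *\<^sub>R u) * heat_kernel 1 u) \<longlonglongrightarrow> heat_kernel 1 u"
      by simp
    show "(\<integral>\<^sup>+u. heat_kernel 1 (u::'a) \<partial>lborel) < \<infinity>" by (simp add: nn_integral_heat_kernel)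
  qed (auto simp: indicator_def)
  then show ?thesis using \<tau>(2) by (simp add: smoothed_eq nn_integral_heat_kernel)
qed

context stationary_random_measure
begin

text \<open>For \<open>s = t\<close> the integral is \<open>\<iota>\<^sup>2\<close>: the product of the factors then has the same diagonal integrals as a
multiple of \<open>gauss_pair\<close>.  The case of different centres follows from \<open>2 a b \<le> a\<^sup>2 + b\<^sup>2\<close>.\<close>

lemma pair_moment_heat_kernels:
  assumes "\<tau> > 0"
    and eq: "(\<integral>\<^sup>+z. gauss_pair \<tau> z \<partial>pair_moment)
      = ennreal (iota\<^sup>2) * (\<integral>\<^sup>+z. gauss_pair \<tau> z \<partial>(lborel :: ('a \<times> 'a) measure))"
  shows "(\<integral>\<^sup>+z. heat_kernel \<tau> (fst z - s) * heat_kernel \<tau> (snd z - t) \<partial>pair_moment) \<le> ennreal (iota\<^sup>2)"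
proof -
  define c where "c = sqrt (pi / (\<tau> / 2)) ^ DIM('a)"
  have c: "c > 0" using assms by (simp add: c_def)
  have h: "(\<lambda>x. heat_kernel \<tau> (x - s)) \<in> borel_measurable borel" for s :: 'a by measurable
  have diag: "(\<integral>\<^sup>+z. heat_kernel \<tau> (fst z - s) * heat_kernel \<tau> (snd z - s) \<partial>pair_moment) = ennreal (iota\<^sup>2)" for s :: 'a
  proof -
    have prod: "heat_kernel \<tau> x * heat_kernel \<tau> y = ennreal (1 / c\<^sup>2) * gauss_pair \<tau> (x, y)" for x y :: 'a
      unfolding gauss_pair_eq_prod heat_kernel_def c_def[symmetric] fst_conv snd_conv using c
      by (simp add: ennreal_mult[symmetric] power2_eq_square)
    have "(\<integral>\<^sup>+z. heat_kernel \<tau> (fst z - s) * heat_kernel \<tau> (snd z - s) \<partial>pair_moment)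
      = (\<integral>\<^sup>+z. ennreal (1 / c\<^sup>2) * gauss_pair \<tau> z \<partial>pair_moment)"
    proof (rule nn_integral_diagonal_invariant[OF diagonal_invariant_pair_moment])
      show "(\<lambda>z. heat_kernel \<tau> (fst z - s) * heat_kernel \<tau> (snd z - s)) \<in> borel_measurable borel"
        unfolding borel_prod[symmetric] by measurable
      fix x y :: 'a
      have "(\<integral>\<^sup>+t. heat_kernel \<tau> (fst (x + t, y + t) - s) * heat_kernel \<tau> (snd (x + t, y + t) - s) \<partial>lborel)
        = (\<integral>\<^sup>+t. ennreal (1 / c\<^sup>2) * gauss_pair \<tau> (x + (- s + t), y + (- s + t)) \<partial>lborel)"
        unfolding prod fst_conv snd_conv by (intro nn_integral_cong) (simp add: algebra_simps)
      also have "\<dots> = (\<integral>\<^sup>+t. ennreal (1 / c\<^sup>2) * gauss_pair \<tau> (x + t, y + t) \<partial>lborel)"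
        by (rule nn_integral_lborel_translate) measurable
      finally show "(\<integral>\<^sup>+t. heat_kernel \<tau> (fst (x + t, y + t) - s) * heat_kernel \<tau> (snd (x + t, y + t) - s) \<partial>lborel)
        = (\<integral>\<^sup>+t. ennreal (1 / c\<^sup>2) * gauss_pair \<tau> (x + t, y + t) \<partial>lborel)" .
    qed measurable
    also have "\<dots> = ennreal (1 / c\<^sup>2) * (ennreal (iota\<^sup>2) * ennreal (c\<^sup>2))"
      unfolding c_def nn_integral_gauss_pair_lborel[OF \<open>\<tau> > 0\<close>, symmetric] eq[symmetric]
      by (rule nn_integral_cmult) measurable
    also have "\<dots> = ennreal (iota\<^sup>2)"
      using c by (simp add: ennreal_mult[symmetric])
    finally show ?thesis .
  qed
  define X where "X s p = (\<integral>\<^sup>+x. heat_kernel \<tau> (x - s) \<partial>p)" for s and p :: "'a measure"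
  have [measurable]: "X s \<in> borel_measurable M" for s
    using mean.nn_integral_mixture[OF h[of s]] by (simp add: X_def[abs_def])
  have X2: "(\<integral>\<^sup>+p. (X s p)\<^sup>2 \<partial>M) = ennreal (iota\<^sup>2)" for s
    using diag[of s] unfolding pair_moment_product[OF h h] X_def power2_eq_square .
  have "2 * (\<integral>\<^sup>+p. X s p * X t p \<partial>M) = (\<integral>\<^sup>+p. 2 * (X s p * X t p) \<partial>M)"
    by (rule nn_integral_cmult[symmetric]) measurable
  also have "\<dots> \<le> (\<integral>\<^sup>+p. (X s p)\<^sup>2 + (X t p)\<^sup>2 \<partial>M)"
    by (intro nn_integral_mono two_mult_le_sum_squares_ennreal)
  also have "\<dots> = 2 * ennreal (iota\<^sup>2)"
    by (simp add: nn_integral_add X2 mult_2)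
  finally have "(\<integral>\<^sup>+p. X s p * X t p \<partial>M) \<le> ennreal (iota\<^sup>2)"
    by (simp add: ennreal_mult_le_mult_iff)
  then show ?thesis unfolding pair_moment_product[OF h h] X_def .
qed

lemma pair_moment_smoothed:
  assumes "\<tau> > 0" and [measurable]: "U \<in> sets borel"
    and eq: "(\<integral>\<^sup>+z. gauss_pair \<tau> z \<partial>pair_moment)
      = ennreal (iota\<^sup>2) * (\<integral>\<^sup>+z. gauss_pair \<tau> z \<partial>(lborel :: ('a \<times> 'a) measure))"
  shows "(\<integral>\<^sup>+z. smoothed U \<tau> (fst z) * smoothed U \<tau> (snd z) \<partial>pair_moment)
    \<le> ennreal (iota\<^sup>2) * (emeasure lborel U)\<^sup>2"
proof -
  interpret \<alpha>: sigma_finite_measure pair_moment by (rule sigma_finite_pair_moment)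
  interpret P: pair_sigma_finite pair_moment "lborel :: 'a measure" ..
  define f where "f s x = indicator U s * heat_kernel \<tau> (x - s)" for s x :: 'a
  have [measurable]: "(\<lambda>x. f s x) \<in> borel_measurable borel" "(\<lambda>s. f s x) \<in> borel_measurable borel" for s x
    unfolding f_def by measurable
  \<comment> \<open>the projections are measurable for the product form of the Borel algebra\<close>
  have c0: "sets pair_moment = sets ((borel :: 'a measure) \<Otimes>\<^sub>M (borel :: 'a measure))"
    unfolding borel_prod by (rule sets_pair_moment)
  have c: "sets (pair_moment \<Otimes>\<^sub>M (lborel :: 'a measure)) = sets (((borel :: 'a measure) \<Otimes>\<^sub>M (borel :: 'a measure)) \<Otimes>\<^sub>M (borel :: 'a measure))"
    by (intro sets_pair_measure_cong sets_lborel c0)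
  have "(\<integral>\<^sup>+z. smoothed U \<tau> (fst z) * smoothed U \<tau> (snd z) \<partial>pair_moment)
    = (\<integral>\<^sup>+z. (\<integral>\<^sup>+s. (\<integral>\<^sup>+t. f s (fst z) * f t (snd z) \<partial>lborel) \<partial>lborel) \<partial>pair_moment)"
    unfolding smoothed_def f_def[symmetric]
    by (simp add: nn_integral_cmult nn_integral_multc)
  also have "\<dots> = (\<integral>\<^sup>+s. (\<integral>\<^sup>+z. (\<integral>\<^sup>+t. f s (fst z) * f t (snd z) \<partial>lborel) \<partial>pair_moment) \<partial>lborel)"
    by (rule P.Fubini'[symmetric]) (unfold f_def measurable_cong_sets[OF c refl], measurable)
  also have "\<dots> = (\<integral>\<^sup>+s. (\<integral>\<^sup>+t. (\<integral>\<^sup>+z. f s (fst z) * f t (snd z) \<partial>pair_moment) \<partial>lborel) \<partial>lborel)"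
    by (intro nn_integral_cong P.Fubini'[symmetric]) (unfold f_def measurable_cong_sets[OF c refl], measurable)
  also have "\<dots> \<le> (\<integral>\<^sup>+s. (\<integral>\<^sup>+t. indicator U s * (indicator U t * ennreal (iota\<^sup>2)) \<partial>lborel) \<partial>lborel)"
  proof (intro nn_integral_mono)
    fix s t :: 'a
    have "(\<integral>\<^sup>+z. f s (fst z) * f t (snd z) \<partial>pair_moment)
      = (\<integral>\<^sup>+z. indicator U s * indicator U t * (heat_kernel \<tau> (fst z - s) * heat_kernel \<tau> (snd z - t)) \<partial>pair_moment)"
      by (intro nn_integral_cong) (simp add: f_def mult_ac)
    also have "\<dots> = indicator U s * indicator U t * (\<integral>\<^sup>+z. heat_kernel \<tau> (fst z - s) * heat_kernel \<tau> (snd z - t) \<partial>pair_moment)"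
      by (rule nn_integral_cmult) (unfold measurable_cong_sets[OF c0 refl], measurable)
    also have "\<dots> \<le> indicator U s * indicator U t * ennreal (iota\<^sup>2)"
      by (intro mult_left_mono pair_moment_heat_kernels assms) auto
    finally show "(\<integral>\<^sup>+z. f s (fst z) * f t (snd z) \<partial>pair_moment) \<le> indicator U s * (indicator U t * ennreal (iota\<^sup>2))"
      by (simp add: mult.assoc)
  qed
  also have "\<dots> = ennreal (iota\<^sup>2) * (emeasure lborel U)\<^sup>2"
    by (simp add: nn_integral_cmult nn_integral_multc power2_eq_square mult_ac)
  finally show ?thesis .
qed

text \<open>On an open set the smoothed indicators converge to \<open>1\<close>, so Fatou's lemma transfers the bound
of \<open>pair_moment_smoothed\<close> to the set itself.\<close>

lemma AE_open_emeasure_eq: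
  assumes good: "\<And>k. k \<ge> 1 \<Longrightarrow> \<exists>\<tau>>k. (\<integral>\<^sup>+z. gauss_pair \<tau> z \<partial>pair_moment)
      = ennreal (iota\<^sup>2) * (\<integral>\<^sup>+z. gauss_pair \<tau> z \<partial>(lborel :: ('a \<times> 'a) measure))"
    and U: "open U" "bounded U"
  shows "AE p in M. emeasure p U = ennreal iota * emeasure lborel U"
proof -
  have U' [measurable]: "U \<in> sets borel" using U by auto
  have "\<forall>k::nat. \<exists>\<tau>. \<tau> > real (Suc k) \<and> (\<integral>\<^sup>+z. gauss_pair \<tau> z \<partial>pair_moment)
      = ennreal (iota\<^sup>2) * (\<integral>\<^sup>+z. gauss_pair \<tau> z \<partial>(lborel :: ('a \<times> 'a) measure))"
    using good[of "real (Suc _)"] by simp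
  from choice[OF this] obtain \<tau> where \<tau>: "\<And>k. \<tau> k > real (Suc k)"
    and eq: "\<And>k. (\<integral>\<^sup>+z. gauss_pair (\<tau> k) z \<partial>pair_moment)
      = ennreal (iota\<^sup>2) * (\<integral>\<^sup>+z. gauss_pair (\<tau> k) z \<partial>(lborel :: ('a \<times> 'a) measure))" by blast
  have pos: "\<tau> k > 0" for k using \<tau>[of k] by linarith
  have "filterlim (\<lambda>k. real (Suc k)) at_top sequentially"
    by (rule filterlim_compose[OF filterlim_real_sequentially filterlim_Suc])
  then have lim: "filterlim \<tau> at_top sequentially"
    by (rule filterlim_at_top_mono) (intro always_eventually allI less_imp_le \<tau>)
  have [measurable]: "smoothed U (\<tau> k) \<in> borel_measurable borel" for k
    unfolding smoothed_def[abs_def] by measurable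
  have UU: "U \<times> U \<in> sets borel" using U by (intro borel_open open_Times)
  have m: "(\<lambda>z. smoothed U (\<tau> k) (fst z) * smoothed U (\<tau> k) (snd z)) \<in> borel_measurable borel" for k
    unfolding borel_prod[symmetric] by measurable
  have "(\<integral>\<^sup>+p. (emeasure p U)\<^sup>2 \<partial>M) = (\<integral>\<^sup>+z. indicator (U \<times> U) z \<partial>pair_moment)"
    using UU by (simp add: pair_moment_square sets_pair_moment)
  also have "\<dots> \<le> (\<integral>\<^sup>+z. liminf (\<lambda>k. smoothed U (\<tau> k) (fst z) * smoothed U (\<tau> k) (snd z)) \<partial>pair_moment)"
  proof (rule nn_integral_mono)
    fix z :: "'a \<times> 'a"
    show "indicator (U \<times> U) z \<le> liminf (\<lambda>k. smoothed U (\<tau> k) (fst z) * smoothed U (\<tau> k) (snd z))"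
    proof (cases "z \<in> U \<times> U")
      case True
      then have "(\<lambda>k. smoothed U (\<tau> k) (fst z)) \<longlonglongrightarrow> 1" "(\<lambda>k. smoothed U (\<tau> k) (snd z)) \<longlonglongrightarrow> 1"
        using smoothed_tendsto_1[OF U(1) _ lim pos] by auto
      then have "(\<lambda>k. smoothed U (\<tau> k) (fst z) * smoothed U (\<tau> k) (snd z)) \<longlonglongrightarrow> 1 * 1"
        by (intro tendsto_mult_ennreal) auto
      then have "liminf (\<lambda>k. smoothed U (\<tau> k) (fst z) * smoothed U (\<tau> k) (snd z)) = 1"
        by (intro lim_imp_Liminf) auto
      then show ?thesis using True by simp
    qed simp
  qed
  also have "\<dots> \<le> liminf (\<lambda>k. \<integral>\<^sup>+z. smoothed U (\<tau> k) (fst z) * smoothed U (\<tau> k) (snd z) \<partial>pair_moment)"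
    using m by (intro nn_integral_liminf) (simp add: sets_pair_moment cong: measurable_cong_sets)
  also have "\<dots> \<le> liminf (\<lambda>k::nat. ennreal (iota\<^sup>2) * (emeasure lborel U)\<^sup>2)"
    by (intro Liminf_mono always_eventually allI pair_moment_smoothed pos U' eq)
  also have "\<dots> = ennreal (iota\<^sup>2) * (emeasure lborel U)\<^sup>2"
    by (intro Liminf_const) simp
  also have "\<dots> = ennreal ((iota * measure lborel U)\<^sup>2)"
    using emeasure_bounded_finite[OF U(2)]
    by (simp add: emeasure_eq_ennreal_measure less_top power_mult_distrib ennreal_mult ennreal_power)
  finally have second: "(\<integral>\<^sup>+p. (emeasure p U)\<^sup>2 \<partial>M) \<le> ennreal ((iota * measure lborel U)\<^sup>2)" .
  have e: "ennreal iota * emeasure lborel U = ennreal (iota * measure lborel U)"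
    using emeasure_bounded_finite[OF U(2)] iota_nonneg
    by (simp add: emeasure_eq_ennreal_measure less_top ennreal_mult)
  show ?thesis
    unfolding e using iota_nonneg
    by (intro AE_eq_mean borel_measurable_emeasure U' second) (simp_all add: nn_integral_emeasure e)
qed

text \<open>Only countably many null sets may be discarded.  Finite intersections of a countable basis, cut off
by balls of integer radius, form a countable intersection-stable generator of bounded open sets.\<close>

lemma almost_surely_lebesgueI:
  assumes open_eq: "\<And>U. open U \<Longrightarrow> bounded U \<Longrightarrow> AE p in M. emeasure p U = ennreal iota * emeasure lborel U"
  shows "almost_surely_lebesgue M"
proof -
  obtain B :: "'a set set" where B: "countable B" "topological_basis B" using ex_countable_basis by blast
  define cell where "cell = (\<lambda>(N::nat, F). ball (0::'a) (real N) \<inter> \<Inter>F)"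
  define I where "I = (UNIV :: nat set) \<times> {F. finite F \<and> F \<subseteq> B}"
  have I: "countable I"
    unfolding I_def using B(1) by (intro countable_SIGMA countable_Collect_finite_subset) auto
  define E where "E = cell ` I"
  have E: "open U \<and> bounded U" if "U \<in> E" for U
  proof -
    from that obtain N F where U: "U = ball 0 (real N) \<inter> \<Inter>F" "finite F" "F \<subseteq> B"
      by (auto simp: E_def I_def cell_def)
    moreover have "open b" if "b \<in> F" for b using that U(3) B(2) by (auto intro: topological_basis_open)
    ultimately show ?thesis by (auto intro!: open_Int open_Inter bounded_Int)
  qed
  have "Int_stable E"
  proof (rule Int_stableI)
    fix U V assume "U \<in> E" "V \<in> E"
    then obtain N F N' F' where UV: "U = ball 0 (real N) \<inter> \<Inter>F" "finite F" "F \<subseteq> B"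
      "V = ball 0 (real N') \<inter> \<Inter>F'" "finite F'" "F' \<subseteq> B"
      by (auto simp: E_def I_def cell_def)
    have "U \<inter> V = cell (min N N', F \<union> F')" by (auto simp: UV cell_def)
    moreover have "(min N N', F \<union> F') \<in> I" using UV by (auto simp: I_def)
    ultimately show "U \<inter> V \<in> E" unfolding E_def by blast
  qed
  have gen: "sets (borel :: 'a measure) = sigma_sets UNIV E"
  proof (rule antisym)
    have "b \<in> sigma_sets UNIV E" if "b \<in> B" for b
    proof -
      have "b = (\<Union>N. cell (N, {b}))" by (auto simp: cell_def reals_Archimedean2)
      moreover have "cell (N, {b}) \<in> sigma_sets UNIV E" for N
        using that by (intro sigma_sets.Basic) (auto simp: E_def I_def)
      ultimately show ?thesis using sigma_sets.Union[of "\<lambda>N. cell (N, {b})" UNIV E] by simp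
    qed
    then have "sigma_sets UNIV B \<subseteq> sigma_sets UNIV E"
      by (intro sigma_sets_mono) auto
    then show "sets (borel :: 'a measure) \<subseteq> sigma_sets UNIV E"
      unfolding borel_eq_countable_basis[OF B] by simp
    show "sigma_sets UNIV E \<subseteq> sets (borel :: 'a measure)"
    proof -
      have "E \<subseteq> sets (borel :: 'a measure)" using E by (blast intro: borel_open)
      then show ?thesis using sets.sigma_sets_subset[of E "borel :: 'a measure"] by simp
    qed
  qed
  have "AE p in M. \<forall>i\<in>I. emeasure p (cell i) = ennreal iota * emeasure lborel (cell i)"
    using E by (intro AE_ball_countable' I open_eq) (auto simp: E_def)
  moreover have "AE p in M. p \<in> space M" by simp
  ultimately have "AE p in M. p = scale_measure (ennreal iota) lborel"
  proof eventually_elim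
    case (elim p)
    show ?case
    proof (rule measure_eqI_generator_eq[where \<Omega>=UNIV and E=E and A="\<lambda>N. cell (N, {})"])
      show "Int_stable E" by fact
      show "emeasure p U = emeasure (scale_measure (ennreal iota) lborel) U" if "U \<in> E" for U
        using elim that by (auto simp: E_def)
      show "sets p = sigma_sets UNIV E" using elim by (simp add: sets_realisation gen)
      show "sets (scale_measure (ennreal iota) lborel) = sigma_sets UNIV E" by (simp add: gen)
      show "range (\<lambda>N. cell (N, {})) \<subseteq> E" by (auto simp: E_def I_def)
      show "(\<Union>N. cell (N, {})) = UNIV" by (auto simp: cell_def reals_Archimedean2)
      show "emeasure p (cell (N, {})) \<noteq> \<infinity>" for N
        using elim finite_realisation[of p "ball 0 (real N)"] by (auto simp: cell_def)
    qed auto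
  qed
  then show ?thesis unfolding almost_surely_lebesgue_def intensity_eq .
qed

lemma number_variance_not_negligible:
  assumes "\<not> almost_surely_lebesgue M"
  shows "\<exists>\<epsilon>>0. \<forall>R0. \<exists>R\<ge>R0. number_variance M R > ennreal (\<epsilon> * R ^ (DIM('a) - 1))"
proof (rule ccontr)
  assume "\<not> ?thesis"
  then have small: "\<exists>R0. \<forall>R\<ge>R0. number_variance M R \<le> ennreal (\<epsilon> * R ^ (DIM('a) - 1))" if "\<epsilon> > 0" for \<epsilon>
    using that by (meson not_le)
  show False
    using assms almost_surely_lebesgueI AE_open_emeasure_eq[OF gauss_pair_moment_eq[OF small]] by blast
qed

end

section \<open>The lower bound for the number variance\<close>

lemma Limsup_number_variance_pos:
  fixes M :: "'a::euclidean_space measure measure"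
  assumes "random_measure M" "translation_invariant M" "locally_square_integrable M"
    and "\<not> almost_surely_lebesgue M"
  shows "Limsup at_top (\<lambda>R::real. number_variance M R /
           hausdorff_measure (DIM('a) - 1) (frontier (ball (0::'a) R))) > 0"
proof -
  interpret stationary_random_measure M by unfold_locales fact+
  let ?n = "DIM('a) - 1"
  let ?H = "\<lambda>R. hausdorff_measure ?n (frontier (ball (0::'a) R))"
  define K where "K = 2 * DIM('a) * unit_ball_vol (real ?n) * (2 * DIM('a)) ^ ?n"
  have K: "K > 0" by (simp add: K_def)
  have H: "?H R \<le> ennreal (K * R ^ ?n)" if "R > 0" for R
    using hausdorff_measure_sphere_le[OF that, where 'a='a] that by (simp add: frontier_ball K_def)
  obtain \<epsilon> where \<epsilon>: "\<epsilon> > 0" and large: "\<And>R0. \<exists>R\<ge>R0. number_variance M R > ennreal (\<epsilon> * R ^ ?n)"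
    using number_variance_not_negligible[OF assms(4)] by blast
  have "ennreal (\<epsilon> / K) \<le> Limsup at_top (\<lambda>R. number_variance M R / ?H R)"
  proof (rule ccontr)
    assume "\<not> ?thesis"
    then have "Limsup at_top (\<lambda>R. number_variance M R / ?H R) < ennreal (\<epsilon> / K)" by simp
    then have "\<forall>\<^sub>F R in at_top. number_variance M R / ?H R < ennreal (\<epsilon> / K)"
      by (rule Limsup_lessD)
    then obtain R0 where R0: "\<And>R. R \<ge> R0 \<Longrightarrow> number_variance M R / ?H R < ennreal (\<epsilon> / K)"
      unfolding eventually_at_top_linorder by blast
    obtain R where R: "R \<ge> max R0 1" and nv: "number_variance M R > ennreal (\<epsilon> * R ^ ?n)"
      using large by blast
    have "R > 0" using R by simp
    have q: "number_variance M R / ?H R < ennreal (\<epsilon> / K)" using R0[of R] R by simp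
    have "?H R \<noteq> 0"
    proof
      assume "?H R = 0"
      moreover have "number_variance M R \<noteq> 0" using nv by auto
      ultimately show False using q by simp
    qed
    moreover have "?H R < \<top>" using H[OF \<open>R > 0\<close>] by (rule order.strict_trans1) simp
    ultimately have "number_variance M R < ennreal (\<epsilon> / K) * ?H R"
      using q divide_less_ennreal by blast
    also have "\<dots> \<le> ennreal (\<epsilon> / K) * ennreal (K * R ^ ?n)"
      by (intro mult_left_mono H \<open>R > 0\<close>) simp
    also have "\<dots> = ennreal (\<epsilon> * R ^ ?n)"
      using \<epsilon> K \<open>R > 0\<close> by (simp add: ennreal_mult[symmetric])
    finally show False using nv by simp
  qed
  moreover have "ennreal (\<epsilon> / K) > 0" using \<epsilon> K by simp
  ultimately show ?thesis by (rule less_le_trans[rotated])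
qed

theorem theorem1p1:
  fixes M :: "(real ^ 'n) measure measure"
  assumes "random_measure M"
    and "translation_invariant M"
    and "locally_square_integrable M"
    and "intensity M > 0"
    and "\<not> almost_surely_lebesgue M"
  shows "Limsup at_top (\<lambda>R::real. number_variance M R /
           hausdorff_measure (CARD('n) - 1) (frontier (ball (0 :: real ^ 'n) R))) > 0"
  using Limsup_number_variance_pos[OF assms(1-3,5)] by simp

end
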